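(* Let $\Gamma$ be a discrete group acting smoothly, freely, properly, and cocompactly on a smooth manifold $M$. Let $\pi:M\to M/\Gamma$ be the projection map. Then: (1) The pullback $\pi^*:\mathcal{E}(M/\Gamma)\to\mathcal{E}(M)^\Gamma$, $\pi^*(h)=h\circ\pi$, is a topological isomorphism of Fréchet spaces under the standard $C^\infty$ topology. (2) There exist smooth invariants $\sigma_1,\dots,\sigma_m\in\mathcal{E}(M)^\Gamma$ (for some $m\in\mathbb{N}$) such that $$\sigma^*\mathcal{E}(\mathbb{R}^m)=\mathcal{E}(M)^\Gamma,$$ where $\sigma=(\sigma_1,\dots,\sigma_m):M\to\mathbb{R}^m$. (3) For any smooth manifold $X$ with trivial $\Gamma$-action, $$(\mathrm{id}\times\sigma)^*\mathcal{E}(X\times\mathbb{R}^m)=\mathcal{E}(X\times M)^\Gamma,$$ where $\sigma$ is the map of part (2).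
   Context: For a smooth manifold $N$, $\mathcal{E}(N)$ is the algebra of real-valued smooth functions on $N$ with the $C^\infty$ topology (uniform convergence of all derivatives on compact sets). If $\Gamma$ acts on $N$, $\mathcal{E}(N)^\Gamma$ is the subalgebra of $\Gamma$-invariant functions, with the subspace topology. On $X\times M$ the group acts by $\gamma\cdot(x,p)=(x,\gamma\cdot p)$. For a smooth map $\varphi:N\to N'$, $\varphi^*F=F\circ\varphi$ and $\varphi^*\mathcal{E}(N')=\{F\circ\varphi: F\in\mathcal{E}(N')\}$; $\mathrm{id}\times\sigma:X\times M\to X\times\mathbb{R}^m$ is $(x,p)\mapsto(x,\sigma(p))$. The action is cocompact if $M/\Gamma$ is compact, and proper if $\Gamma\times M\to M\times M$, $(\gamma,p)\mapsto(\gamma\cdot p,p)$, is a proper map ($\Gamma$ having the discrete topology). The quotient $M/\Gamma$ carries its unique smooth manifold structure for which $\pi$ is a smooth covering map. Manifolds are Hausdorff, second countable and without boundary. *)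

theory Defs
  imports "HOL-Analysis.Analysis" "HOL-Algebra.Group_Action"
begin

section \<open>Smooth functions on open subsets of Euclidean space\<close>

text \<open>
  The space of real $n$-tuples is the library's \<^term>\<open>Euclidean_space n\<close>: functions
  \<^typ>\<open>nat \<Rightarrow> real\<close> that vanish from index \<^term>\<open>n\<close> on. This allows the dimension to be bound by
  a quantifier and to be \<open>0\<close>.
\<close>

definition partial_deriv :: "nat \<Rightarrow> ((nat \<Rightarrow> real) \<Rightarrow> real) \<Rightarrow> (nat \<Rightarrow> real) \<Rightarrow> real" where
  "partial_deriv i f x = deriv (\<lambda>t. f (x(i := t))) (x i)"

definition iter_partial :: "nat list \<Rightarrow> ((nat \<Rightarrow> real) \<Rightarrow> real) \<Rightarrow> (nat \<Rightarrow> real) \<Rightarrow> real" where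
  "iter_partial js f = foldr partial_deriv js f"

text \<open>
  All iterated partial derivatives exist and are continuous. This is only meant for \<open>W\<close> open in
  \<^term>\<open>Euclidean_space n\<close>; then values of \<open>f\<close> outside \<open>W\<close> are irrelevant.
\<close>

definition smooth_fun_on :: "nat \<Rightarrow> (nat \<Rightarrow> real) set \<Rightarrow> ((nat \<Rightarrow> real) \<Rightarrow> real) \<Rightarrow> bool" where
  "smooth_fun_on n W f \<longleftrightarrow>
     (\<forall>js \<in> lists {..<n}.
        continuous_map (subtopology (Euclidean_space n) W) euclideanreal (iter_partial js f) \<and>
        (\<forall>i<n. \<forall>x\<in>W. (\<lambda>t. iter_partial js f (x(i := t))) differentiable (at (x i))))"


section \<open>Smooth manifolds\<close>

text \<open>
  A chart is a pair of its domain and a coordinate map, whose values outside the domain are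
  never used. Smooth structures are maximal atlases.
\<close>

type_synonym 'a chart = "'a set \<times> ('a \<Rightarrow> nat \<Rightarrow> real)"

record 'a manifold =
  mdim :: nat
  mtop :: "'a topology"
  mcharts :: "'a chart set"

abbreviation mpoints :: "'a manifold \<Rightarrow> 'a set" where
  "mpoints N \<equiv> topspace (mtop N)"

definition is_chart :: "nat \<Rightarrow> 'a topology \<Rightarrow> 'a chart \<Rightarrow> bool" where
  "is_chart n T = (\<lambda>(U, \<phi>).
     openin T U \<and> openin (Euclidean_space n) (\<phi> ` U) \<and>
     homeomorphic_map (subtopology T U) (subtopology (Euclidean_space n) (\<phi> ` U)) \<phi>)"

definition smooth_transition :: "nat \<Rightarrow> 'a chart \<Rightarrow> 'a chart \<Rightarrow> bool" where
  "smooth_transition n = (\<lambda>(U, \<phi>) (V, \<psi>).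
     \<forall>i<n. smooth_fun_on n (\<phi> ` (U \<inter> V)) (\<lambda>y. \<psi> (inv_into U \<phi> y) i))"

definition compatible_charts :: "nat \<Rightarrow> 'a chart \<Rightarrow> 'a chart \<Rightarrow> bool" where
  "compatible_charts n c d \<longleftrightarrow> smooth_transition n c d \<and> smooth_transition n d c"

definition atlas :: "nat \<Rightarrow> 'a topology \<Rightarrow> 'a chart set \<Rightarrow> bool" where
  "atlas n T A \<longleftrightarrow>
     (\<forall>c\<in>A. is_chart n T c) \<and> (\<Union>(U, \<phi>)\<in>A. U) = topspace T \<and>
     (\<forall>c\<in>A. \<forall>d\<in>A. compatible_charts n c d)"

definition maximal_atlas :: "nat \<Rightarrow> 'a topology \<Rightarrow> 'a chart set \<Rightarrow> 'a chart set" where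
  "maximal_atlas n T A = {c. is_chart n T c \<and> (\<forall>d\<in>A. compatible_charts n c d)}"

definition smooth_manifold :: "'a manifold \<Rightarrow> bool" where
  "smooth_manifold N \<longleftrightarrow>
     Hausdorff_space (mtop N) \<and> second_countable (mtop N) \<and>
     atlas (mdim N) (mtop N) (mcharts N) \<and>
     maximal_atlas (mdim N) (mtop N) (mcharts N) = mcharts N"

definition euclidean_manifold :: "nat \<Rightarrow> (nat \<Rightarrow> real) manifold" where
  "euclidean_manifold m =
     \<lparr>mdim = m, mtop = Euclidean_space m,
      mcharts = maximal_atlas m (Euclidean_space m) {(topspace (Euclidean_space m), \<lambda>x. x)}\<rparr>"

definition prod_chart :: "nat \<Rightarrow> 'a chart \<Rightarrow> 'b chart \<Rightarrow> ('a \<times> 'b) chart" where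
  "prod_chart k = (\<lambda>(U, \<phi>) (V, \<psi>).
     (U \<times> V, \<lambda>(x, y) i. if i < k then \<phi> x i else \<psi> y (i - k)))"

definition prod_manifold :: "'a manifold \<Rightarrow> 'b manifold \<Rightarrow> ('a \<times> 'b) manifold" where
  "prod_manifold X Y =
     \<lparr>mdim = mdim X + mdim Y, mtop = prod_topology (mtop X) (mtop Y),
      mcharts = maximal_atlas (mdim X + mdim Y) (prod_topology (mtop X) (mtop Y))
        {prod_chart (mdim X) c d | c d. c \<in> mcharts X \<and> d \<in> mcharts Y}\<rparr>"

definition open_submanifold :: "'a manifold \<Rightarrow> 'a set \<Rightarrow> 'a manifold" where
  "open_submanifold N U =
     \<lparr>mdim = mdim N, mtop = subtopology (mtop N) U,
      mcharts = {(V, \<psi>). (V, \<psi>) \<in> mcharts N \<and> V \<subseteq> U}\<rparr>"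

definition smooth_map :: "'a manifold \<Rightarrow> 'b manifold \<Rightarrow> ('a \<Rightarrow> 'b) \<Rightarrow> bool" where
  "smooth_map N N' f \<longleftrightarrow> f \<in> mpoints N \<rightarrow> mpoints N' \<and>
     (\<forall>p\<in>mpoints N. \<exists>(U, \<phi>)\<in>mcharts N. \<exists>(V, \<psi>)\<in>mcharts N'. p \<in> U \<and> f ` U \<subseteq> V \<and>
        (\<forall>i<mdim N'. smooth_fun_on (mdim N) (\<phi> ` U) (\<lambda>y. \<psi> (f (inv_into U \<phi> y)) i)))"

definition diffeomorphism :: "'a manifold \<Rightarrow> 'b manifold \<Rightarrow> ('a \<Rightarrow> 'b) \<Rightarrow> bool" where
  "diffeomorphism N N' f \<longleftrightarrow> bij_betw f (mpoints N) (mpoints N') \<and>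
     smooth_map N N' f \<and> smooth_map N' N (inv_into (mpoints N) f)"

definition smooth_covering_map :: "'a manifold \<Rightarrow> 'b manifold \<Rightarrow> ('a \<Rightarrow> 'b) \<Rightarrow> bool" where
  "smooth_covering_map N B p \<longleftrightarrow>
     smooth_map N B p \<and> p ` mpoints N = mpoints B \<and>
     (\<forall>b\<in>mpoints B. \<exists>V. openin (mtop B) V \<and> b \<in> V \<and>
        (\<exists>\<U>. \<Union>\<U> = {x \<in> mpoints N. p x \<in> V} \<and> (\<forall>U\<in>\<U>. openin (mtop N) U) \<and>
             pairwise disjnt \<U> \<and>
             (\<forall>U\<in>\<U>. diffeomorphism (open_submanifold N U) (open_submanifold B V) p)))"


section \<open>Function spaces and Frechet spaces\<close>

text \<open>
  Real-valued functions on a set \<open>S\<close> are represented by elements of \<^term>\<open>extensional S\<close>, so that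
  equality of functions on \<open>S\<close> is equality in HOL. Vector space operations are pointwise.
\<close>

definition fun_add :: "'a set \<Rightarrow> ('a \<Rightarrow> real) \<Rightarrow> ('a \<Rightarrow> real) \<Rightarrow> 'a \<Rightarrow> real" where
  "fun_add S f g = (\<lambda>x\<in>S. f x + g x)"

definition fun_diff :: "'a set \<Rightarrow> ('a \<Rightarrow> real) \<Rightarrow> ('a \<Rightarrow> real) \<Rightarrow> 'a \<Rightarrow> real" where
  "fun_diff S f g = (\<lambda>x\<in>S. f x - g x)"

definition fun_scale :: "'a set \<Rightarrow> real \<Rightarrow> ('a \<Rightarrow> real) \<Rightarrow> 'a \<Rightarrow> real" where
  "fun_scale S c f = (\<lambda>x\<in>S. c * f x)"

definition linear_function_space :: "'a set \<Rightarrow> ('a \<Rightarrow> real) set \<Rightarrow> bool" where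
  "linear_function_space S V \<longleftrightarrow> V \<subseteq> extensional S \<and> (\<lambda>x\<in>S. 0) \<in> V \<and>
     (\<forall>f\<in>V. \<forall>g\<in>V. fun_add S f g \<in> V) \<and> (\<forall>c. \<forall>f\<in>V. fun_scale S c f \<in> V)"

definition seminorm_on :: "'a set \<Rightarrow> ('a \<Rightarrow> real) set \<Rightarrow> (('a \<Rightarrow> real) \<Rightarrow> real) \<Rightarrow> bool" where
  "seminorm_on S V q \<longleftrightarrow>
     (\<forall>f\<in>V. 0 \<le> q f) \<and> (\<forall>f\<in>V. \<forall>g\<in>V. q (fun_add S f g) \<le> q f + q g) \<and>
     (\<forall>c. \<forall>f\<in>V. q (fun_scale S c f) = \<bar>c\<bar> * q f)"

text \<open>The locally convex topology on \<open>V\<close> defined by a family \<open>P\<close> of seminorms.\<close>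

definition seminorm_topology ::
    "'a set \<Rightarrow> ('a \<Rightarrow> real) set \<Rightarrow> (('a \<Rightarrow> real) \<Rightarrow> real) set \<Rightarrow> ('a \<Rightarrow> real) topology" where
  "seminorm_topology S V P = topology (\<lambda>W. W \<subseteq> V \<and>
     (\<forall>f\<in>W. \<exists>F \<epsilon>. finite F \<and> F \<subseteq> P \<and> \<epsilon> > 0 \<and>
        {g \<in> V. \<forall>q\<in>F. q (fun_diff S g f) < \<epsilon>} \<subseteq> W))"

lemma openin_seminorm_topology:
  "openin (seminorm_topology S V P) W \<longleftrightarrow> W \<subseteq> V \<and>
     (\<forall>f\<in>W. \<exists>F \<epsilon>. finite F \<and> F \<subseteq> P \<and> \<epsilon> > 0 \<and>
        {g \<in> V. \<forall>q\<in>F. q (fun_diff S g f) < \<epsilon>} \<subseteq> W)"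
proof -
  let ?N = "\<lambda>W f. \<exists>F \<epsilon>. finite F \<and> F \<subseteq> P \<and> \<epsilon> > 0 \<and>
        {g \<in> V. \<forall>q\<in>F. q (fun_diff S g f) < \<epsilon>} \<subseteq> W"
  have inter: "?N (W1 \<inter> W2) f" if N: "?N W1 f" "?N W2 f" for W1 W2 f
  proof -
    obtain F1 e1 where 1: "finite F1" "F1 \<subseteq> P" "e1 > 0"
        "{g \<in> V. \<forall>q\<in>F1. q (fun_diff S g f) < e1} \<subseteq> W1" using N(1) by blast
    obtain F2 e2 where 2: "finite F2" "F2 \<subseteq> P" "e2 > 0"
        "{g \<in> V. \<forall>q\<in>F2. q (fun_diff S g f) < e2} \<subseteq> W2" using N(2) by blast
    show ?thesis
    proof (intro exI conjI)
      show "{g \<in> V. \<forall>q\<in>F1 \<union> F2. q (fun_diff S g f) < min e1 e2} \<subseteq> W1 \<inter> W2"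
        using 1(4) 2(4) by fastforce
    qed (use 1 2 in simp_all)
  qed
  have "istopology (\<lambda>W. W \<subseteq> V \<and> (\<forall>f\<in>W. ?N W f))"
    unfolding istopology_def
  proof (intro conjI allI impI ballI)
    fix W1 W2 f
    assume "W1 \<subseteq> V \<and> (\<forall>f\<in>W1. ?N W1 f)" "W2 \<subseteq> V \<and> (\<forall>f\<in>W2. ?N W2 f)" "f \<in> W1 \<inter> W2"
    then show "?N (W1 \<inter> W2) f" by (intro inter) auto
  next
    fix \<K> f
    assume K: "\<forall>W\<in>\<K>. W \<subseteq> V \<and> (\<forall>f\<in>W. ?N W f)" and "f \<in> \<Union>\<K>"
    then obtain W where "W \<in> \<K>" "f \<in> W" by blast
    then have "?N W f" "W \<subseteq> \<Union>\<K>" using K by blast+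
    then show "?N (\<Union>\<K>) f" by (meson subset_trans)
  qed blast+
  then show ?thesis by (simp add: seminorm_topology_def topology_inverse')
qed

lemma topspace_seminorm_topology [simp]: "topspace (seminorm_topology S V P) = V"
proof -
  have "openin (seminorm_topology S V P) V"
    unfolding openin_seminorm_topology
    by (intro conjI ballI exI[of _ "{}"] exI[of _ "1::real"]) auto
  then show ?thesis
    using openin_seminorm_topology[of S V P "topspace (seminorm_topology S V P)"]
    by (intro subset_antisym openin_subset) simp_all
qed

text \<open>
  A topology \<open>T\<close> makes the function space \<^term>\<open>topspace T\<close> a Frechet space: it is induced by
  a countable separating family of seminorms with respect to which the space is complete.
\<close>

definition frechet_space :: "'a set \<Rightarrow> ('a \<Rightarrow> real) topology \<Rightarrow> bool" where
  "frechet_space S T \<longleftrightarrow> linear_function_space S (topspace T) \<and>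
     (\<exists>P. countable P \<and> (\<forall>q\<in>P. seminorm_on S (topspace T) q) \<and>
        T = seminorm_topology S (topspace T) P \<and>
        (\<forall>f\<in>topspace T. (\<forall>q\<in>P. q f = 0) \<longrightarrow> f = (\<lambda>x\<in>S. 0)) \<and>
        (\<forall>u. range u \<subseteq> topspace T \<and>
             (\<forall>q\<in>P. \<forall>\<epsilon>>0. \<exists>k::nat. \<forall>i\<ge>k. \<forall>j\<ge>k. q (fun_diff S (u i) (u j)) < \<epsilon>) \<longrightarrow>
             (\<exists>f\<in>topspace T. \<forall>q\<in>P. (\<lambda>i. q (fun_diff S (u i) f)) \<longlonglongrightarrow> 0)))"

definition frechet_isomorphism ::
    "'a set \<Rightarrow> ('a \<Rightarrow> real) topology \<Rightarrow> 'b set \<Rightarrow> ('b \<Rightarrow> real) topology \<Rightarrow>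
     (('a \<Rightarrow> real) \<Rightarrow> ('b \<Rightarrow> real)) \<Rightarrow> bool" where
  "frechet_isomorphism S T S' T' L \<longleftrightarrow> frechet_space S T \<and> frechet_space S' T' \<and>
     (\<forall>f\<in>topspace T. \<forall>g\<in>topspace T. L (fun_add S f g) = fun_add S' (L f) (L g)) \<and>
     (\<forall>c. \<forall>f\<in>topspace T. L (fun_scale S c f) = fun_scale S' c (L f)) \<and>
     homeomorphic_map T T' L"


section \<open>Smooth functions on manifolds\<close>

definition smooth_functions :: "'a manifold \<Rightarrow> ('a \<Rightarrow> real) set" where
  "smooth_functions N = {f \<in> extensional (mpoints N).
     \<forall>(U, \<phi>)\<in>mcharts N. smooth_fun_on (mdim N) (\<phi> ` U) (f \<circ> inv_into U \<phi>)}"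

definition cinf_seminorm :: "'a chart \<Rightarrow> 'a set \<Rightarrow> nat list \<Rightarrow> ('a \<Rightarrow> real) \<Rightarrow> real" where
  "cinf_seminorm = (\<lambda>(U, \<phi>) K js f. SUP p\<in>K. \<bar>iter_partial js (f \<circ> inv_into U \<phi>) (\<phi> p)\<bar>)"

text \<open>
  Every compact set is a finite union of compact sets each contained in a chart domain, so these
  seminorms give uniform convergence of all derivatives on compact sets. The empty set is
  excluded because its supremum is unspecified.
\<close>

definition cinf_topology :: "'a manifold \<Rightarrow> ('a \<Rightarrow> real) topology" where
  "cinf_topology N = seminorm_topology (mpoints N) (smooth_functions N)
     {cinf_seminorm (U, \<phi>) K js | U \<phi> K js. (U, \<phi>) \<in> mcharts N \<and> compactin (mtop N) K \<and>
        K \<noteq> {} \<and> K \<subseteq> U \<and> js \<in> lists {..<mdim N}}"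

text \<open>The pullback of functions along a map \<open>f\<close> defined on \<open>N\<close>.\<close>

definition pullback :: "'a manifold \<Rightarrow> ('a \<Rightarrow> 'b) \<Rightarrow> ('b \<Rightarrow> real) \<Rightarrow> 'a \<Rightarrow> real" where
  "pullback N f F = compose (mpoints N) F f"


section \<open>Group actions on manifolds\<close>

definition smooth_action ::
    "('g, 'b) monoid_scheme \<Rightarrow> ('g \<Rightarrow> 'a \<Rightarrow> 'a) \<Rightarrow> 'a manifold \<Rightarrow> bool" where
  "smooth_action G \<alpha> M \<longleftrightarrow>
     group_action G (mpoints M) \<alpha> \<and> (\<forall>g\<in>carrier G. smooth_map M M (\<alpha> g))"

definition free_action ::
    "('g, 'b) monoid_scheme \<Rightarrow> ('g \<Rightarrow> 'a \<Rightarrow> 'a) \<Rightarrow> 'a manifold \<Rightarrow> bool" where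
  "free_action G \<alpha> M \<longleftrightarrow> (\<forall>g\<in>carrier G. \<forall>p\<in>mpoints M. \<alpha> g p = p \<longrightarrow> g = \<one>\<^bsub>G\<^esub>)"

definition proper_action ::
    "('g, 'b) monoid_scheme \<Rightarrow> ('g \<Rightarrow> 'a \<Rightarrow> 'a) \<Rightarrow> 'a manifold \<Rightarrow> bool" where
  "proper_action G \<alpha> M \<longleftrightarrow>
     proper_map (prod_topology (discrete_topology (carrier G)) (mtop M))
       (prod_topology (mtop M) (mtop M)) (\<lambda>(g, p). (\<alpha> g p, p))"

definition quotient_topology :: "'a topology \<Rightarrow> ('a \<Rightarrow> 'b) \<Rightarrow> 'b topology" where
  "quotient_topology T f =
     topology (\<lambda>W. W \<subseteq> f ` topspace T \<and> openin T {x \<in> topspace T. f x \<in> W})"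

lemma openin_quotient_topology:
  "openin (quotient_topology T f) W \<longleftrightarrow>
     W \<subseteq> f ` topspace T \<and> openin T {x \<in> topspace T. f x \<in> W}"
proof -
  have "istopology (\<lambda>W. W \<subseteq> f ` topspace T \<and> openin T {x \<in> topspace T. f x \<in> W})"
    unfolding istopology_def
  proof (intro conjI allI impI)
    fix V W
    assume "V \<subseteq> f ` topspace T \<and> openin T {x \<in> topspace T. f x \<in> V}"
      "W \<subseteq> f ` topspace T \<and> openin T {x \<in> topspace T. f x \<in> W}"
    then have "openin T ({x \<in> topspace T. f x \<in> V} \<inter> {x \<in> topspace T. f x \<in> W})" by blast
    then show "openin T {x \<in> topspace T. f x \<in> V \<inter> W}"
      by (rule back_subst[of "openin T"]) blast
  next
    fix \<K>
    assume "\<forall>W\<in>\<K>. W \<subseteq> f ` topspace T \<and> openin T {x \<in> topspace T. f x \<in> W}"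
    then have "openin T (\<Union>W\<in>\<K>. {x \<in> topspace T. f x \<in> W})" by blast
    then show "openin T {x \<in> topspace T. f x \<in> \<Union>\<K>}"
      by (rule back_subst[of "openin T"]) blast
  qed blast+
  then show ?thesis by (simp add: quotient_topology_def topology_inverse')
qed

lemma topspace_quotient_topology [simp]: "topspace (quotient_topology T f) = f ` topspace T"
proof -
  have "{x \<in> topspace T. f x \<in> f ` topspace T} = topspace T" by blast
  then have "openin (quotient_topology T f) (f ` topspace T)"
    by (simp add: openin_quotient_topology)
  then show ?thesis
    using openin_quotient_topology[of T f "topspace (quotient_topology T f)"]
    by (intro subset_antisym openin_subset) simp_all
qed

lemma quotient_map_quotient_topology: "quotient_map T (quotient_topology T f) f"
  by (simp add: quotient_map_def openin_quotient_topology)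

text \<open>
  The projection to the orbit space sends \<open>p\<close> to \<^term>\<open>orbit G \<alpha> p\<close>. The quotient manifold is the
  topological quotient with the unique smooth structure making this a smooth covering map.
\<close>

definition orbit_topology ::
    "('g, 'b) monoid_scheme \<Rightarrow> ('g \<Rightarrow> 'a \<Rightarrow> 'a) \<Rightarrow> 'a manifold \<Rightarrow> 'a set topology" where
  "orbit_topology G \<alpha> M = quotient_topology (mtop M) (orbit G \<alpha>)"

lemma topspace_orbit_topology: "topspace (orbit_topology G \<alpha> M) = orbits G (mpoints M) \<alpha>"
  unfolding orbit_topology_def orbits_def topspace_quotient_topology by blast

definition cocompact_action ::
    "('g, 'b) monoid_scheme \<Rightarrow> ('g \<Rightarrow> 'a \<Rightarrow> 'a) \<Rightarrow> 'a manifold \<Rightarrow> bool" where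
  "cocompact_action G \<alpha> M \<longleftrightarrow> compact_space (orbit_topology G \<alpha> M)"

definition quotient_manifold ::
    "('g, 'b) monoid_scheme \<Rightarrow> ('g \<Rightarrow> 'a \<Rightarrow> 'a) \<Rightarrow> 'a manifold \<Rightarrow> 'a set manifold" where
  "quotient_manifold G \<alpha> M =
     (THE Q. mdim Q = mdim M \<and> mtop Q = orbit_topology G \<alpha> M \<and> smooth_manifold Q \<and>
        smooth_covering_map M Q (orbit G \<alpha>))"

definition invariant_functions ::
    "('g, 'b) monoid_scheme \<Rightarrow> ('g \<Rightarrow> 'a \<Rightarrow> 'a) \<Rightarrow> 'a manifold \<Rightarrow> ('a \<Rightarrow> real) set" where
  "invariant_functions G \<alpha> N =
     {f \<in> smooth_functions N. \<forall>g\<in>carrier G. \<forall>p\<in>mpoints N. f (\<alpha> g p) = f p}"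

definition tuple_map :: "nat \<Rightarrow> (nat \<Rightarrow> 'a \<Rightarrow> real) \<Rightarrow> 'a \<Rightarrow> nat \<Rightarrow> real" where
  "tuple_map m s p = (\<lambda>i. if i < m then s i p else 0)"

definition generating_invariants ::
    "('g, 'b) monoid_scheme \<Rightarrow> ('g \<Rightarrow> 'a \<Rightarrow> 'a) \<Rightarrow> 'a manifold \<Rightarrow> nat \<Rightarrow> (nat \<Rightarrow> 'a \<Rightarrow> real) \<Rightarrow> bool"
  where
  "generating_invariants G \<alpha> M m s \<longleftrightarrow>
     (\<forall>i<m. s i \<in> invariant_functions G \<alpha> M) \<and>
     pullback M (tuple_map m s) ` smooth_functions (euclidean_manifold m) =
       invariant_functions G \<alpha> M"

end

theory Submission
  imports Defs
begin

text \<open>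
  Freeness and properness give every point a neighbourhood disjoint from its translates, so that
  local charts of \<open>M\<close> push forward to an atlas of the orbit space. A chart with such a small domain
  and its push-forward have equal coordinate representations, hence equal seminorms, and every
  compact set splits into finitely many pieces in small charts: this makes \<open>\<pi>\<^sup>*\<close> a homeomorphism.
  Completeness and metrizability of the smooth topology come from countably many compact chart
  pieces, since a change of coordinates expresses derivatives through derivatives.

  For the generators, cover the compact orbit space by finitely many charts \<open>\<phi>\<^sub>j\<close> and take the
  functions \<open>\<chi>\<^sub>j\<close> of an invariant partition of unity together with the cut-off coordinates
  \<open>\<eta>\<^sub>j \<phi>\<^sub>j\<close>, where \<open>\<eta>\<^sub>j = 1\<close> on the support of \<open>\<chi>\<^sub>j\<close>. An invariant \<open>f\<close> is then
  \<open>\<Sum>\<^sub>j \<chi>\<^sub>j (\<eta>\<^sub>j f \<circ> \<phi>\<^sub>j\<^sup>-\<^sup>1)(\<eta>\<^sub>j \<phi>\<^sub>j)\<close>, a smooth function of the generators, and an additional parameter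
  in \<open>X\<close> is harmless. For arbitrary \<open>\<sigma>\<close> with \<open>\<sigma>\<^sup>* E(\<real>\<^sup>m) = E(M)\<^sup>\<Gamma>\<close> these particular generators are
  smooth functions of \<open>\<sigma>\<close>, so the same formula applies.
\<close>

section \<open>Partial derivatives and the chain rule\<close>

text \<open>The dimension is bound by a quantifier, so R^n is a set of sequences, and smoothness
  there means existence and continuity of all iterated partial derivatives; all analysis on
  manifolds rests on a coordinatewise chain rule for such functions. Two further points shape the
  proof. The quotient manifold is given by a definite description, so besides constructing a
  structure on the orbit space its uniqueness has to be shown. And the formula for the extension of
  f must make sense on all of X \<times> R^m, also off the image of \<sigma>, where the generators
  no longer encode points of M. This is why f is multiplied in each chart by a cut-off: the product
  is a smooth function on all of X \<times> R^n and can be evaluated at arbitrary would-be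
  coordinates. A nesting of boxes with radii r, 2 r and 4 r makes the cut-off equal to 1 at every
  point that contributes. The extension is proved with the parameter space X from the start; part
  (2) is the case in which X is a point.\<close>

abbreviation Rn :: "nat \<Rightarrow> (nat \<Rightarrow> real) set" where
  "Rn n \<equiv> topspace (Euclidean_space n)"

section \<open>Coordinate boxes and the topology of R^n\<close>

definition open_box :: "nat \<Rightarrow> (nat \<Rightarrow> real) \<Rightarrow> real \<Rightarrow> (nat \<Rightarrow> real) set" where
  "open_box n x e = {y \<in> Rn n. \<forall>i<n. \<bar>y i - x i\<bar> < e}"

lemma Euclidean_space_eq: "Euclidean_space n = top_of_set (Rn n)"
  by (simp add: Euclidean_space_def topspace_Euclidean_space euclidean_product_topology)

lemma openin_Rn: "openin (Euclidean_space n) W \<longleftrightarrow> openin (top_of_set (Rn n)) W"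
  by (rule arg_cong[OF Euclidean_space_eq, where f="\<lambda>T. openin T W"])

lemma Rn_upd: "x \<in> Rn n \<Longrightarrow> i < n \<Longrightarrow> x(i := t) \<in> Rn n"
  by (auto simp: topspace_Euclidean_space)

lemma openin_open_box: "openin (Euclidean_space n) (open_box n x e)"
proof -
  let ?B = "Pi\<^sub>E UNIV (\<lambda>i. if i < n then ball (x i) e else UNIV)"
  have "finite {i. (if i < n then ball (x i) e else UNIV) \<noteq> UNIV}"
    by (rule finite_subset[of _ "{..<n}"]) auto
  then have "open ?B" by (intro open_PiE) auto
  moreover have "open_box n x e = Rn n \<inter> ?B"
    unfolding open_box_def by (auto simp: PiE_iff dist_real_def abs_minus_commute split: if_splits)
  ultimately show ?thesis unfolding openin_Rn by (simp add: openin_open_Int)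
qed

text \<open>Basic open sets of the product topology restrict finitely many coordinates. On
  \<open>Rn n\<close> all coordinates from n on are 0, so only the first n count, and one common
  side length can be taken for them.\<close>

lemma openin_Euclidean_space_iff:
  "openin (Euclidean_space n) W \<longleftrightarrow> W \<subseteq> Rn n \<and> (\<forall>x\<in>W. \<exists>e>0. open_box n x e \<subseteq> W)"
proof (intro iffI conjI ballI)
  assume W: "openin (Euclidean_space n) W"
  then show "W \<subseteq> Rn n" by (rule openin_subset)
  fix x assume "x \<in> W"
  from W obtain T where T: "open T" "W = Rn n \<inter> T"
    unfolding openin_Rn openin_open by auto
  then have "openin (product_topology (\<lambda>i. euclideanreal) UNIV) T" "x \<in> T"
    using \<open>x \<in> W\<close> by (auto simp: euclidean_product_topology)
  from product_topology_open_contains_basis[OF this] obtain X where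
    X: "x \<in> Pi\<^sub>E UNIV X" "\<And>i. open (X i)" "Pi\<^sub>E UNIV X \<subseteq> T" by auto
  have "\<exists>e>0. ball (x i) e \<subseteq> X i" for i
    using X(1) X(2)[of i] by (auto simp: open_contains_ball PiE_iff)
  then obtain e where e: "\<And>i. e i > 0" "\<And>i. ball (x i) (e i) \<subseteq> X i" by metis
  \<comment> \<open>The inserted 1 keeps \<open>Min\<close> meaningful for n = 0, when there are no
    side lengths to compare.\<close>
  define d where "d = Min (insert 1 (e ` {..<n}))"
  have "d > 0" using e(1) by (auto simp: d_def)
  have d: "d \<le> e i" if "i < n" for i using that by (auto simp: d_def)
  have "open_box n x d \<subseteq> W"
  proof
    fix y assume y: "y \<in> open_box n x d"
    have "y i \<in> X i" for i
    proof (cases "i < n")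
      case True
      then have "y i \<in> ball (x i) (e i)"
        using y d[of i] by (force simp: open_box_def dist_real_def)
      then show ?thesis using e(2) by blast
    next
      case False
      then have "y i = 0" "x i = 0"
        using y T \<open>x \<in> W\<close> by (auto simp: open_box_def topspace_Euclidean_space)
      moreover have "x i \<in> X i" using X(1) by (simp add: PiE_iff)
      ultimately show ?thesis by simp
    qed
    then have "y \<in> T" using X(3) by auto
    then show "y \<in> W" using y T by (auto simp: open_box_def)
  qed
  with \<open>d > 0\<close> show "\<exists>e>0. open_box n x e \<subseteq> W" by blast
next
  assume W: "W \<subseteq> Rn n \<and> (\<forall>x\<in>W. \<exists>e>0. open_box n x e \<subseteq> W)"
  show "openin (Euclidean_space n) W"
  proof (subst openin_subopen, intro ballI)
    fix x assume "x \<in> W"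
    then obtain e where "e > 0" "open_box n x e \<subseteq> W" using W by blast
    moreover have "x \<in> open_box n x e" using \<open>x \<in> W\<close> W \<open>e > 0\<close> by (auto simp: open_box_def)
    ultimately show "\<exists>T. openin (Euclidean_space n) T \<and> x \<in> T \<and> T \<subseteq> W"
      using openin_open_box by blast
  qed
qed

lemma Rn_box_obtain:
  assumes "openin (Euclidean_space n) W" "x \<in> W"
  obtains e where "e > 0" "open_box n x e \<subseteq> W"
  using assms openin_Euclidean_space_iff by blast

lemma continuous_map_Euclidean_real_iff:
  assumes "W \<subseteq> Rn n"
  shows "continuous_map (subtopology (Euclidean_space n) W) euclideanreal f \<longleftrightarrow> continuous_on W f"
  proof -
  have "subtopology (Euclidean_space n) W = top_of_set W"
    using arg_cong[OF Euclidean_space_eq[of n], where f="\<lambda>T. subtopology T W"] assms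
    by (simp add: subtopology_subtopology inf_absorb2)
  then show ?thesis by simp
qed

lemma openin_vimage_Rn:
  fixes f :: "(nat \<Rightarrow> real) \<Rightarrow> 'b::topological_space"
  assumes "openin (Euclidean_space n) W" "continuous_on W f" "open T"
  shows "openin (Euclidean_space n) {y \<in> W. f y \<in> T}"
proof -
  have "openin (top_of_set W) (W \<inter> f -` T)"
    by (rule continuous_openin_preimage_gen[OF assms(2,3)])
  moreover have "{y \<in> W. f y \<in> T} = W \<inter> f -` T" by auto
  ultimately show ?thesis
    using assms(1) openin_trans unfolding openin_Rn by metis
qed

lemma continuous_on_open_box:
  fixes f :: "(nat \<Rightarrow> real) \<Rightarrow> real"
  assumes "openin (Euclidean_space n) W" "continuous_on W f" "x \<in> W" "e > 0"
  obtains d where "d > 0" "open_box n x d \<subseteq> W" "\<And>y. y \<in> open_box n x d \<Longrightarrow> \<bar>f y - f x\<bar> < e"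
proof -
  have "x \<in> {y \<in> W. f y \<in> ball (f x) e}" using assms by auto
  from Rn_box_obtain[OF openin_vimage_Rn[OF assms(1,2) open_ball] this] obtain d
    where "d > 0" "open_box n x d \<subseteq> {y \<in> W. f y \<in> ball (f x) e}" by blast
  then show thesis using that[of d] by (force simp: dist_real_def)
qed

text \<open>A partial derivative inspects f only along \<open>x(i := t)\<close> with t near
  \<open>x i\<close>. That these points stay in an open W makes differentiation local, whatever the
  total functions do outside W.\<close>

lemma eventually_upd_mem:
  assumes "openin (Euclidean_space n) W" "x \<in> W" "i < n"
  shows "\<forall>\<^sub>F t in nhds (x i). x(i := t) \<in> W"
proof -
  obtain e where e: "e > 0" "open_box n x e \<subseteq> W" using Rn_box_obtain[OF assms(1,2)] .
  have x: "x \<in> Rn n" using openin_subset[OF assms(1)] assms(2) by auto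
  show ?thesis unfolding eventually_nhds_metric
    by (rule exI[of _ e])
      (use e Rn_upd[OF x assms(3)] in \<open>force simp: open_box_def dist_real_def subset_iff\<close>)
qed

text \<open>A coordinate of a moving point may lie on either side of its base value or coincide with
  it, so the mean value theorem is wanted without an order between the endpoints.\<close>

lemma MVT_closed_segment:
  fixes g :: "real \<Rightarrow> real"
  assumes "\<And>s. s \<in> closed_segment a b \<Longrightarrow> (g has_real_derivative g' s) (at s)"
  obtains \<xi> where "\<xi> \<in> closed_segment a b" "g b - g a = g' \<xi> * (b - a)"
proof (cases a b rule: linorder_cases)
  case less
  then obtain z where "a < z" "z < b" "g b - g a = (b - a) * g' z"
    using MVT2[of a b g g'] assms by (auto simp: closed_segment_eq_real_ivl)
  then show ?thesis using that[of z] less by (auto simp: closed_segment_eq_real_ivl mult.commute)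
next
  case equal
  then show ?thesis using that[of a] by auto
next
  case greater
  then obtain z where "b < z" "z < a" "g a - g b = (a - b) * g' z"
    using MVT2[of b a g g'] assms by (auto simp: closed_segment_eq_real_ivl)
  then show ?thesis using that[of z] greater
    by (auto simp: closed_segment_eq_real_ivl algebra_simps)
qed

text \<open>
  Continuous partial derivatives suffice for the chain rule along a curve: telescope over the
  coordinates and apply the mean value theorem in each of them.
\<close>

lemma has_real_derivative_chain_Rn:
  fixes c :: "real \<Rightarrow> nat \<Rightarrow> real"
  assumes W: "openin (Euclidean_space k) W" "c t0 \<in> W"
    and c_Rn: "\<forall>\<^sub>F t in nhds t0. c t \<in> Rn k"
    and c_der: "\<And>j. j < k \<Longrightarrow> ((\<lambda>t. c t j) has_real_derivative d j) (at t0)"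
    and f_der: "\<And>j z. j < k \<Longrightarrow> z \<in> W \<Longrightarrow> ((\<lambda>t. f (z(j := t))) has_real_derivative fp j z) (at (z j))"
    and fp_cont: "\<And>j. j < k \<Longrightarrow> continuous_on W (fp j)"
  shows "((\<lambda>t. f (c t)) has_real_derivative (\<Sum>j<k. fp j (c t0) * d j)) (at t0)"
proof -
  define z where "z = c t0"
  \<comment> \<open>\<open>h j t\<close> takes the first j coordinates from the curve and the others
    from z: a staircase from z to \<open>c t\<close> whose j-th step changes only coordinate
    j.\<close>
  define h where "h = (\<lambda>j t i. if i < j then c t i else z i)"
  have z: "z \<in> Rn k" "z \<in> W" using W openin_subset by (auto simp: z_def)
  have near: "\<forall>\<^sub>F t in at t0. \<forall>i<k. \<bar>c t i - z i\<bar> < \<delta>" if "\<delta> > 0" for \<delta>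
  proof -
    have "\<forall>\<^sub>F t in at t0. \<bar>c t i - z i\<bar> < \<delta>" if i: "i < k" for i
    proof -
      have "((\<lambda>t. c t i) \<longlongrightarrow> c t0 i) (at t0)"
        using DERIV_isCont[OF c_der[OF i]] by (simp add: isCont_def)
      then show ?thesis using \<open>\<delta> > 0\<close> by (auto simp: tendsto_iff dist_real_def z_def)
    qed
    then show ?thesis
      using eventually_ball_finite[of "{..<k}" "\<lambda>t i. \<bar>c t i - z i\<bar> < \<delta>" "at t0"]
      by (simp add: Ball_def)
  qed
  have part: "((\<lambda>t. f (h (Suc j) t) - f (h j t)) has_real_derivative fp j z * d j) (at t0)"
    if j: "j < k" for j
  proof -
    \<comment> \<open>The difference quotient of the j-th step. The curve may return to the value
      \<open>z j\<close> for t close to t0, so the partial derivative is inserted there; the product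
      formula for the increment then holds for every t.\<close>
    define A where "A = (\<lambda>t. if c t j = z j then fp j z
                         else (f (h (Suc j) t) - f (h j t)) / (c t j - z j))"
    have hS: "h (Suc j) t = (h j t)(j := c t j)" for t
      by (auto simp: h_def fun_eq_iff less_Suc_eq)
    have hj: "h j t j = z j" for t by (simp add: h_def)
    have eq: "f (h (Suc j) t) - f (h j t) = A t * (c t j - z j)" for t
    proof (cases "c t j = z j")
      case True
      then have "h (Suc j) t = h j t" using hS hj by (metis fun_upd_triv)
      then show ?thesis using True by simp
    qed (simp add: A_def)
    have A: "(A \<longlongrightarrow> fp j z) (at t0)"
      unfolding tendsto_iff
    proof (intro allI impI)
      fix \<epsilon> :: real assume "\<epsilon> > 0"
      obtain \<delta> where \<delta>: "\<delta> > 0" "open_box k z \<delta> \<subseteq> W"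
        "\<And>y. y \<in> open_box k z \<delta> \<Longrightarrow> \<bar>fp j y - fp j z\<bar> < \<epsilon>"
        using continuous_on_open_box[OF W(1) fp_cont[OF j] z(2) \<open>\<epsilon> > 0\<close>] by blast
      show "\<forall>\<^sub>F t in at t0. dist (A t) (fp j z) < \<epsilon>"
        using near[OF \<delta>(1)]
      proof eventually_elim
        case (elim t)
        show ?case
        proof (cases "c t j = z j")
          case True
          then show ?thesis using \<open>\<epsilon> > 0\<close> by (simp add: A_def)
        next
          case False
          \<comment> \<open>The whole j-th step stays in the box: coordinate j lies between
            \<open>z j\<close> and \<open>c t j\<close>, and the others are those of z or of
            \<open>c t\<close>.\<close>
          have box: "(h j t)(j := s) \<in> open_box k z \<delta>" if "s \<in> closed_segment (z j) (c t j)" for s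
          proof -
            have "\<bar>s - z j\<bar> < \<delta>"
              using that elim j by (force simp: closed_segment_eq_real_ivl split: if_splits)
            then show ?thesis
              using elim z(1) j \<delta>(1) unfolding open_box_def h_def
              by (auto simp: topspace_Euclidean_space)
          qed
          have "((\<lambda>s. f ((h j t)(j := s))) has_real_derivative fp j ((h j t)(j := s))) (at s)"
            if "s \<in> closed_segment (z j) (c t j)" for s
            using f_der[OF j, of "(h j t)(j := s)"] box[OF that] \<delta>(2) by auto
          then obtain \<xi> where \<xi>: "\<xi> \<in> closed_segment (z j) (c t j)"
            "f ((h j t)(j := c t j)) - f ((h j t)(j := z j)) = fp j ((h j t)(j := \<xi>)) * (c t j - z j)"
            by (rule MVT_closed_segment)
          have "f (h (Suc j) t) - f (h j t) = fp j ((h j t)(j := \<xi>)) * (c t j - z j)"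
            using \<xi>(2) hS hj by (metis fun_upd_triv)
          then have "A t = fp j ((h j t)(j := \<xi>))" using False by (simp add: A_def)
          then show ?thesis using \<delta>(3)[OF box[OF \<xi>(1)]] by (simp add: dist_real_def)
        qed
      qed
    qed
    have "((\<lambda>t. A t * ((c t j - c t0 j) / (t - t0))) \<longlongrightarrow> fp j z * d j) (at t0)"
      using c_der[OF j] by (intro tendsto_mult A) (simp add: has_field_derivative_iff)
    then show ?thesis
      unfolding has_field_derivative_iff eq by (simp add: z_def)
  qed
  have tel: "(\<Sum>j<k. f (h (Suc j) t) - f (h j t)) + f z = f (h k t)" for t
    using sum_lessThan_telescope[of "\<lambda>j. f (h j t)" k] by (simp add: h_def)
  have "((\<lambda>t. (\<Sum>j<k. f (h (Suc j) t) - f (h j t)) + f z) has_real_derivative (\<Sum>j<k. fp j z * d j) + 0)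
          (at t0)"
    using part by (intro DERIV_add DERIV_sum DERIV_const) auto
  then have *: "((\<lambda>t. f (h k t)) has_real_derivative (\<Sum>j<k. fp j z * d j)) (at t0)"
    unfolding tel by simp
  \<comment> \<open>From coordinate k on, \<open>h k t\<close> has the values of z and not of the
    curve; both vanish there once \<open>c t\<close> lies in \<open>Rn k\<close>.\<close>
  have "\<forall>\<^sub>F t in nhds t0. f (h k t) = f (c t)"
    using c_Rn
  proof eventually_elim
    case (elim t)
    then have "h k t = c t" using z(1) unfolding h_def topspace_Euclidean_space
      by (auto simp: fun_eq_iff)
    then show ?case by simp
  qed
  then show ?thesis
    using * DERIV_cong_ev[OF refl, of "\<lambda>t. f (h k t)" "\<lambda>t. f (c t)" t0] by (simp add: z_def)
qed

text \<open>Products and composites do not keep their form under differentiation, so an induction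
  over words of derivatives gets stuck; an induction over the order k with the function arbitrary
  succeeds. The recursion peels off the derivative that acts first.\<close>

primrec Ck :: "nat \<Rightarrow> (nat \<Rightarrow> real) set \<Rightarrow> nat \<Rightarrow> ((nat \<Rightarrow> real) \<Rightarrow> real) \<Rightarrow> bool" where
  "Ck n W 0 f \<longleftrightarrow> continuous_on W f"
| "Ck n W (Suc k) f \<longleftrightarrow> continuous_on W f \<and>
     (\<forall>i<n. (\<forall>x\<in>W. (\<lambda>t. f (x(i := t))) differentiable at (x i)) \<and> Ck n W k (partial_deriv i f))"

lemma Ck_continuous: "Ck n W k f \<Longrightarrow> continuous_on W f"
  by (cases k) auto

lemma Ck_Suc_imp: "Ck n W (Suc k) f \<Longrightarrow> Ck n W k f"
  by (induction k arbitrary: f) auto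

section \<open>Smoothness as membership in every class C^k\<close>

lemma iter_partial_Nil [simp]: "iter_partial [] f = f"
  and iter_partial_Cons: "iter_partial (j # js) f = partial_deriv j (iter_partial js f)"
  and iter_partial_append: "iter_partial (js @ js') f = iter_partial js (iter_partial js' f)"
  by (simp_all add: iter_partial_def)

text \<open>\<open>foldr\<close> lets the last entry of the word act first. A letter added at the
  end therefore matches the recursion of \<open>Ck\<close>, while one added at the front
  differentiates the result.\<close>

lemma iter_partial_snoc: "iter_partial (js @ [i]) f = iter_partial js (partial_deriv i f)"
  by (simp add: iter_partial_append iter_partial_Cons)

lemma smooth_fun_on_iff:
  assumes "W \<subseteq> Rn n"
  shows "smooth_fun_on n W f \<longleftrightarrow> (\<forall>js \<in> lists {..<n}. continuous_on W (iter_partial js f) \<and>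
        (\<forall>i<n. \<forall>x\<in>W. (\<lambda>t. iter_partial js f (x(i := t))) differentiable (at (x i))))"
  unfolding smooth_fun_on_def continuous_map_Euclidean_real_iff[OF assms] ..

lemma smooth_fun_on_unfold:
  assumes "W \<subseteq> Rn n"
  shows "smooth_fun_on n W f \<longleftrightarrow> continuous_on W f \<and>
     (\<forall>i<n. (\<forall>x\<in>W. (\<lambda>t. f (x(i := t))) differentiable at (x i)) \<and> smooth_fun_on n W (partial_deriv i f))"
    (is "?l \<longleftrightarrow> ?r")
proof
  assume l: ?l
  show ?r
  proof (intro conjI allI impI)
    show "continuous_on W f" using l[unfolded smooth_fun_on_iff[OF assms], rule_format, of "[]"] by simp
    fix i assume i: "i < n"
    show "\<forall>x\<in>W. (\<lambda>t. f (x(i := t))) differentiable at (x i)"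
      using l[unfolded smooth_fun_on_iff[OF assms], rule_format, of "[]"] i by simp
    show "smooth_fun_on n W (partial_deriv i f)"
      unfolding smooth_fun_on_iff[OF assms] iter_partial_snoc[symmetric]
      by (intro ballI) (rule l[unfolded smooth_fun_on_iff[OF assms], rule_format], use i in auto)
  qed
next
  assume r: ?r
  show ?l unfolding smooth_fun_on_iff[OF assms]
  proof
    fix js assume js: "js \<in> lists {..<n}"
    show "continuous_on W (iter_partial js f) \<and>
        (\<forall>i<n. \<forall>x\<in>W. (\<lambda>t. iter_partial js f (x(i := t))) differentiable (at (x i)))"
    proof (cases js rule: rev_cases)
      case Nil
      then show ?thesis using r by simp
    next
      case (snoc ys y)
      then show ?thesis using r js
        by (auto simp: smooth_fun_on_iff[OF assms] iter_partial_snoc)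
    qed
  qed
qed

lemma smooth_fun_on_iff_Ck:
  assumes "W \<subseteq> Rn n"
  shows "smooth_fun_on n W f \<longleftrightarrow> (\<forall>k. Ck n W k f)"
proof
  have "smooth_fun_on n W f \<Longrightarrow> Ck n W k f" for k
  proof (induction k arbitrary: f)
    case 0
    then show ?case using smooth_fun_on_unfold[OF assms, THEN iffD1] by simp
  next
    case (Suc k)
    from smooth_fun_on_unfold[OF assms, THEN iffD1, OF Suc.prems] Suc.IH show ?case
      unfolding Ck.simps by blast
  qed
  then show "smooth_fun_on n W f \<Longrightarrow> \<forall>k. Ck n W k f" by blast
next
  \<comment> \<open>One order more than the length of the word, as \<open>iter_partial js f\<close>
    has to be differentiable once again.\<close>
  have "Ck n W (Suc (length js)) f \<Longrightarrow> js \<in> lists {..<n} \<Longrightarrow> continuous_on W (iter_partial js f) \<and>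
        (\<forall>i<n. \<forall>x\<in>W. (\<lambda>t. iter_partial js f (x(i := t))) differentiable (at (x i)))" for js
  proof (induction js arbitrary: f rule: rev_induct)
    case (snoc y ys)
    then show ?case unfolding iter_partial_snoc by (intro snoc.IH) auto
  qed auto
  then show "\<forall>k. Ck n W k f \<Longrightarrow> smooth_fun_on n W f"
    unfolding smooth_fun_on_iff[OF assms] by blast
qed

lemma upd_cong_ev:
  fixes f g :: "(nat \<Rightarrow> real) \<Rightarrow> real"
  assumes "openin (Euclidean_space n) W" "x \<in> W" "i < n" "\<And>y. y \<in> W \<Longrightarrow> f y = g y"
  shows "\<forall>\<^sub>F t in nhds (x i). f (x(i := t)) = g (x(i := t))"
  using eventually_upd_mem[OF assms(1-3)] by eventually_elim (use assms(4) in auto)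

lemma partial_deriv_cong:
  assumes "openin (Euclidean_space n) W" "x \<in> W" "i < n" "\<And>y. y \<in> W \<Longrightarrow> f y = g y"
  shows "partial_deriv i f x = partial_deriv i g x"
  unfolding partial_deriv_def by (rule deriv_cong_ev[OF upd_cong_ev[OF assms] refl])

text \<open>By openness of W only the values on W matter. Coordinate representations that agree on a
  chart range, but perhaps not off it, may thus be exchanged under all derivatives.\<close>

lemma iter_partial_cong:
  assumes "openin (Euclidean_space n) W" "\<And>y. y \<in> W \<Longrightarrow> f y = g y" "js \<in> lists {..<n}" "x \<in> W"
  shows "iter_partial js f x = iter_partial js g x"
  using assms(3,4)
proof (induction js arbitrary: x)
  case (Cons j js)
  then show ?case unfolding iter_partial_Cons
    by (intro partial_deriv_cong[OF assms(1)]) auto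
qed (use assms in auto)

lemma differentiable_upd_cong:
  fixes f g :: "(nat \<Rightarrow> real) \<Rightarrow> real"
  assumes "openin (Euclidean_space n) W" "x \<in> W" "i < n" "\<And>y. y \<in> W \<Longrightarrow> f y = g y"
    "(\<lambda>t. f (x(i := t))) differentiable at (x i)"
  shows "(\<lambda>t. g (x(i := t))) differentiable at (x i)"
proof -
  have "\<forall>\<^sub>F t in nhds (x i). f (x(i := t)) = g (x(i := t))"
    by (rule upd_cong_ev[OF assms(1-4)])
  from DERIV_cong_ev[OF refl this refl] assms(5) show ?thesis
    unfolding real_differentiable_def by blast
qed

lemma Ck_cong:
  assumes "openin (Euclidean_space n) W" "\<And>y. y \<in> W \<Longrightarrow> f y = g y" "Ck n W k f"
  shows "Ck n W k g"
  using assms(2,3)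
proof (induction k arbitrary: f g)
  case 0
  then show ?case using continuous_on_cong by (metis Ck.simps(1))
next
  case (Suc k)
  have "continuous_on W g" using Suc.prems continuous_on_cong by (metis Ck.simps(2))
  moreover have "(\<lambda>t. g (x(i := t))) differentiable at (x i)" if "i < n" "x \<in> W" for i x
    by (rule differentiable_upd_cong[of n W x i f g])
      (use assms(1) that Suc.prems in simp_all)
  moreover have "Ck n W k (partial_deriv i g)" if "i < n" for i
    by (rule Suc.IH[of "partial_deriv i f"])
      (use partial_deriv_cong[of n W _ i f g] assms(1) Suc.prems that in simp_all)
  ultimately show ?case by auto
qed

text \<open>The common pattern of the closure properties: guess the derivatives as explicit
  expressions \<open>g i\<close>, to which the induction hypothesis applies.
  \<open>partial_deriv i f\<close> is known to agree with \<open>g i\<close> on W only, hence the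
  appeal to congruence.\<close>

lemma Ck_SucI:
  assumes W: "openin (Euclidean_space n) W" and "continuous_on W f"
    and der: "\<And>i x. i < n \<Longrightarrow> x \<in> W \<Longrightarrow> ((\<lambda>t. f (x(i := t))) has_real_derivative g i x) (at (x i))"
    and "\<And>i. i < n \<Longrightarrow> Ck n W k (g i)"
  shows "Ck n W (Suc k) f"
proof -
  have "partial_deriv i f x = g i x" if "i < n" "x \<in> W" for i x
    unfolding partial_deriv_def by (rule DERIV_imp_deriv[OF der[OF that]])
  then have "Ck n W k (partial_deriv i f)" if "i < n" for i
    using Ck_cong[OF W, of "g i" "partial_deriv i f"] assms(4)[OF that] that by simp
  moreover have "(\<lambda>t. f (x(i := t))) differentiable at (x i)" if "i < n" "x \<in> W" for i x
    using der[OF that] unfolding real_differentiable_def by blast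
  ultimately show ?thesis using assms(2) unfolding Ck.simps by blast
qed

lemma Ck_SucD:
  assumes "Ck n W (Suc k) f" "i < n" "x \<in> W"
  shows "((\<lambda>t. f (x(i := t))) has_real_derivative partial_deriv i f x) (at (x i))"
proof -
  have "(\<lambda>t. f (x(i := t))) differentiable at (x i)" using assms unfolding Ck.simps by blast
  then show ?thesis unfolding partial_deriv_def DERIV_deriv_iff_real_differentiable .
qed

section \<open>Closure properties of C^k functions\<close>

lemma Ck_const: "openin (Euclidean_space n) W \<Longrightarrow> Ck n W k (\<lambda>x. c)"
proof (induction k arbitrary: c)
  case (Suc k)
  show ?case by (rule Ck_SucI[OF Suc.prems, where g="\<lambda>i x. 0"]) (use Suc in auto)
qed auto

lemma continuous_on_coord: "continuous_on W (\<lambda>x :: nat \<Rightarrow> real. x j)"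
  by (rule continuous_on_product_then_coordinatewise[where f="\<lambda>x. x"]) (rule continuous_on_id)

lemma Ck_coord: assumes W: "openin (Euclidean_space n) W" shows "Ck n W k (\<lambda>x. x j)"
proof (cases k)
  case 0
  then show ?thesis by (simp add: continuous_on_coord)
next
  case (Suc k)
  show ?thesis unfolding Suc
    by (rule Ck_SucI[OF W, where g="\<lambda>i x. if i = j then 1 else 0"])
      (auto simp: continuous_on_coord Ck_const[OF W])
qed

lemma Ck_add:
  assumes W: "openin (Euclidean_space n) W"
  shows "Ck n W k f \<Longrightarrow> Ck n W k g \<Longrightarrow> Ck n W k (\<lambda>x. f x + g x)"
proof (induction k arbitrary: f g)
  case (Suc k)
  show ?case
  proof (rule Ck_SucI[OF W, where g="\<lambda>i x. partial_deriv i f x + partial_deriv i g x"])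
    fix i x assume i: "i < n"
    show "Ck n W k (\<lambda>x. partial_deriv i f x + partial_deriv i g x)"
      using Suc i by auto
    assume "x \<in> W"
    then show "((\<lambda>t. f (x(i := t)) + g (x(i := t))) has_real_derivative
        partial_deriv i f x + partial_deriv i g x) (at (x i))"
      by (intro DERIV_add Ck_SucD[OF Suc.prems(1) i] Ck_SucD[OF Suc.prems(2) i])
  qed (use Suc.prems in \<open>auto intro: continuous_on_add\<close>)
qed (auto intro: continuous_on_add)

lemma Ck_mult:
  assumes W: "openin (Euclidean_space n) W"
  shows "Ck n W k f \<Longrightarrow> Ck n W k g \<Longrightarrow> Ck n W k (\<lambda>x. f x * g x)"
proof (induction k arbitrary: f g)
  case (Suc k)
  have "Ck n W k f" "Ck n W k g" using Suc.prems Ck_Suc_imp by blast+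
  then have "Ck n W k (\<lambda>x. partial_deriv i f x * g x + partial_deriv i g x * f x)" if "i < n" for i
    using Suc that by (intro Ck_add[OF W] Suc.IH) auto
  moreover have "((\<lambda>t. f (x(i := t)) * g (x(i := t))) has_real_derivative
       partial_deriv i f x * g x + partial_deriv i g x * f x) (at (x i))" if "i < n" "x \<in> W" for i x
    by (rule DERIV_cong[OF DERIV_mult[OF Ck_SucD[OF Suc.prems(1) that] Ck_SucD[OF Suc.prems(2) that]]])
      simp
  moreover have "continuous_on W (\<lambda>x. f x * g x)"
    using Suc.prems Ck_continuous continuous_on_mult by blast
  ultimately show ?case
    by (intro Ck_SucI[OF W, where g="\<lambda>i x. partial_deriv i f x * g x + partial_deriv i g x * f x"])
qed (auto intro: continuous_on_mult)

lemma Ck_sum: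
  assumes W: "openin (Euclidean_space n) W"
  shows "(\<And>j. j \<in> J \<Longrightarrow> Ck n W k (f j)) \<Longrightarrow> Ck n W k (\<lambda>x. \<Sum>j\<in>J. f j x)"
  by (induction J rule: infinite_finite_induct) (auto intro: Ck_const[OF W] Ck_add[OF W])

lemma continuous_on_into_Rn:
  assumes W': "openin (Euclidean_space m) W'" and g: "\<And>x. x \<in> W \<Longrightarrow> g x \<in> W'"
    and cont: "\<And>j. j < m \<Longrightarrow> continuous_on W (\<lambda>x. g x j)"
  shows "continuous_on W g"
proof (rule continuous_on_coordinatewise_then_product)
  fix j
  show "continuous_on W (\<lambda>x. g x j)"
  proof (cases "j < m")
    case False
    then have "g x j = 0" if "x \<in> W" for x
      using g[OF that] openin_subset[OF W'] by (force simp: topspace_Euclidean_space)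
    then show ?thesis using continuous_on_cong[of W W "\<lambda>x. g x j" "\<lambda>x. 0"] by auto
  qed (rule cont)
qed

text \<open>By the chain rule each partial derivative is a sum of products of
  \<open>partial_deriv j f\<close> after g with derivatives of the components of g. The induction
  hypothesis applies to the first factors with the same g, whose components are C^k as well.\<close>

lemma Ck_compose:
  assumes W: "openin (Euclidean_space n) W" and W': "openin (Euclidean_space m) W'"
    and g: "\<And>x. x \<in> W \<Longrightarrow> g x \<in> W'"
  shows "Ck m W' k f \<Longrightarrow> (\<And>j. j < m \<Longrightarrow> Ck n W k (\<lambda>x. g x j)) \<Longrightarrow> Ck n W k (\<lambda>x. f (g x))"
proof (induction k arbitrary: f)
  case (0 f)
  show ?case unfolding Ck.simps
    by (rule continuous_on_compose2[OF Ck_continuous[OF 0(1)] continuous_on_into_Rn[OF W' g]])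
      (use 0 g in auto)
next
  case (Suc k f)
  have gk: "Ck n W k (\<lambda>x. g x j)" if "j < m" for j using Suc.prems(2)[OF that] by (rule Ck_Suc_imp)
  let ?D = "\<lambda>i x. \<Sum>j<m. partial_deriv j f (g x) * partial_deriv i (\<lambda>x. g x j) x"
  show ?case
  proof (rule Ck_SucI[OF W, where g="?D"])
    show "continuous_on W (\<lambda>x. f (g x))"
      by (rule continuous_on_compose2[OF Ck_continuous[OF Suc.prems(1)] continuous_on_into_Rn[OF W' g]])
        (use Ck_continuous[OF Suc.prems(2)] g in auto)
    fix i assume i: "i < n"
    show "Ck n W k (?D i)"
    proof (rule Ck_sum[OF W], rule Ck_mult[OF W])
      fix j assume "j \<in> {..<m}"
      then have j: "j < m" by simp
      have "Ck m W' k (partial_deriv j f)" using Suc.prems(1) j by simp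
      then show "Ck n W k (\<lambda>x. partial_deriv j f (g x))" by (rule Suc.IH) (rule gk)
      show "Ck n W k (partial_deriv i (\<lambda>x. g x j))" using Suc.prems(2)[OF j] i by simp
    qed
    fix x assume x: "x \<in> W"
    have ev: "\<forall>\<^sub>F t in nhds (x i). g (x(i := t)) \<in> Rn m"
      using eventually_upd_mem[OF W x i]
      by eventually_elim (use g openin_subset[OF W'] in blast)
    \<comment> \<open>The curve sends t to \<open>g (x(i := t))\<close>; its base point appears as
      \<open>x(i := x i)\<close> until \<open>fun_upd_triv\<close> removes the update.\<close>
    have "((\<lambda>t. f (g (x(i := t)))) has_real_derivative
        (\<Sum>j<m. partial_deriv j f (g (x(i := x i))) * partial_deriv i (\<lambda>x. g x j) x)) (at (x i))"
    proof (rule has_real_derivative_chain_Rn[OF W' _ ev])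
      show "g (x(i := x i)) \<in> W'" using g[OF x] by simp
      show "((\<lambda>t. g (x(i := t)) j) has_real_derivative partial_deriv i (\<lambda>x. g x j) x) (at (x i))"
        if "j < m" for j using Ck_SucD[OF Suc.prems(2)[OF that] i x] .
      show "((\<lambda>t. f (z(j := t))) has_real_derivative partial_deriv j f z) (at (z j))"
        if "j < m" "z \<in> W'" for j z using Ck_SucD[OF Suc.prems(1) that] .
      show "continuous_on W' (partial_deriv j f)" if "j < m" for j
        using Suc.prems(1) that Ck_continuous by auto
    qed
    then show "((\<lambda>t. f (g (x(i := t)))) has_real_derivative ?D i x) (at (x i))"
      unfolding fun_upd_triv .
  qed
qed

text \<open>The derivative - f' / f^2 contains 1 / f again, but only to order k, so the induction
  closes.\<close>

lemma Ck_inverse: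
  assumes W: "openin (Euclidean_space n) W" and nz: "\<And>x. x \<in> W \<Longrightarrow> f x \<noteq> 0"
  shows "Ck n W k f \<Longrightarrow> Ck n W k (\<lambda>x. inverse (f x))"
proof (induction k)
  case (Suc k)
  let ?D = "\<lambda>i x. (-1) * ((inverse (f x) * inverse (f x)) * partial_deriv i f x)"
  have "Ck n W k f" using Suc.prems Ck_Suc_imp by blast
  then have "Ck n W k (?D i)" if "i < n" for i
    using Suc.prems that by (intro Ck_mult[OF W] Ck_const[OF W] Suc.IH) simp_all
  moreover have "((\<lambda>t. inverse (f (x(i := t)))) has_real_derivative ?D i x) (at (x i))"
    if "i < n" "x \<in> W" for i x
    by (rule DERIV_cong[OF DERIV_inverse_fun[OF Ck_SucD[OF Suc.prems that]]])
      (use nz[OF that(2)] in \<open>simp_all add: power2_eq_square mult_ac\<close>)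
  moreover have "continuous_on W (\<lambda>x. inverse (f x))"
    using Suc.prems nz Ck_continuous continuous_on_inverse by blast
  ultimately show ?case by (intro Ck_SucI[OF W, where g="?D"])
qed (use nz in \<open>auto intro: continuous_on_inverse\<close>)

text \<open>The functions t^(-k) exp(-1/t), extended by 0. The powers are there because
  differentiation maps this family into its own linear combinations, which lets one induction cover
  all derivatives. The cut-offs use only k = 0.\<close>

definition flat_fun :: "nat \<Rightarrow> real \<Rightarrow> real" where
  "flat_fun k t = (if t \<le> 0 then 0 else inverse t ^ k * exp (- inverse t))"

lemma flat_fun_deriv:
  "(flat_fun k has_real_derivative flat_fun (k+2) t - real k * flat_fun (k+1) t) (at t)"
proof (cases t "0::real" rule: linorder_cases)
  case less
  have "eventually (\<lambda>s. s \<in> {..<0}) (nhds t)" using less by (intro eventually_nhds_in_open) auto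
  then have "\<forall>\<^sub>F s in nhds t. flat_fun k s = 0" by eventually_elim (simp add: flat_fun_def)
  then show ?thesis using DERIV_cong_ev[OF refl, of "flat_fun k" "\<lambda>_. 0" t] less
    by (simp add: flat_fun_def)
next
  case greater
  have "eventually (\<lambda>s. s \<in> {0<..}) (nhds t)" using greater by (intro eventually_nhds_in_open) auto
  then have ev: "\<forall>\<^sub>F s in nhds t. flat_fun k s = inverse s ^ k * exp (- inverse s)"
    by eventually_elim (simp add: flat_fun_def)
  have "((\<lambda>s. inverse s ^ k * exp (- inverse s)) has_real_derivative
     flat_fun (k+2) t - real k * flat_fun (k+1) t) (at t)"
  proof (cases k)
    case 0
    then show ?thesis using greater
      by (auto intro!: derivative_eq_intros simp: flat_fun_def field_simps power2_eq_square)
  next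
    case (Suc m)
    show ?thesis using greater unfolding Suc
      by (auto intro!: derivative_eq_intros simp: flat_fun_def power2_eq_square field_simps)
        (cases m; simp)
  qed
  then show ?thesis using DERIV_cong_ev[OF refl ev refl] by simp
next
  case equal
  \<comment> \<open>At 0 the difference quotient from the right is s^(-k-1) exp(-1/s); with x = 1/s
    this is x^(k+1) / exp x for x tending to infinity.\<close>
  have lim: "((\<lambda>s::real. inverse s ^ Suc k * exp (- inverse s)) \<longlongrightarrow> 0) (at_right 0)"
  proof -
    have "((\<lambda>x::real. x ^ Suc k / exp x) \<longlongrightarrow> 0) at_top" by (rule tendsto_power_div_exp_0)
    then have "((\<lambda>s::real. inverse s ^ Suc k / exp (inverse s)) \<longlongrightarrow> 0) (at_right 0)"
      by (rule filterlim_compose[OF _ filterlim_inverse_at_top_right])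
    then show ?thesis by (simp add: exp_minus divide_inverse)
  qed
  have "((\<lambda>h. flat_fun k h / h) \<longlongrightarrow> 0) (at 0)"
  proof (rule filterlim_split_at)
    show "((\<lambda>h. flat_fun k h / h) \<longlongrightarrow> 0) (at_left 0)"
      by (rule tendsto_eventually) (auto simp: eventually_at_filter flat_fun_def)
    show "((\<lambda>h. flat_fun k h / h) \<longlongrightarrow> 0) (at_right 0)"
      by (rule Lim_transform_eventually[OF lim])
        (auto simp: eventually_at_filter flat_fun_def divide_inverse mult_ac)
  qed
  then show ?thesis using equal by (simp add: has_field_derivative_iff flat_fun_def)
qed

text \<open>The index l must stay arbitrary in the induction: a derivative raises it by one or
  two.\<close>

lemma Ck_flat_fun:
  assumes W: "openin (Euclidean_space n) W"
  shows "Ck n W k f \<Longrightarrow> Ck n W k (\<lambda>x. flat_fun l (f x))"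
proof (induction k arbitrary: l)
  case (0 l)
  have "continuous_on UNIV (flat_fun l)"
    by (intro continuous_at_imp_continuous_on ballI DERIV_isCont[OF flat_fun_deriv])
  then show ?case
    using continuous_on_compose2[OF _ Ck_continuous[OF 0], of UNIV "flat_fun l"] by simp
next
  case (Suc k l)
  let ?D = "\<lambda>i x. (flat_fun (l+2) (f x) + (- real l) * flat_fun (l+1) (f x)) * partial_deriv i f x"
  have c: "continuous_on UNIV (flat_fun l)"
    by (intro continuous_at_imp_continuous_on ballI DERIV_isCont[OF flat_fun_deriv])
  have "Ck n W k f" using Suc.prems Ck_Suc_imp by blast
  then have "Ck n W k (?D i)" if "i < n" for i
    using Suc.prems that by (intro Ck_mult[OF W] Ck_add[OF W] Ck_const[OF W] Suc.IH) simp_all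
  moreover have "((\<lambda>t. flat_fun l (f (x(i := t)))) has_real_derivative ?D i x) (at (x i))"
    if "i < n" "x \<in> W" for i x
    by (rule DERIV_cong[OF DERIV_chain2[OF flat_fun_deriv Ck_SucD[OF Suc.prems that]]]) simp
  moreover have "continuous_on W (\<lambda>x. flat_fun l (f x))"
    using continuous_on_compose2[OF c Ck_continuous[OF Suc.prems]] by simp
  ultimately show ?case by (intro Ck_SucI[OF W, where g="?D"])
qed


section \<open>Closure properties, limits and bump functions\<close>

lemma smooth_fun_on_Ck:
  assumes "openin (Euclidean_space n) W"
  shows "smooth_fun_on n W f \<longleftrightarrow> (\<forall>k. Ck n W k f)"
  using smooth_fun_on_iff_Ck[OF openin_subset[OF assms]] .

context
  fixes n :: nat and W :: "(nat \<Rightarrow> real) set"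
  assumes W: "openin (Euclidean_space n) W"
begin

lemma smooth_fun_on_const: "smooth_fun_on n W (\<lambda>x. c)"
  using Ck_const[OF W] smooth_fun_on_Ck[OF W] by blast

lemma smooth_fun_on_coord: "smooth_fun_on n W (\<lambda>x. x j)"
  using Ck_coord[OF W] smooth_fun_on_Ck[OF W] by blast

lemma smooth_fun_on_add:
  "smooth_fun_on n W f \<Longrightarrow> smooth_fun_on n W g \<Longrightarrow> smooth_fun_on n W (\<lambda>x. f x + g x)"
  using Ck_add[OF W] smooth_fun_on_Ck[OF W] by blast

lemma smooth_fun_on_mult:
  "smooth_fun_on n W f \<Longrightarrow> smooth_fun_on n W g \<Longrightarrow> smooth_fun_on n W (\<lambda>x. f x * g x)"
  using Ck_mult[OF W] smooth_fun_on_Ck[OF W] by blast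

lemma smooth_fun_on_inverse:
  "smooth_fun_on n W f \<Longrightarrow> (\<And>x. x \<in> W \<Longrightarrow> f x \<noteq> 0) \<Longrightarrow> smooth_fun_on n W (\<lambda>x. inverse (f x))"
  using Ck_inverse[OF W] smooth_fun_on_Ck[OF W] by blast

lemma smooth_fun_on_flat_fun:
  "smooth_fun_on n W f \<Longrightarrow> smooth_fun_on n W (\<lambda>x. flat_fun l (f x))"
  using Ck_flat_fun[OF W] smooth_fun_on_Ck[OF W] by blast

lemma smooth_fun_on_prod:
  "(\<And>j. j \<in> J \<Longrightarrow> smooth_fun_on n W (f j)) \<Longrightarrow> smooth_fun_on n W (\<lambda>x. \<Prod>j\<in>J. f j x)"
proof (induction J rule: infinite_finite_induct)
  case (insert j J)
  then have "smooth_fun_on n W (\<lambda>x. f j x * (\<Prod>j\<in>J. f j x))" by (intro smooth_fun_on_mult) auto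
  then show ?case using insert.hyps by simp
qed (auto intro: smooth_fun_on_const)

lemma smooth_fun_on_compose:
  assumes "openin (Euclidean_space m) W'" "smooth_fun_on m W' f"
    "\<And>x. x \<in> W \<Longrightarrow> g x \<in> W'" "\<And>j. j < m \<Longrightarrow> smooth_fun_on n W (\<lambda>x. g x j)"
  shows "smooth_fun_on n W (\<lambda>x. f (g x))"
proof -
  have "Ck n W k (\<lambda>x. f (g x))" for k
    by (rule Ck_compose[OF W assms(1), of g])
      (use assms smooth_fun_on_Ck[OF W] smooth_fun_on_Ck[OF assms(1)] in blast)+
  then show ?thesis using smooth_fun_on_Ck[OF W] by blast
qed

lemma smooth_fun_on_cong:
  assumes "\<And>y. y \<in> W \<Longrightarrow> f y = g y" "smooth_fun_on n W f"
  shows "smooth_fun_on n W g"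
  using Ck_cong[OF W, of f g] assms smooth_fun_on_Ck[OF W] by blast

lemma smooth_fun_on_D:
  assumes "smooth_fun_on n W f" "js \<in> lists {..<n}"
  shows "continuous_on W (iter_partial js f)"
    and "i < n \<Longrightarrow> x \<in> W \<Longrightarrow>
      ((\<lambda>t. iter_partial js f (x(i := t))) has_real_derivative iter_partial (i # js) f x) (at (x i))"
proof -
  note * = assms(1)[unfolded smooth_fun_on_iff[OF openin_subset[OF W]], rule_format, OF assms(2)]
  show "continuous_on W (iter_partial js f)" using * by blast
  assume "i < n" "x \<in> W"
  then have "(\<lambda>t. iter_partial js f (x(i := t))) differentiable (at (x i))" using * by blast
  then show "((\<lambda>t. iter_partial js f (x(i := t))) has_real_derivative iter_partial (i # js) f x) (at (x i))"
    unfolding iter_partial_Cons partial_deriv_def DERIV_deriv_iff_real_differentiable .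
qed

lemma smooth_fun_on_subset:
  assumes "smooth_fun_on n W f" "V \<subseteq> W"
  shows "smooth_fun_on n V f"
proof -
  have "V \<subseteq> Rn n" using assms(2) openin_subset[OF W] by blast
  from smooth_fun_on_iff[OF this] assms smooth_fun_on_iff[OF openin_subset[OF W]]
  show ?thesis using continuous_on_subset by blast
qed

lemma smooth_fun_on_iter_partial:
  assumes "smooth_fun_on n W f" "js \<in> lists {..<n}"
  shows "smooth_fun_on n W (iter_partial js f)"
proof -
  have "js' @ js \<in> lists {..<n}" if "js' \<in> lists {..<n}" for js' using assms(2) that by auto
  then show ?thesis
    using assms(1) unfolding smooth_fun_on_iff[OF openin_subset[OF W]] iter_partial_append[symmetric]
    by blast
qed

section \<open>Locality, and iterated derivatives of sums, composites and limits\<close>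

lemma continuous_on_local:
  fixes f :: "(nat \<Rightarrow> real) \<Rightarrow> real"
  assumes "\<And>x. x \<in> W \<Longrightarrow> \<exists>V. openin (Euclidean_space n) V \<and> x \<in> V \<and> V \<subseteq> W \<and> continuous_on V f"
  shows "continuous_on W f"
proof -
  let ?I = "{V. openin (Euclidean_space n) V \<and> V \<subseteq> W \<and> continuous_on V f}"
  have "continuous_map (subtopology (Euclidean_space n) W) euclideanreal f"
  proof (rule pasting_lemma[where I="?I" and T="\<lambda>V. V" and f="\<lambda>_. f"])
    fix V assume V: "V \<in> ?I"
    then show "openin (subtopology (Euclidean_space n) W) V"
      using W by (simp add: openin_open_subtopology)
    have "V \<subseteq> Rn n" using V openin_subset by blast
    from continuous_map_Euclidean_real_iff[OF this] V
    show "continuous_map (subtopology (subtopology (Euclidean_space n) W) V) euclideanreal f"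
      by (simp add: subtopology_subtopology inf_absorb2)
  next
    fix x assume "x \<in> topspace (subtopology (Euclidean_space n) W)"
    then show "\<exists>V. V \<in> ?I \<and> x \<in> V \<and> f x = f x" using assms[of x] by auto
  qed auto
  then show ?thesis using continuous_map_Euclidean_real_iff[OF openin_subset[OF W]] by blast
qed

lemma smooth_fun_on_local:
  assumes loc: "\<And>x. x \<in> W \<Longrightarrow> \<exists>V. openin (Euclidean_space n) V \<and> x \<in> V \<and> V \<subseteq> W \<and> smooth_fun_on n V f"
  shows "smooth_fun_on n W f"
  unfolding smooth_fun_on_iff[OF openin_subset[OF W]]
proof (intro ballI conjI allI impI)
  fix js assume js: "js \<in> lists {..<n}"
  have V: "continuous_on V (iter_partial js f)"
       "\<And>i x. i < n \<Longrightarrow> x \<in> V \<Longrightarrow> (\<lambda>t. iter_partial js f (x(i := t))) differentiable (at (x i))"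
    if "openin (Euclidean_space n) V" "smooth_fun_on n V f" for V
    using that(2) js unfolding smooth_fun_on_iff[OF openin_subset[OF that(1)]] by blast+
  show "continuous_on W (iter_partial js f)"
    by (rule continuous_on_local) (use loc V in meson)
  show "(\<lambda>t. iter_partial js f (x(i := t))) differentiable (at (x i))" if "i < n" "x \<in> W" for i x
    using loc[OF that(2)] V(2)[OF _ _ that(1)] by blast
qed

lemma iter_partial_linear:
  assumes "smooth_fun_on n W f" "smooth_fun_on n W g" "js \<in> lists {..<n}" "x \<in> W"
  shows "iter_partial js (\<lambda>x. a * f x + b * g x) x = a * iter_partial js f x + b * iter_partial js g x"
  using assms(3,4)
proof (induction js arbitrary: x rule: list.induct)
  case (Cons j js)
  then have j: "j < n" "js \<in> lists {..<n}" by auto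
  have "iter_partial (j # js) (\<lambda>x. a * f x + b * g x) x =
      partial_deriv j (\<lambda>x. a * iter_partial js f x + b * iter_partial js g x) x"
    unfolding iter_partial_Cons
    by (rule partial_deriv_cong[OF W Cons.prems(2) j(1)]) (rule Cons.IH[OF j(2)])
  also have "\<dots> = a * iter_partial (j # js) f x + b * iter_partial (j # js) g x"
    unfolding partial_deriv_def
    by (intro DERIV_imp_deriv DERIV_add DERIV_cmult smooth_fun_on_D(2)[OF assms(1) j(2,1) Cons.prems(2)]
        smooth_fun_on_D(2)[OF assms(2) j(2,1) Cons.prems(2)])
  finally show ?case .
qed simp

text \<open>The iterated chain rule. Its point is the order of quantifiers: words and coefficients
  depend on js and \<tau> but not on f, so that bounds on the coefficients give estimates uniform in
  f. The expansion is a list because a word may occur with several coefficients.\<close>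

lemma iter_partial_compose_expand:
  assumes W': "openin (Euclidean_space m) W'" and \<tau>: "\<And>x. x \<in> W \<Longrightarrow> \<tau> x \<in> W'"
    "\<And>j. j < m \<Longrightarrow> smooth_fun_on n W (\<lambda>x. \<tau> x j)"
    and js: "js \<in> lists {..<n}"
  shows "\<exists>L. (\<forall>(s, a) \<in> set L. s \<in> lists {..<m} \<and> smooth_fun_on n W a) \<and>
     (\<forall>f. smooth_fun_on m W' f \<longrightarrow> (\<forall>x\<in>W. iter_partial js (\<lambda>x. f (\<tau> x)) x =
        (\<Sum>(s, a)\<leftarrow>L. a x * iter_partial s f (\<tau> x))))"
  using js
proof (induction js rule: list.induct)
  case Nil
  show ?case
    by (rule exI[of _ "[([], \<lambda>_. 1)]"]) (auto intro: smooth_fun_on_const)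
next
  case (Cons j js)
  then obtain L where L: "\<And>s a. (s, a) \<in> set L \<Longrightarrow> s \<in> lists {..<m} \<and> smooth_fun_on n W a"
    "\<And>f x. smooth_fun_on m W' f \<Longrightarrow> x \<in> W \<Longrightarrow> iter_partial js (\<lambda>x. f (\<tau> x)) x =
        (\<Sum>(s, a)\<leftarrow>L. a x * iter_partial s f (\<tau> x))" by fastforce
  from Cons.prems have j: "j < n" "js \<in> lists {..<n}" by auto
  define d where "d = (\<lambda>k. partial_deriv j (\<lambda>x. \<tau> x k))"
  have d: "smooth_fun_on n W (d k)" if "k < m" for k
    using smooth_fun_on_iter_partial[OF \<tau>(2)[OF that], of "[j]"] j
    by (simp add: d_def iter_partial_Cons)
  \<comment> \<open>Differentiating one summand: either the coefficient is differentiated and the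
    word kept, or the derivative falls on f after \<tau>, which puts a letter k in front of the word
    and multiplies the coefficient by the j-th derivative of component k of \<tau>.\<close>
  define L' where "L' = map (\<lambda>(s, a). (s, partial_deriv j a)) L @
     concat (map (\<lambda>(s, a). map (\<lambda>k. (k # s, \<lambda>x. a x * d k x)) [0..<m]) L)"
  have L'1: "s \<in> lists {..<m} \<and> smooth_fun_on n W a" if sa: "(s, a) \<in> set L'" for s a
  proof -
    consider a' where "(s, a') \<in> set L" "a = partial_deriv j a'"
      | k s' a' where "(s', a') \<in> set L" "k < m" "s = k # s'" "a = (\<lambda>x. a' x * d k x)"
      using sa unfolding L'_def by fastforce
    then show ?thesis
    proof cases
      case 1
      then show ?thesis using L(1)[OF 1(1)] smooth_fun_on_iter_partial[of a' "[j]"] j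
        by (simp add: iter_partial_Cons)
    next
      case 2
      then show ?thesis using L(1)[OF 2(1)] d by (auto intro: smooth_fun_on_mult)
    qed
  qed
  have L'2: "iter_partial (j # js) (\<lambda>x. f (\<tau> x)) x = (\<Sum>(s, a)\<leftarrow>L'. a x * iter_partial s f (\<tau> x))"
    if f: "smooth_fun_on m W' f" and x: "x \<in> W" for f x
  proof -
    have summand: "((\<lambda>t. a (x(j := t)) * iter_partial s f (\<tau> (x(j := t)))) has_real_derivative
        partial_deriv j a x * iter_partial s f (\<tau> x) +
        (\<Sum>k\<leftarrow>[0..<m]. (a x * d k x) * iter_partial (k # s) f (\<tau> x))) (at (x j))"
      if "(s, a) \<in> set L" for s a
    proof -
      have a: "((\<lambda>t. a (x(j := t))) has_real_derivative partial_deriv j a x) (at (x j))"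
        using smooth_fun_on_D(2)[of a "[]" j x] L(1)[OF that] j x by (simp only: iter_partial_Nil iter_partial_Cons lists.Nil)
      have ev: "\<forall>\<^sub>F t in nhds (x j). \<tau> (x(j := t)) \<in> Rn m"
        using eventually_upd_mem[OF W x j(1)]
        by eventually_elim (use \<tau> openin_subset[OF W'] in blast)
      have s: "s \<in> lists {..<m}" using L(1)[OF that] by blast
      have "((\<lambda>t. iter_partial s f (\<tau> (x(j := t)))) has_real_derivative
        (\<Sum>k<m. iter_partial (k # s) f (\<tau> (x(j := x j))) * d k x)) (at (x j))"
      proof (rule has_real_derivative_chain_Rn[OF W' _ ev])
        show "\<tau> (x(j := x j)) \<in> W'" using \<tau>(1)[OF x] by simp
        show "((\<lambda>t. \<tau> (x(j := t)) k) has_real_derivative d k x) (at (x j))"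
          if "k < m" for k
          using smooth_fun_on_D(2)[OF \<tau>(2)[OF that], of "[]" j x] j x
          by (simp only: iter_partial_Nil iter_partial_Cons lists.Nil d_def)
        show "((\<lambda>t. iter_partial s f (z(k := t))) has_real_derivative iter_partial (k # s) f z) (at (z k))"
          if "k < m" "z \<in> W'" for k z
        proof -
          have "(\<lambda>t. iter_partial s f (z(k := t))) differentiable (at (z k))"
            using f that s unfolding smooth_fun_on_iff[OF openin_subset[OF W']] by blast
          then show ?thesis
            unfolding iter_partial_Cons partial_deriv_def DERIV_deriv_iff_real_differentiable .
        qed
        have "k # s \<in> lists {..<m}" if "k < m" for k using s that by auto
        then show "continuous_on W' (iter_partial (k # s) f)" if "k < m" for k
          using f that unfolding smooth_fun_on_iff[OF openin_subset[OF W']] by blast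
      qed
      from DERIV_mult[OF a this] show ?thesis
        by (rule DERIV_cong)
          (simp add: interv_sum_list_conv_sum_set_nat atLeast0LessThan sum_distrib_left sum_distrib_right mult_ac)
    qed
    \<comment> \<open>Stated for lists with entries from L, so that an induction over the list keeps
      the knowledge that every summand comes from L.\<close>
    have sum: "((\<lambda>t. \<Sum>(s, a)\<leftarrow>L0. a (x(j := t)) * iter_partial s f (\<tau> (x(j := t)))) has_real_derivative
        (\<Sum>(s, a)\<leftarrow>L0. partial_deriv j a x * iter_partial s f (\<tau> x) +
        (\<Sum>k\<leftarrow>[0..<m]. (a x * d k x) * iter_partial (k # s) f (\<tau> x)))) (at (x j))"
      if "set L0 \<subseteq> set L" for L0
      using that
    proof (induction L0)
      case (Cons p L0)
      obtain s a where p: "p = (s, a)" by (cases p)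
      then have sa: "(s, a) \<in> set L" using Cons.prems by auto
      have IH: "((\<lambda>t. \<Sum>(s, a)\<leftarrow>L0. a (x(j := t)) * iter_partial s f (\<tau> (x(j := t)))) has_real_derivative
        (\<Sum>(s, a)\<leftarrow>L0. partial_deriv j a x * iter_partial s f (\<tau> x) +
        (\<Sum>k\<leftarrow>[0..<m]. (a x * d k x) * iter_partial (k # s) f (\<tau> x)))) (at (x j))"
        by (rule Cons.IH) (use Cons.prems in simp)
      show ?case unfolding p list.map sum_list.Cons prod.case
        by (rule DERIV_add[OF summand[OF sa] IH])
    qed simp
    have cong: "\<forall>\<^sub>F t in nhds (x j). iter_partial js (\<lambda>x. f (\<tau> x)) (x(j := t)) =
        (\<Sum>(s, a)\<leftarrow>L. a (x(j := t)) * iter_partial s f (\<tau> (x(j := t))))"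
      using eventually_upd_mem[OF W x j(1)] by eventually_elim (rule L(2)[OF f])
    have "iter_partial (j # js) (\<lambda>x. f (\<tau> x)) x =
       (\<Sum>(s, a)\<leftarrow>L. partial_deriv j a x * iter_partial s f (\<tau> x) +
        (\<Sum>k\<leftarrow>[0..<m]. (a x * d k x) * iter_partial (k # s) f (\<tau> x)))"
      unfolding iter_partial_Cons[of j js "\<lambda>x. f (\<tau> x)"] partial_deriv_def[of _ "iter_partial js (\<lambda>x. f (\<tau> x))"]
      by (rule DERIV_imp_deriv, rule iffD2[OF DERIV_cong_ev[OF refl cong refl] sum[OF order.refl]])
    also have "\<dots> = (\<Sum>(s, a)\<leftarrow>L'. a x * iter_partial s f (\<tau> x))"
      unfolding L'_def
      by (induction L) (auto simp: case_prod_beta sum_list.append o_def algebra_simps)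
    finally show ?thesis .
  qed
  show ?case
    by (rule exI[of _ L']) (use L'1 L'2 in blast)
qed

text \<open>Every derivative converges locally uniformly to some \<open>g js\<close>, which is
  continuous. The theorem on differentiating a sequence, used on coordinate lines, identifies
  \<open>g (j # js)\<close> as the j-th derivative of \<open>g js\<close>; hence the
  \<open>g js\<close> are the derivatives of the limit f.\<close>

lemma smooth_fun_on_limit:
  assumes u: "\<And>i::nat. smooth_fun_on n W (u i)"
    and cauchy: "\<And>js x. js \<in> lists {..<n} \<Longrightarrow> x \<in> W \<Longrightarrow> \<exists>V. openin (Euclidean_space n) V \<and> x \<in> V \<and> V \<subseteq> W \<and>
       uniformly_Cauchy_on V (\<lambda>i. iter_partial js (u i))"
    and f: "\<And>x. x \<in> W \<Longrightarrow> (\<lambda>i. u i x) \<longlonglongrightarrow> f x"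
  shows "smooth_fun_on n W f"
    and "js \<in> lists {..<n} \<Longrightarrow> x \<in> W \<Longrightarrow> (\<lambda>i. iter_partial js (u i) x) \<longlonglongrightarrow> iter_partial js f x"
proof -
  define g where "g = (\<lambda>js x. lim (\<lambda>i. iter_partial js (u i) x))"
  have loc: "\<exists>V. openin (Euclidean_space n) V \<and> x \<in> V \<and> V \<subseteq> W \<and>
       uniform_limit V (\<lambda>i. iter_partial js (u i)) (g js) sequentially"
    if jsx: "js \<in> lists {..<n}" "x \<in> W" for js x
  proof -
    obtain V where V: "openin (Euclidean_space n) V" "x \<in> V" "V \<subseteq> W"
      "uniformly_Cauchy_on V (\<lambda>i. iter_partial js (u i))" using cauchy[OF jsx] by blast
    then have uc: "uniformly_convergent_on V (\<lambda>i. iter_partial js (u i))"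
      using Cauchy_uniformly_convergent by blast
    then have "uniform_limit V (\<lambda>i. iter_partial js (u i)) (g js) sequentially"
      unfolding g_def uniformly_convergent_uniform_limit_iff by simp
    then show ?thesis using V by blast
  qed
  have g_lim: "(\<lambda>i. iter_partial js (u i) x) \<longlonglongrightarrow> g js x" if js: "js \<in> lists {..<n}" and x: "x \<in> W" for js x
  proof -
    obtain V where "x \<in> V" "uniform_limit V (\<lambda>i. iter_partial js (u i)) (g js) sequentially"
      using loc[OF js x] by blast
    then show ?thesis by (rule tendsto_uniform_limitI[rotated])
  qed
  have g_cont: "continuous_on W (g js)" if js: "js \<in> lists {..<n}" for js
  proof (rule continuous_on_local)
    fix x assume "x \<in> W"
    then obtain V where V: "openin (Euclidean_space n) V" "x \<in> V" "V \<subseteq> W"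
      "uniform_limit V (\<lambda>i. iter_partial js (u i)) (g js) sequentially" using loc[OF js] by blast
    have "continuous_on V (g js)"
      by (rule uniform_limit_theorem[OF _ V(4)])
        (use continuous_on_subset[OF smooth_fun_on_D(1)[OF u js] V(3)] in \<open>auto intro!: always_eventually\<close>)
    then show "\<exists>V. openin (Euclidean_space n) V \<and> x \<in> V \<and> V \<subseteq> W \<and> continuous_on V (g js)"
      using V by blast
  qed
  have g_der: "((\<lambda>t. g js (x(j := t))) has_real_derivative g (j # js) x) (at (x j))"
    if js: "js \<in> lists {..<n}" and j: "j < n" and x: "x \<in> W" for js j x
  proof -
    have jjs: "j # js \<in> lists {..<n}" using js j by auto
    obtain V where V: "openin (Euclidean_space n) V" "x \<in> V" "V \<subseteq> W"
      "uniform_limit V (\<lambda>i. iter_partial (j # js) (u i)) (g (j # js)) sequentially"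
      using loc[OF jjs x] by blast
    \<comment> \<open>Restriction to the coordinate line through x reduces the claim to functions of
      one variable on an interval on which the line stays in V.\<close>
    obtain e where e: "e > 0" "\<And>t. dist t (x j) < e \<Longrightarrow> x(j := t) \<in> V"
      using eventually_upd_mem[OF V(1,2) j] unfolding eventually_nhds_metric by blast
    let ?S = "ball (x j) e"
    have inV: "x(j := t) \<in> V" if "t \<in> ?S" for t using e(2)[of t] that by (simp add: dist_commute)
    have "\<exists>G. \<forall>t\<in>?S. (\<lambda>i. iter_partial js (u i) (x(j := t))) \<longlonglongrightarrow> G t \<and>
        (G has_derivative (\<lambda>h. g (j # js) (x(j := t)) * h)) (at t within ?S)"
    proof (rule has_derivative_sequence[where ?x0.0="x j" and
                    ?f'="\<lambda>i t h. iter_partial (j # js) (u i) (x(j := t)) * h"])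
      show "((\<lambda>t. iter_partial js (u i) (x(j := t))) has_derivative
          (\<lambda>h. iter_partial (j # js) (u i) (x(j := t)) * h)) (at t within ?S)" if "t \<in> ?S" for i t
      proof -
        have "x(j := t) \<in> W" using inV[OF that] V(3) by blast
        from smooth_fun_on_D(2)[OF u js j this, of i]
        have "((\<lambda>s. iter_partial js (u i) (x(j := s))) has_real_derivative
           iter_partial (j # js) (u i) (x(j := t))) (at t)" unfolding fun_upd_upd fun_upd_same .
        then show ?thesis unfolding has_field_derivative_def by (rule has_derivative_at_withinI)
      qed
      show "\<forall>\<^sub>F i in sequentially. \<forall>t\<in>?S. \<forall>h. norm (iter_partial (j # js) (u i) (x(j := t)) * h -
          g (j # js) (x(j := t)) * h) \<le> d * norm h" if "d > 0" for d
        using uniform_limitD[OF V(4) that]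
      proof eventually_elim
        case (elim i)
        show ?case
        proof (intro ballI allI)
          fix t h assume "t \<in> ?S"
          have "norm (iter_partial (j # js) (u i) (x(j := t)) * h - g (j # js) (x(j := t)) * h) =
             dist (iter_partial (j # js) (u i) (x(j := t))) (g (j # js) (x(j := t))) * norm h"
            by (simp add: dist_real_def left_diff_distrib[symmetric] abs_mult)
          also have "\<dots> \<le> d * norm h"
            by (rule mult_right_mono) (use elim inV[OF \<open>t \<in> ?S\<close>] in \<open>auto intro: less_imp_le\<close>)
          finally show "norm (iter_partial (j # js) (u i) (x(j := t)) * h - g (j # js) (x(j := t)) * h) \<le> d * norm h" .
        qed
      qed
      show "x j \<in> ?S" using e by simp
      show "(\<lambda>i. iter_partial js (u i) (x(j := x j))) \<longlonglongrightarrow> g js x"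
        unfolding fun_upd_triv by (rule g_lim[OF js x])
    qed simp
    then obtain G where G: "\<And>t. t \<in> ?S \<Longrightarrow> (\<lambda>i. iter_partial js (u i) (x(j := t))) \<longlonglongrightarrow> G t"
      "\<And>t. t \<in> ?S \<Longrightarrow> (G has_derivative (\<lambda>h. g (j # js) (x(j := t)) * h)) (at t within ?S)" by blast
    have "x j \<in> ?S" using e by simp
    from G(2)[OF this] have "(G has_derivative (\<lambda>h. g (j # js) x * h)) (at (x j))"
      unfolding fun_upd_triv using at_within_open[OF \<open>x j \<in> ?S\<close> open_ball] by simp
    then have Gd: "(G has_real_derivative g (j # js) x) (at (x j))"
      unfolding has_field_derivative_def .
    \<comment> \<open>The theorem yields only some limit function G; pointwise limits being unique,
      it is \<open>g js\<close> along the line.\<close>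
    have "\<forall>\<^sub>F t in nhds (x j). G t = g js (x(j := t))"
    proof -
      have "eventually (\<lambda>t. t \<in> ?S) (nhds (x j))" using \<open>x j \<in> ?S\<close> by (intro eventually_nhds_in_open) auto
      then show ?thesis
      proof eventually_elim
        case (elim t)
        have "x(j := t) \<in> W" using inV[OF elim] V(3) by blast
        then show ?case using LIMSEQ_unique[OF G(1)[OF elim] g_lim[OF js]] by blast
      qed
    qed
    from iffD1[OF DERIV_cong_ev[OF refl this refl] Gd] show ?thesis .
  qed
  have eq: "js \<in> lists {..<n} \<Longrightarrow> x \<in> W \<Longrightarrow> iter_partial js f x = g js x" for js x
  proof (induction js arbitrary: x)
    case Nil
    show ?case using LIMSEQ_unique[OF f[OF Nil(2)]] g_lim[OF Nil] by simp
  next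
    case (Cons j js)
    then have j: "j < n" "js \<in> lists {..<n}" by auto
    have "iter_partial (j # js) f x = partial_deriv j (g js) x"
      unfolding iter_partial_Cons
      by (rule partial_deriv_cong[OF W Cons.prems(2) j(1)]) (rule Cons.IH[OF j(2)])
    also have "\<dots> = g (j # js) x"
      unfolding partial_deriv_def by (rule DERIV_imp_deriv[OF g_der[OF j(2,1) Cons.prems(2)]])
    finally show ?case .
  qed
  show "smooth_fun_on n W f"
    unfolding smooth_fun_on_iff[OF openin_subset[OF W]]
  proof (intro ballI conjI allI impI)
    fix js assume js: "js \<in> lists {..<n}"
    show "continuous_on W (iter_partial js f)"
      using g_cont[OF js] continuous_on_cong[OF refl eq[OF js], of W] by simp
    fix j x assume "j < n" "x \<in> W"
    show "(\<lambda>t. iter_partial js f (x(j := t))) differentiable (at (x j))"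
      by (rule differentiable_upd_cong[OF W \<open>x \<in> W\<close> \<open>j < n\<close>, of "g js"])
        (use eq[OF js] g_der[OF js \<open>j < n\<close> \<open>x \<in> W\<close>] in \<open>auto simp only: real_differentiable_def\<close>)
  qed
  show "js \<in> lists {..<n} \<Longrightarrow> x \<in> W \<Longrightarrow> (\<lambda>i. iter_partial js (u i) x) \<longlonglongrightarrow> iter_partial js f x"
    using g_lim eq by simp
qed

end

text \<open>The standard transition from 0 to 1 between t = 0 and t = 1. The denominator never
  vanishes because t and 1 - t are not both nonpositive.\<close>

definition smooth_step :: "real \<Rightarrow> real" where
  "smooth_step t = flat_fun 0 t * inverse (flat_fun 0 t + flat_fun 0 (1 - t))"

lemma flat_fun_nonneg: "flat_fun 0 t \<ge> 0" and flat_fun_pos: "t > 0 \<Longrightarrow> flat_fun 0 t > 0"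
  and flat_fun_zero: "t \<le> 0 \<Longrightarrow> flat_fun 0 t = 0"
  by (auto simp: flat_fun_def)

lemma smooth_step_denom_pos: "flat_fun 0 t + flat_fun 0 (1 - t) > 0"
proof (cases "t > 0")
  case False
  then have "flat_fun 0 (1 - t) > 0" by (intro flat_fun_pos) simp
  then show ?thesis using flat_fun_nonneg[of t] by linarith
qed (use flat_fun_pos[of t] flat_fun_nonneg[of "1 - t"] in linarith)

lemma smooth_step_zero: "t \<le> 0 \<Longrightarrow> smooth_step t = 0"
  and smooth_step_one: "t \<ge> 1 \<Longrightarrow> smooth_step t = 1"
  and smooth_step_nonneg: "smooth_step t \<ge> 0"
  using smooth_step_denom_pos[of t] flat_fun_nonneg[of t]
  by (auto simp: smooth_step_def flat_fun_zero)

text \<open>Squaring avoids the absolute value, which is not smooth. For r > 0 a factor is 1 if the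
  ratio is at most 1 in absolute value and 0 if its square is at least 2; the radius 2 r used later
  is a round bound for this.\<close>

definition box_bump :: "nat \<Rightarrow> (nat \<Rightarrow> real) \<Rightarrow> real \<Rightarrow> (nat \<Rightarrow> real) \<Rightarrow> real" where
  "box_bump n c r u = (\<Prod>i<n. smooth_step (2 - ((u i - c i) / r)\<^sup>2))"

definition closed_box :: "nat \<Rightarrow> (nat \<Rightarrow> real) \<Rightarrow> real \<Rightarrow> (nat \<Rightarrow> real) set" where
  "closed_box n x e = {y \<in> Rn n. \<forall>i<n. \<bar>y i - x i\<bar> \<le> e}"

lemma box_bump_nonneg: "box_bump n c r u \<ge> 0"
  unfolding box_bump_def by (intro prod_nonneg ballI smooth_step_nonneg)

lemma box_bump_one:
  assumes "r > 0" "u \<in> closed_box n c r"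
  shows "box_bump n c r u = 1"
  unfolding box_bump_def
proof (rule prod.neutral, intro ballI smooth_step_one)
  fix i assume "i \<in> {..<n}"
  then have "\<bar>(u i - c i) / r\<bar> \<le> 1" using assms by (simp add: closed_box_def)
  then have "((u i - c i) / r)\<^sup>2 \<le> 1" by (simp add: abs_square_le_1)
  then show "1 \<le> 2 - ((u i - c i) / r)\<^sup>2" by simp
qed

lemma box_bump_zero:
  assumes "r > 0" "u \<in> Rn n" "u \<notin> closed_box n c (2 * r)"
  shows "box_bump n c r u = 0"
proof -
  \<comment> \<open>Since u lies in \<open>Rn n\<close>, it can only leave the box through one of
    the first n coordinates.\<close>
  obtain i where i: "i < n" "\<bar>u i - c i\<bar> > 2 * r" using assms by (auto simp: closed_box_def)
  then have "\<bar>(u i - c i) / r\<bar> \<ge> 2" using assms(1) by (simp add: field_simps)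
  then have "((u i - c i) / r)\<^sup>2 \<ge> 2\<^sup>2" by (metis abs_le_square_iff abs_numeral)
  then have "smooth_step (2 - ((u i - c i) / r)\<^sup>2) = 0" by (intro smooth_step_zero) simp
  then show ?thesis using i(1) unfolding box_bump_def by (intro prod_zero) auto
qed

lemma smooth_fun_on_box_bump:
  assumes W: "openin (Euclidean_space n) W"
  shows "smooth_fun_on n W (box_bump m c r)"
proof -
  have q: "smooth_fun_on n W (\<lambda>u. 2 - ((u i - c i) / r)\<^sup>2)" for i
  proof -
    have "smooth_fun_on n W (\<lambda>u. 2 + (-1) * (((u i + - c i) * inverse r) * ((u i + - c i) * inverse r)))"
      by (intro smooth_fun_on_add[OF W] smooth_fun_on_mult[OF W] smooth_fun_on_const[OF W]
          smooth_fun_on_coord[OF W])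
    then show ?thesis by (simp add: power2_eq_square divide_inverse)
  qed
  have s: "smooth_fun_on n W (\<lambda>u. smooth_step (f u))" if "smooth_fun_on n W f" for f
  proof -
    have "smooth_fun_on n W (\<lambda>u. 1 + (-1) * f u)"
      by (intro smooth_fun_on_add[OF W] smooth_fun_on_mult[OF W] smooth_fun_on_const[OF W] that)
    then have "smooth_fun_on n W (\<lambda>u. flat_fun 0 (1 - f u))"
      using smooth_fun_on_flat_fun[OF W, of "\<lambda>u. 1 + (-1) * f u" 0] by simp
    then have "smooth_fun_on n W (\<lambda>u. flat_fun 0 (f u) + flat_fun 0 (1 - f u))"
      by (rule smooth_fun_on_add[OF W smooth_fun_on_flat_fun[OF W that]])
    then have "smooth_fun_on n W (\<lambda>u. inverse (flat_fun 0 (f u) + flat_fun 0 (1 - f u)))"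
      by (rule smooth_fun_on_inverse[OF W]) (metis smooth_step_denom_pos less_irrefl)
    then show ?thesis unfolding smooth_step_def
      by (rule smooth_fun_on_mult[OF W smooth_fun_on_flat_fun[OF W that]])
  qed
  show ?thesis unfolding box_bump_def by (intro smooth_fun_on_prod[OF W] s q)
qed

text \<open>Tychonoff: inside the full product the box is a product of compact intervals and, from
  index n on, of the singleton of 0.\<close>

lemma compactin_closed_box: "compactin (Euclidean_space n) (closed_box n c r)"
proof -
  let ?B = "Pi\<^sub>E UNIV (\<lambda>i. if i < n then {c i - r..c i + r} else {0})"
  have "compactin (product_topology (\<lambda>i. euclideanreal) UNIV) ?B"
    by (subst compactin_PiE) auto
  moreover have "closed_box n c r = ?B"
  proof (rule Set.set_eqI, rule iffI)
    fix y assume "y \<in> closed_box n c r"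
    then show "y \<in> ?B" by (force simp: closed_box_def topspace_Euclidean_space PiE_iff abs_le_iff)
  next
    fix y assume y: "y \<in> ?B"
    then have "\<And>i. y i \<in> (if i < n then {c i - r..c i + r} else {0})" by (simp add: PiE_iff)
    then have "\<And>i. i < n \<Longrightarrow> c i - r \<le> y i \<and> y i \<le> c i + r" "\<And>i. i \<ge> n \<Longrightarrow> y i = 0"
      by (metis atLeastAtMost_iff, metis linorder_not_le singletonD)
    then show "y \<in> closed_box n c r"
      by (force simp: closed_box_def topspace_Euclidean_space abs_le_iff)
  qed
  ultimately have "compactin (product_topology (\<lambda>i. euclideanreal) UNIV) (closed_box n c r)" by metis
  moreover have "closed_box n c r \<subseteq> {x. \<forall>i\<ge>n. x i = 0}"
    by (auto simp: closed_box_def topspace_Euclidean_space)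
  ultimately show ?thesis unfolding Euclidean_space_def compactin_subtopology by blast
qed

lemma open_box_subset_closed_box: "open_box n c r \<subseteq> closed_box n c r"
  by (auto simp: open_box_def closed_box_def intro: less_imp_le)

lemma closed_box_subset_open_box: "r < s \<Longrightarrow> closed_box n c r \<subseteq> open_box n c s"
  by (force simp: open_box_def closed_box_def)

lemma closed_box_mono: "r \<le> s \<Longrightarrow> closed_box n c r \<subseteq> closed_box n c s"
  by (force simp: closed_box_def)

lemma openin_diff_closed_box: "openin (Euclidean_space n) (Rn n - closed_box n c r)"
  by (intro openin_diff openin_topspace compactin_imp_closedin Hausdorff_Euclidean_space compactin_closed_box)


section \<open>Smooth functions and maps on manifolds\<close>

lemma homeomorphic_map_inv_into:
  assumes "homeomorphic_map X Y f"
  shows "homeomorphic_map Y X (inv_into (topspace X) f)"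
proof -
  obtain g where g: "homeomorphic_maps X Y f g"
    using assms unfolding homeomorphic_map_maps by blast
  have inj: "inj_on f (topspace X)" by (rule homeomorphic_imp_injective_map[OF assms])
  have "g y = inv_into (topspace X) f y" if y: "y \<in> topspace Y" for y
  proof -
    have "g y \<in> topspace X" "f (g y) = y"
      using g y unfolding homeomorphic_maps_def continuous_map_def by auto
    then show ?thesis using inv_into_f_f[OF inj] by metis
  qed
  moreover have "homeomorphic_map Y X g" using g by (simp add: homeomorphic_maps_map)
  ultimately show ?thesis by (rule homeomorphic_map_eq[rotated])
qed

section \<open>Charts and their inverses\<close>

lemma is_chart_iff:
  "is_chart n T (U, \<phi>) \<longleftrightarrow> openin T U \<and> openin (Euclidean_space n) (\<phi> ` U) \<and>
     homeomorphic_map (subtopology T U) (subtopology (Euclidean_space n) (\<phi> ` U)) \<phi>"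
  by (simp add: is_chart_def)

context
  fixes n :: nat and T :: "'a topology" and U :: "'a set" and \<phi> :: "'a \<Rightarrow> nat \<Rightarrow> real"
  assumes c: "is_chart n T (U, \<phi>)"
begin

lemma chart_openin: "openin T U"
  and chart_open_range: "openin (Euclidean_space n) (\<phi> ` U)"
  and chart_homeo: "homeomorphic_map (subtopology T U) (subtopology (Euclidean_space n) (\<phi> ` U)) \<phi>"
  using c by (auto simp: is_chart_iff)

lemma chart_inj: "inj_on \<phi> U"
  using homeomorphic_imp_injective_map[OF chart_homeo] openin_subset[OF chart_openin]
  by (simp add: inf_absorb2)

lemma chart_inv [simp]: "p \<in> U \<Longrightarrow> inv_into U \<phi> (\<phi> p) = p"
  using chart_inj by (simp add: inv_into_f_f)

lemma chart_continuous: "continuous_map (subtopology T U) (Euclidean_space n) \<phi>"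
  using homeomorphic_imp_continuous_map[OF chart_homeo] by (simp add: continuous_map_in_subtopology)

lemma chart_inv_homeo:
  "homeomorphic_map (subtopology (Euclidean_space n) (\<phi> ` U)) (subtopology T U) (inv_into U \<phi>)"
  using homeomorphic_map_inv_into[OF chart_homeo] openin_subset[OF chart_openin]
  by (simp add: inf_absorb2)

lemma chart_inv_continuous: "continuous_map (subtopology (Euclidean_space n) (\<phi> ` U)) T (inv_into U \<phi>)"
  using homeomorphic_imp_continuous_map[OF chart_inv_homeo] by (simp add: continuous_map_in_subtopology)

lemma chart_open_image:
  assumes "openin T V" "V \<subseteq> U"
  shows "openin (Euclidean_space n) (\<phi> ` V)"
proof -
  have "openin (subtopology T U) V" using assms chart_openin by (simp add: openin_open_subtopology)
  then have "openin (subtopology (Euclidean_space n) (\<phi> ` U)) (\<phi> ` V)"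
    using homeomorphic_imp_open_map[OF chart_homeo] by (simp add: open_map_def)
  then show ?thesis using chart_open_range by (simp add: openin_open_subtopology)
qed

lemma chart_open_vimage:
  assumes "openin (Euclidean_space n) W"
  shows "openin T {p \<in> U. \<phi> p \<in> W}"
proof -
  have "openin (subtopology T U) {p \<in> topspace (subtopology T U). \<phi> p \<in> W}"
    by (rule openin_continuous_map_preimage[OF chart_continuous assms])
  then show ?thesis using chart_openin openin_subset[OF chart_openin]
    by (simp add: openin_open_subtopology inf_absorb2)
qed

lemma chart_in_Rn: "p \<in> U \<Longrightarrow> \<phi> p \<in> Rn n"
  using openin_subset[OF chart_open_range] by blast

lemma is_chart_restrict:
  assumes "openin T V" "V \<subseteq> U"
  shows "is_chart n T (V, \<phi>)"
proof -
  have U: "topspace (subtopology T U) = U" using openin_subset[OF chart_openin] by (simp add: inf_absorb2)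
  have "homeomorphic_map (subtopology (subtopology T U) V)
     (subtopology (subtopology (Euclidean_space n) (\<phi> ` U)) (\<phi> ` V)) \<phi>"
    by (rule homeomorphic_map_subtopologies[OF chart_homeo])
      (use U assms(2) openin_subset[OF chart_open_range] in auto)
  moreover have "U \<inter> V = V" "\<phi> ` U \<inter> \<phi> ` V = \<phi> ` V" using assms by auto
  ultimately show ?thesis
    using assms chart_open_image[OF assms] by (simp add: is_chart_iff subtopology_subtopology)
qed

text \<open>A chart does not carry its inverse; \<open>inv_into\<close> recovers it from the domain,
  so it changes as a term whenever the domain shrinks. This is the bridge.\<close>

lemma inv_into_restrict:
  assumes "V \<subseteq> U" "y \<in> \<phi> ` V"
  shows "inv_into V \<phi> y = inv_into U \<phi> y"
  using assms chart_inj by (metis (no_types, lifting) chart_inv image_iff inj_on_subset inv_into_f_f subsetD)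

end

section \<open>Maximal atlases\<close>

lemma atlas_maximal_compatible:
  assumes A: "\<And>c. c \<in> A \<Longrightarrow> is_chart n T c" "(\<Union>(U, \<phi>)\<in>A. U) = topspace T"
    and cd: "is_chart n T c" "is_chart n T d" "\<And>a. a \<in> A \<Longrightarrow> smooth_transition n c a"
      "\<And>a. a \<in> A \<Longrightarrow> smooth_transition n a d"
  shows "smooth_transition n c d"
proof -
  obtain U \<phi> V \<psi> where c: "c = (U, \<phi>)" and d: "d = (V, \<psi>)" by (cases c, cases d)
  have C: "is_chart n T (U, \<phi>)" and D: "is_chart n T (V, \<psi>)" using cd c d by auto
  have UV: "openin T (U \<inter> V)" using chart_openin[OF C] chart_openin[OF D] by blast
  show ?thesis unfolding c d smooth_transition_def prod.case
  proof (intro allI impI)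
    fix i assume i: "i < n"
    show "smooth_fun_on n (\<phi> ` (U \<inter> V)) (\<lambda>y. \<psi> (inv_into U \<phi> y) i)"
    proof (rule smooth_fun_on_local[OF chart_open_image[OF C UV]])
      fix y assume "y \<in> \<phi> ` (U \<inter> V)"
      then obtain p where p: "p \<in> U" "p \<in> V" "y = \<phi> p" by blast
      \<comment> \<open>Smoothness is local, and near p the transition from c to d factors through a
        chart Z of the atlas, on the common part of the three domains.\<close>
      then have "p \<in> (\<Union>(U, \<phi>)\<in>A. U)" using A(2) openin_subset[OF chart_openin[OF C]] by blast
      then obtain Z \<zeta> where Z: "(Z, \<zeta>) \<in> A" "p \<in> Z" by auto
      have ZC: "is_chart n T (Z, \<zeta>)" using A(1) Z(1) by blast
      let ?O = "U \<inter> V \<inter> Z"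
      have O: "openin T ?O" using UV chart_openin[OF ZC] by blast
      have ZV: "openin T (Z \<inter> V)" using chart_openin[OF D] chart_openin[OF ZC] by blast
      have UZ: "openin T (U \<inter> Z)" using chart_openin[OF C] chart_openin[OF ZC] by blast
      have O': "openin (Euclidean_space n) (\<phi> ` ?O)" by (rule chart_open_image[OF C O]) auto
      have 1: "smooth_fun_on n (\<zeta> ` (Z \<inter> V)) (\<lambda>y. \<psi> (inv_into Z \<zeta> y) i)"
        using cd(4)[OF Z(1)] i unfolding d smooth_transition_def by simp
      have 2: "smooth_fun_on n (\<phi> ` ?O) (\<lambda>y. \<zeta> (inv_into U \<phi> y) j)" if "j < n" for j
      proof (rule smooth_fun_on_subset)
        show "openin (Euclidean_space n) (\<phi> ` (U \<inter> Z))" by (rule chart_open_image[OF C UZ]) auto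
        show "smooth_fun_on n (\<phi> ` (U \<inter> Z)) (\<lambda>y. \<zeta> (inv_into U \<phi> y) j)"
          using cd(3)[OF Z(1)] that unfolding c smooth_transition_def by simp
      qed auto
      have "smooth_fun_on n (\<phi> ` ?O) (\<lambda>y. \<psi> (inv_into Z \<zeta> (\<zeta> (inv_into U \<phi> y))) i)"
        by (rule smooth_fun_on_compose[OF O' chart_open_image[OF ZC ZV] 1 _ 2])
          (auto simp: chart_inv[OF C])
      then have "smooth_fun_on n (\<phi> ` ?O) (\<lambda>y. \<psi> (inv_into U \<phi> y) i)"
        by (rule smooth_fun_on_cong[OF O', rotated]) (auto simp: chart_inv[OF C] chart_inv[OF ZC])
      then show "\<exists>W. openin (Euclidean_space n) W \<and> y \<in> W \<and> W \<subseteq> \<phi> ` (U \<inter> V) \<and>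
          smooth_fun_on n W (\<lambda>y. \<psi> (inv_into U \<phi> y) i)"
        using O' p Z by (intro exI[of _ "\<phi> ` ?O"]) auto
    qed auto
  qed
qed

text \<open>The atlas half of \<open>smooth_manifold\<close>. Kept apart from the separation and
  countability axioms, it passes by itself to products and open submanifolds.\<close>

definition smooth_structure :: "'a manifold \<Rightarrow> bool" where
  "smooth_structure N \<longleftrightarrow> atlas (mdim N) (mtop N) (mcharts N) \<and>
     maximal_atlas (mdim N) (mtop N) (mcharts N) = mcharts N"

lemma smooth_manifold_iff:
  "smooth_manifold N \<longleftrightarrow> Hausdorff_space (mtop N) \<and> second_countable (mtop N) \<and> smooth_structure N"
  by (auto simp: smooth_manifold_def smooth_structure_def)

lemma maximal_atlas_structure:
  assumes A: "atlas n T A"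
  shows "atlas n T (maximal_atlas n T A)"
    and "maximal_atlas n T (maximal_atlas n T A) = maximal_atlas n T A"
    and "A \<subseteq> maximal_atlas n T A"
proof -
  have Ac: "\<And>c. c \<in> A \<Longrightarrow> is_chart n T c" "(\<Union>(U, \<phi>)\<in>A. U) = topspace T"
    "\<And>c d. c \<in> A \<Longrightarrow> d \<in> A \<Longrightarrow> compatible_charts n c d" using A by (auto simp: atlas_def)
  show sub: "A \<subseteq> maximal_atlas n T A" using Ac by (auto simp: maximal_atlas_def)
  have tr: "smooth_transition n c d" if "c \<in> maximal_atlas n T A" "d \<in> maximal_atlas n T A" for c d
    by (rule atlas_maximal_compatible[OF Ac(1,2)])
      (use that in \<open>auto simp: maximal_atlas_def compatible_charts_def\<close>)
  then have compat: "compatible_charts n c d" if "c \<in> maximal_atlas n T A" "d \<in> maximal_atlas n T A" for c d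
    using that by (simp add: compatible_charts_def)
  have "U \<subseteq> topspace T" if "(U, \<phi>) \<in> maximal_atlas n T A" for U \<phi>
    using that chart_openin[of n T U \<phi>] openin_subset by (auto simp: maximal_atlas_def)
  then have "(\<Union>(U, \<phi>)\<in>maximal_atlas n T A. U) \<subseteq> topspace T" by auto
  moreover have "topspace T \<subseteq> (\<Union>(U, \<phi>)\<in>maximal_atlas n T A. U)" using sub Ac(2) by blast
  ultimately have cover: "(\<Union>(U, \<phi>)\<in>maximal_atlas n T A. U) = topspace T" by (rule subset_antisym)
  have chart: "is_chart n T c" if "c \<in> maximal_atlas n T A" for c
    using that unfolding maximal_atlas_def by simp
  show "atlas n T (maximal_atlas n T A)"
    unfolding atlas_def using cover chart compat by blast
  have max: "c \<in> maximal_atlas n T B \<longleftrightarrow> is_chart n T c \<and> (\<forall>d\<in>B. compatible_charts n c d)" for c B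
    unfolding maximal_atlas_def by simp
  show "maximal_atlas n T (maximal_atlas n T A) = maximal_atlas n T A"
  proof (intro subset_antisym subsetI)
    fix c assume "c \<in> maximal_atlas n T (maximal_atlas n T A)"
    then have "is_chart n T c" "\<And>d. d \<in> maximal_atlas n T A \<Longrightarrow> compatible_charts n c d"
      unfolding max[of c "maximal_atlas n T A"] by blast+
    then show "c \<in> maximal_atlas n T A" unfolding max[of c A] using sub by blast
  next
    fix c assume "c \<in> maximal_atlas n T A"
    then show "c \<in> maximal_atlas n T (maximal_atlas n T A)"
      unfolding max[of c "maximal_atlas n T A"] using compat chart by blast
  qed
qed

text \<open>Smoothness on a part A of the manifold, freed from \<open>extensional\<close> and
  witnessed by one chart around each point inside A. In this form functions can be restricted, glued
  and composed; \<open>smooth_functions_iff\<close> leads back to the function space.\<close>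

definition smooth_real :: "'a manifold \<Rightarrow> 'a set \<Rightarrow> ('a \<Rightarrow> real) \<Rightarrow> bool" where
  "smooth_real N A f \<longleftrightarrow> (\<forall>p\<in>A. \<exists>U \<phi>. (U, \<phi>) \<in> mcharts N \<and> p \<in> U \<and> U \<subseteq> A \<and>
     smooth_fun_on (mdim N) (\<phi> ` U) (\<lambda>y. f (inv_into U \<phi> y)))"

context
  fixes N :: "'a manifold"
  assumes N: "smooth_structure N"
begin

lemma mcharts_is_chart: "c \<in> mcharts N \<Longrightarrow> is_chart (mdim N) (mtop N) c"
  and mcharts_cover: "p \<in> mpoints N \<Longrightarrow> \<exists>U \<phi>. (U, \<phi>) \<in> mcharts N \<and> p \<in> U"
  and mcharts_maximal: "is_chart (mdim N) (mtop N) c \<Longrightarrow>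
    (\<And>d. d \<in> mcharts N \<Longrightarrow> compatible_charts (mdim N) c d) \<Longrightarrow> c \<in> mcharts N"
proof -
  have a: "atlas (mdim N) (mtop N) (mcharts N)" "maximal_atlas (mdim N) (mtop N) (mcharts N) = mcharts N"
    using N by (auto simp: smooth_structure_def)
  show "c \<in> mcharts N \<Longrightarrow> is_chart (mdim N) (mtop N) c" using a(1) by (auto simp: atlas_def)
  show "\<exists>U \<phi>. (U, \<phi>) \<in> mcharts N \<and> p \<in> U" if "p \<in> mpoints N"
  proof -
    have "p \<in> (\<Union>(U, \<phi>)\<in>mcharts N. U)" using that a(1) by (simp add: atlas_def)
    then show ?thesis by auto
  qed
  show "is_chart (mdim N) (mtop N) c \<Longrightarrow>
    (\<And>d. d \<in> mcharts N \<Longrightarrow> compatible_charts (mdim N) c d) \<Longrightarrow> c \<in> mcharts N"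
    using a(2) unfolding maximal_atlas_def by blast
qed

lemma mcharts_transition:
  assumes "(U, \<phi>) \<in> mcharts N" "(V, \<psi>) \<in> mcharts N" "i < mdim N"
  shows "smooth_fun_on (mdim N) (\<phi> ` (U \<inter> V)) (\<lambda>y. \<psi> (inv_into U \<phi> y) i)"
proof -
  have "compatible_charts (mdim N) (U, \<phi>) (V, \<psi>)"
    using N assms by (auto simp: smooth_structure_def atlas_def)
  then show ?thesis using assms(3) by (simp add: compatible_charts_def smooth_transition_def)
qed

lemmas mchart_openin = chart_openin[OF mcharts_is_chart]
lemmas mchart_inv = chart_inv[OF mcharts_is_chart]
lemmas mchart_open_image = chart_open_image[OF mcharts_is_chart]
lemmas mchart_inv_restrict = inv_into_restrict[OF mcharts_is_chart]

text \<open>Maximality at work: a restricted chart inherits the transitions of the original one, so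
  it belongs to the structure already.\<close>

lemma mcharts_restrict:
  assumes U: "(U, \<phi>) \<in> mcharts N" and V: "openin (mtop N) V" "V \<subseteq> U"
  shows "(V, \<phi>) \<in> mcharts N"
proof (rule mcharts_maximal)
  note C = mcharts_is_chart[OF U]
  show VC: "is_chart (mdim N) (mtop N) (V, \<phi>)" by (rule is_chart_restrict[OF C V])
  fix d assume d: "d \<in> mcharts N"
  obtain Z \<zeta> where d': "d = (Z, \<zeta>)" by (cases d)
  have D: "is_chart (mdim N) (mtop N) (Z, \<zeta>)" using mcharts_is_chart[OF d] d' by simp
  have op: "openin (mtop N) (U \<inter> Z)" "openin (mtop N) (V \<inter> Z)" "openin (mtop N) (Z \<inter> U)" "openin (mtop N) (Z \<inter> V)"
    using chart_openin[OF C] chart_openin[OF D] V by auto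
  show "compatible_charts (mdim N) (V, \<phi>) d"
    unfolding compatible_charts_def d' smooth_transition_def prod.case
  proof (intro conjI allI impI)
    fix i assume i: "i < mdim N"
    have "smooth_fun_on (mdim N) (\<phi> ` (V \<inter> Z)) (\<lambda>y. \<zeta> (inv_into U \<phi> y) i)"
      by (rule smooth_fun_on_subset[OF chart_open_image[OF C op(1)] mcharts_transition[OF U d[unfolded d'] i]])
        (use V in auto)
    then show "smooth_fun_on (mdim N) (\<phi> ` (V \<inter> Z)) (\<lambda>y. \<zeta> (inv_into V \<phi> y) i)"
      by (rule smooth_fun_on_cong[OF chart_open_image[OF C op(2)], rotated -1])
        (use V in \<open>auto simp: inv_into_restrict[OF C V(2)]\<close>)
    show "smooth_fun_on (mdim N) (\<zeta> ` (Z \<inter> V)) (\<lambda>y. \<phi> (inv_into Z \<zeta> y) i)"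
      by (rule smooth_fun_on_subset[OF chart_open_image[OF D op(3)] mcharts_transition[OF d[unfolded d'] U i]])
        (use V in auto)
  qed
qed

lemma mcharts_at:
  assumes "openin (mtop N) A" "p \<in> A"
  obtains U \<phi> where "(U, \<phi>) \<in> mcharts N" "p \<in> U" "U \<subseteq> A"
proof -
  obtain U \<phi> where U: "(U, \<phi>) \<in> mcharts N" "p \<in> U"
    using mcharts_cover assms openin_subset by blast
  have "(U \<inter> A, \<phi>) \<in> mcharts N"
    by (rule mcharts_restrict[OF U(1)]) (use mchart_openin[OF U(1)] assms(1) in auto)
  then show thesis using that[of "U \<inter> A"] U assms by auto
qed

lemma smooth_fun_on_change:
  assumes U: "(U, \<phi>) \<in> mcharts N" and V: "(V, \<psi>) \<in> mcharts N" and B: "openin (mtop N) B" "B \<subseteq> U" "B \<subseteq> V"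
    and f: "smooth_fun_on (mdim N) (\<phi> ` B) (\<lambda>y. f (inv_into U \<phi> y))"
  shows "smooth_fun_on (mdim N) (\<psi> ` B) (\<lambda>y. f (inv_into V \<psi> y))"
proof -
  have OB: "openin (Euclidean_space (mdim N)) (\<psi> ` B)" by (rule mchart_open_image[OF V B(1,3)])
  have VU: "openin (mtop N) (V \<inter> U)" using mchart_openin[OF U] mchart_openin[OF V] by blast
  have "smooth_fun_on (mdim N) (\<psi> ` B) (\<lambda>y. f (inv_into U \<phi> (\<phi> (inv_into V \<psi> y))))"
  proof (rule smooth_fun_on_compose[OF OB mchart_open_image[OF U B(1,2)] f])
    show "smooth_fun_on (mdim N) (\<psi> ` B) (\<lambda>y. \<phi> (inv_into V \<psi> y) j)" if "j < mdim N" for j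
      by (rule smooth_fun_on_subset[OF mchart_open_image[OF V VU] mcharts_transition[OF V U that]])
        (use B in auto)
  qed (use B mchart_inv[OF V] in auto)
  then show ?thesis
    by (rule smooth_fun_on_cong[OF OB, rotated]) (use B mchart_inv[OF V] mchart_inv[OF U] in \<open>auto simp: subset_iff\<close>)
qed

text \<open>One suitable chart per point is enough for all charts, because transitions are smooth
  and smoothness is local.\<close>

lemma smooth_realD:
  assumes f: "smooth_real N A f" and U: "(U, \<phi>) \<in> mcharts N" and B: "openin (mtop N) B" "B \<subseteq> U" "B \<subseteq> A"
  shows "smooth_fun_on (mdim N) (\<phi> ` B) (\<lambda>y. f (inv_into U \<phi> y))"
proof (rule smooth_fun_on_local[OF mchart_open_image[OF U B(1,2)]])
  fix y assume "y \<in> \<phi> ` B"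
  then obtain p where p: "p \<in> B" "y = \<phi> p" by blast
  then obtain V \<psi> where V: "(V, \<psi>) \<in> mcharts N" "p \<in> V"
    "smooth_fun_on (mdim N) (\<psi> ` V) (\<lambda>y. f (inv_into V \<psi> y))"
    using f B unfolding smooth_real_def by blast
  have BV: "openin (mtop N) (B \<inter> V)" using mchart_openin[OF V(1)] B by blast
  have "smooth_fun_on (mdim N) (\<psi> ` (B \<inter> V)) (\<lambda>y. f (inv_into V \<psi> y))"
    by (rule smooth_fun_on_subset[OF mchart_open_image[OF V(1) mchart_openin[OF V(1)]] V(3)]) auto
  then have "smooth_fun_on (mdim N) (\<phi> ` (B \<inter> V)) (\<lambda>y. f (inv_into U \<phi> y))"
    by (rule smooth_fun_on_change[OF V(1) U BV, rotated -1]) (use B in auto)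
  moreover have "openin (Euclidean_space (mdim N)) (\<phi> ` (B \<inter> V))"
    by (rule mchart_open_image[OF U BV]) (use B in auto)
  ultimately show "\<exists>W. openin (Euclidean_space (mdim N)) W \<and> y \<in> W \<and> W \<subseteq> \<phi> ` B \<and>
      smooth_fun_on (mdim N) W (\<lambda>y. f (inv_into U \<phi> y))"
    using p V(2) by (intro exI[of _ "\<phi> ` (B \<inter> V)"]) auto
qed

lemma smooth_real_chartI:
  assumes U: "(U, \<phi>) \<in> mcharts N" and "smooth_fun_on (mdim N) (\<phi> ` U) (\<lambda>y. f (inv_into U \<phi> y))"
  shows "smooth_real N U f"
  using assms unfolding smooth_real_def by blast

lemma smooth_real_iff:
  assumes "openin (mtop N) A"
  shows "smooth_real N A f \<longleftrightarrow> (\<forall>U \<phi>. (U, \<phi>) \<in> mcharts N \<longrightarrow> U \<subseteq> A \<longrightarrow>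
    smooth_fun_on (mdim N) (\<phi> ` U) (\<lambda>y. f (inv_into U \<phi> y)))" (is "?l \<longleftrightarrow> ?r")
proof
  show "?l \<Longrightarrow> ?r" using smooth_realD mchart_openin by blast
  assume ?r
  then show ?l unfolding smooth_real_def using mcharts_at[OF assms] by metis
qed

lemma smooth_functions_iff:
  "smooth_functions N = {f \<in> extensional (mpoints N). smooth_real N (mpoints N) f}"
proof -
  have "U \<subseteq> mpoints N" if "(U, \<phi>) \<in> mcharts N" for U \<phi>
    using mchart_openin[OF that] openin_subset by blast
  then show ?thesis
    unfolding smooth_functions_def smooth_real_iff[OF openin_topspace] by (fastforce simp: o_def)
qed

lemma smooth_real_local:
  assumes "\<And>p. p \<in> A \<Longrightarrow> \<exists>B. p \<in> B \<and> B \<subseteq> A \<and> smooth_real N B f"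
  shows "smooth_real N A f"
  using assms unfolding smooth_real_def by (meson order_trans)

lemma smooth_real_subset:
  assumes "smooth_real N A f" "openin (mtop N) B" "B \<subseteq> A"
  shows "smooth_real N B f"
  unfolding smooth_real_iff[OF assms(2)]
  using smooth_realD[OF assms(1)] mchart_openin assms(3) by (meson order.refl order_trans)

lemma smooth_real_cong:
  assumes "\<And>p. p \<in> A \<Longrightarrow> f p = g p" "smooth_real N A f"
  shows "smooth_real N A g"
  unfolding smooth_real_def
proof
  fix p assume "p \<in> A"
  then obtain U \<phi> where U: "(U, \<phi>) \<in> mcharts N" "p \<in> U" "U \<subseteq> A"
     "smooth_fun_on (mdim N) (\<phi> ` U) (\<lambda>y. f (inv_into U \<phi> y))"
    using assms(2) unfolding smooth_real_def by blast
  have "smooth_fun_on (mdim N) (\<phi> ` U) (\<lambda>y. g (inv_into U \<phi> y))"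
    by (rule smooth_fun_on_cong[OF mchart_open_image[OF U(1) mchart_openin[OF U(1)] order.refl] _ U(4)])
      (use U(3) assms(1) mchart_inv[OF U(1)] in \<open>auto simp: subset_iff\<close>)
  then show "\<exists>U \<phi>. (U, \<phi>) \<in> mcharts N \<and> p \<in> U \<and> U \<subseteq> A \<and>
     smooth_fun_on (mdim N) (\<phi> ` U) (\<lambda>y. g (inv_into U \<phi> y))" using U by blast
qed

lemma smooth_real_compose:
  assumes A: "openin (mtop N) A" and W: "openin (Euclidean_space k) W" "smooth_fun_on k W F"
    and g: "\<And>p. p \<in> A \<Longrightarrow> g p \<in> W" "\<And>j. j < k \<Longrightarrow> smooth_real N A (\<lambda>p. g p j)"
  shows "smooth_real N A (\<lambda>p. F (g p))"
  unfolding smooth_real_iff[OF A]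
proof (intro allI impI)
  fix U \<phi> assume U: "(U, \<phi>) \<in> mcharts N" "U \<subseteq> A"
  show "smooth_fun_on (mdim N) (\<phi> ` U) (\<lambda>y. F (g (inv_into U \<phi> y)))"
    by (rule smooth_fun_on_compose[OF mchart_open_image[OF U(1) mchart_openin[OF U(1)] order.refl] W])
      (use U g(1) mchart_inv[OF U(1)] smooth_realD[OF g(2) U(1) mchart_openin[OF U(1)] order.refl U(2)] in
        \<open>auto simp: subset_iff\<close>)
qed

lemma smooth_real_const:
  assumes "openin (mtop N) A"
  shows "smooth_real N A (\<lambda>p. c)"
  unfolding smooth_real_iff[OF assms]
proof (intro allI impI)
  fix U \<phi> assume U: "(U, \<phi>) \<in> mcharts N"
  show "smooth_fun_on (mdim N) (\<phi> ` U) (\<lambda>y. c)"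
    by (rule smooth_fun_on_const[OF mchart_open_image[OF U mchart_openin[OF U] order.refl]])
qed

lemma smooth_real_add:
  assumes A: "openin (mtop N) A" and fg: "smooth_real N A f" "smooth_real N A g"
  shows "smooth_real N A (\<lambda>p. f p + g p)"
  unfolding smooth_real_iff[OF A]
proof (intro allI impI)
  fix U \<phi> assume U: "(U, \<phi>) \<in> mcharts N" "U \<subseteq> A"
  note O = mchart_openin[OF U(1)]
  show "smooth_fun_on (mdim N) (\<phi> ` U) (\<lambda>y. f (inv_into U \<phi> y) + g (inv_into U \<phi> y))"
    by (rule smooth_fun_on_add[OF mchart_open_image[OF U(1) O order.refl]
        smooth_realD[OF fg(1) U(1) O order.refl U(2)] smooth_realD[OF fg(2) U(1) O order.refl U(2)]])
qed

lemma smooth_real_mult: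
  assumes A: "openin (mtop N) A" and fg: "smooth_real N A f" "smooth_real N A g"
  shows "smooth_real N A (\<lambda>p. f p * g p)"
  unfolding smooth_real_iff[OF A]
proof (intro allI impI)
  fix U \<phi> assume U: "(U, \<phi>) \<in> mcharts N" "U \<subseteq> A"
  note O = mchart_openin[OF U(1)]
  show "smooth_fun_on (mdim N) (\<phi> ` U) (\<lambda>y. f (inv_into U \<phi> y) * g (inv_into U \<phi> y))"
    by (rule smooth_fun_on_mult[OF mchart_open_image[OF U(1) O order.refl]
        smooth_realD[OF fg(1) U(1) O order.refl U(2)] smooth_realD[OF fg(2) U(1) O order.refl U(2)]])
qed

lemma smooth_real_inverse:
  assumes A: "openin (mtop N) A" and f: "smooth_real N A f" "\<And>p. p \<in> A \<Longrightarrow> f p \<noteq> 0"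
  shows "smooth_real N A (\<lambda>p. inverse (f p))"
  unfolding smooth_real_iff[OF A]
proof (intro allI impI)
  fix U \<phi> assume U: "(U, \<phi>) \<in> mcharts N" "U \<subseteq> A"
  note O = mchart_openin[OF U(1)]
  show "smooth_fun_on (mdim N) (\<phi> ` U) (\<lambda>y. inverse (f (inv_into U \<phi> y)))"
    by (rule smooth_fun_on_inverse[OF mchart_open_image[OF U(1) O order.refl]
        smooth_realD[OF f(1) U(1) O order.refl U(2)]])
      (use f(2) U mchart_inv[OF U(1)] in \<open>auto simp: subset_iff\<close>)
qed

lemma smooth_real_sum:
  assumes A: "openin (mtop N) A" and "\<And>j. j \<in> J \<Longrightarrow> smooth_real N A (f j)"
  shows "smooth_real N A (\<lambda>p. \<Sum>j\<in>J. f j p)"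
  using assms(2)
  by (induction J rule: infinite_finite_induct) (auto intro: smooth_real_const[OF A] smooth_real_add[OF A])

lemma smooth_real_chart_fun:
  assumes U: "(U, \<phi>) \<in> mcharts N" and F: "smooth_fun_on (mdim N) (\<phi> ` U) F"
  shows "smooth_real N U (\<lambda>p. F (\<phi> p))"
  by (rule smooth_real_chartI[OF U], rule smooth_fun_on_cong[OF mchart_open_image[OF U mchart_openin[OF U] order.refl] _ F])
    (use mchart_inv[OF U] in auto)

lemma smooth_real_coord:
  assumes U: "(U, \<phi>) \<in> mcharts N"
  shows "smooth_real N U (\<lambda>p. \<phi> p i)"
  by (rule smooth_real_chart_fun[OF U smooth_fun_on_coord[OF mchart_open_image[OF U mchart_openin[OF U] order.refl]]])

lemma smooth_real_continuous:
  assumes A: "openin (mtop N) A" and f: "smooth_real N A f"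
  shows "continuous_map (subtopology (mtop N) A) euclideanreal f"
proof -
  let ?I = "{(U, \<phi>). (U, \<phi>) \<in> mcharts N \<and> U \<subseteq> A}"
  show ?thesis
  proof (rule pasting_lemma[where I="?I" and T=fst and f="\<lambda>_. f"])
    fix c assume "c \<in> ?I"
    then obtain U \<phi> where c: "c = (U, \<phi>)" and U: "(U, \<phi>) \<in> mcharts N" "U \<subseteq> A" by auto
    note C = mcharts_is_chart[OF U(1)] and O = mchart_openin[OF U(1)]
    show "openin (subtopology (mtop N) A) (fst c)" using O U(2) A c by (simp add: openin_open_subtopology)
    have UT: "U \<subseteq> mpoints N" by (rule openin_subset[OF O])
    have "smooth_fun_on (mdim N) (\<phi> ` U) (\<lambda>y. f (inv_into U \<phi> y))"
      by (rule smooth_realD[OF f U(1) O order.refl U(2)])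
    then have "continuous_map (subtopology (Euclidean_space (mdim N)) (\<phi> ` U)) euclideanreal (\<lambda>y. f (inv_into U \<phi> y))"
      unfolding smooth_fun_on_def by (metis iter_partial_Nil lists.Nil)
    from continuous_map_compose[OF homeomorphic_imp_continuous_map[OF chart_homeo[OF C]] this]
    have "continuous_map (subtopology (mtop N) U) euclideanreal f"
      by (rule continuous_map_eq) (use UT chart_inv[OF C] in auto)
    then show "continuous_map (subtopology (subtopology (mtop N) A) (fst c)) euclideanreal f"
      using U(2) c by (simp add: subtopology_subtopology inf_absorb2)
  next
    fix p assume "p \<in> topspace (subtopology (mtop N) A)"
    then have "p \<in> A" by simp
    from mcharts_at[OF A this] obtain U \<phi> where "(U, \<phi>) \<in> mcharts N" "p \<in> U" "U \<subseteq> A" .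
    then show "\<exists>c. c \<in> ?I \<and> p \<in> fst c \<and> f p = f p" by force
  qed auto
qed

section \<open>Open submanifolds\<close>

lemma smooth_structure_open_submanifold:
  assumes A: "openin (mtop N) A"
  shows "smooth_structure (open_submanifold N A)"
proof -
  let ?T = "subtopology (mtop N) A" and ?n = "mdim N"
  have chart: "is_chart ?n ?T (V, \<psi>) \<longleftrightarrow> is_chart ?n (mtop N) (V, \<psi>) \<and> V \<subseteq> A" for V \<psi>
    using A openin_subset[of ?T V]
    by (auto simp: is_chart_iff openin_open_subtopology subtopology_subtopology inf_absorb2)
  have at: "atlas ?n ?T {(V, \<psi>). (V, \<psi>) \<in> mcharts N \<and> V \<subseteq> A}"
    unfolding atlas_def
  proof (intro conjI ballI)
    show "is_chart ?n ?T c" if "c \<in> {(V, \<psi>). (V, \<psi>) \<in> mcharts N \<and> V \<subseteq> A}" for c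
      using that mcharts_is_chart chart by auto
    show "compatible_charts ?n c d" if "c \<in> {(V, \<psi>). (V, \<psi>) \<in> mcharts N \<and> V \<subseteq> A}"
      "d \<in> {(V, \<psi>). (V, \<psi>) \<in> mcharts N \<and> V \<subseteq> A}" for c d
      using that N by (auto simp: smooth_structure_def atlas_def)
    show "(\<Union>(U, \<phi>)\<in>{(V, \<psi>). (V, \<psi>) \<in> mcharts N \<and> V \<subseteq> A}. U) = topspace ?T"
    proof
      show "(\<Union>(U, \<phi>)\<in>{(V, \<psi>). (V, \<psi>) \<in> mcharts N \<and> V \<subseteq> A}. U) \<subseteq> topspace ?T"
        using mchart_openin openin_subset by fastforce
      show "topspace ?T \<subseteq> (\<Union>(U, \<phi>)\<in>{(V, \<psi>). (V, \<psi>) \<in> mcharts N \<and> V \<subseteq> A}. U)"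
      proof
        fix p assume "p \<in> topspace ?T"
        then have "p \<in> A" by simp
        from mcharts_at[OF A this] obtain U \<phi> where "(U, \<phi>) \<in> mcharts N" "p \<in> U" "U \<subseteq> A" .
        then show "p \<in> (\<Union>(U, \<phi>)\<in>{(V, \<psi>). (V, \<psi>) \<in> mcharts N \<and> V \<subseteq> A}. U)" by blast
      qed
    qed
  qed
  have "maximal_atlas ?n ?T {(V, \<psi>). (V, \<psi>) \<in> mcharts N \<and> V \<subseteq> A} \<subseteq> {(V, \<psi>). (V, \<psi>) \<in> mcharts N \<and> V \<subseteq> A}"
  proof
    fix c assume c: "c \<in> maximal_atlas ?n ?T {(V, \<psi>). (V, \<psi>) \<in> mcharts N \<and> V \<subseteq> A}"
    obtain V \<psi> where cV: "c = (V, \<psi>)" by (cases c)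
    have V: "is_chart ?n (mtop N) (V, \<psi>)" "V \<subseteq> A"
      using c cV chart by (auto simp: maximal_atlas_def)
    have "(V, \<psi>) \<in> mcharts N"
    proof (rule mcharts_maximal[OF V(1)])
      fix d assume d: "d \<in> mcharts N"
      obtain Z \<zeta> where dZ: "d = (Z, \<zeta>)" by (cases d)
      have ZA: "openin (mtop N) (Z \<inter> A)" using mchart_openin[OF d[unfolded dZ]] A by blast
      \<comment> \<open>A chart of the ambient manifold is tested through its restriction to A; as V
        lies in A, the overlaps with V are the same.\<close>
      have "(Z \<inter> A, \<zeta>) \<in> mcharts N" by (rule mcharts_restrict[OF d[unfolded dZ] ZA]) auto
      then have co: "compatible_charts ?n (V, \<psi>) (Z \<inter> A, \<zeta>)"
        using c cV by (auto simp: maximal_atlas_def)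
      have eq: "V \<inter> (Z \<inter> A) = V \<inter> Z" "Z \<inter> A \<inter> V = Z \<inter> V" using V by auto
      have ZV: "openin (mtop N) (Z \<inter> V)" using mchart_openin[OF d[unfolded dZ]] chart_openin[OF V(1)] by blast
      show "compatible_charts ?n (V, \<psi>) d"
        unfolding compatible_charts_def dZ smooth_transition_def prod.case
      proof (intro conjI allI impI)
        fix i assume i: "i < ?n"
        show "smooth_fun_on ?n (\<psi> ` (V \<inter> Z)) (\<lambda>y. \<zeta> (inv_into V \<psi> y) i)"
          using co i by (simp add: compatible_charts_def smooth_transition_def eq)
        have "smooth_fun_on ?n (\<zeta> ` (Z \<inter> V)) (\<lambda>y. \<psi> (inv_into (Z \<inter> A) \<zeta> y) i)"
          using co i by (simp add: compatible_charts_def smooth_transition_def eq)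
        then show "smooth_fun_on ?n (\<zeta> ` (Z \<inter> V)) (\<lambda>y. \<psi> (inv_into Z \<zeta> y) i)"
          by (rule smooth_fun_on_cong[OF mchart_open_image[OF d[unfolded dZ] ZV], rotated -1])
            (use V mchart_inv_restrict[OF d[unfolded dZ], of "Z \<inter> A"] in auto)
      qed
    qed
    then show "c \<in> {(V, \<psi>). (V, \<psi>) \<in> mcharts N \<and> V \<subseteq> A}" using V cV by simp
  qed
  with at maximal_atlas_structure(3)[OF at] show ?thesis
    unfolding smooth_structure_def open_submanifold_def by simp
qed

end

lemma smooth_structure_maximal_atlas:
  assumes "atlas n T A"
  shows "smooth_structure \<lparr>mdim = n, mtop = T, mcharts = maximal_atlas n T A\<rparr>"
  using maximal_atlas_structure[OF assms] by (simp add: smooth_structure_def)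

lemma smooth_real_open_submanifold:
  "B \<subseteq> A \<Longrightarrow> smooth_real (open_submanifold N A) B f \<longleftrightarrow> smooth_real N B f"
proof -
  assume "B \<subseteq> A"
  then have *: "(U, \<phi>) \<in> mcharts (open_submanifold N A) \<longleftrightarrow> (U, \<phi>) \<in> mcharts N" if "U \<subseteq> B" for U \<phi>
    using that by (auto simp: open_submanifold_def)
  have d: "mdim (open_submanifold N A) = mdim N" by (simp add: open_submanifold_def)
  show ?thesis unfolding smooth_real_def d
    by (intro ball_cong refl arg_cong[where f=Ex] ext) (use * in blast)
qed

section \<open>Smooth maps between manifolds\<close>

lemma smooth_map_chartE:
  assumes f: "smooth_map N N' f" and p: "p \<in> mpoints N"
  obtains U \<phi> V \<psi> where "(U, \<phi>) \<in> mcharts N" "(V, \<psi>) \<in> mcharts N'" "p \<in> U" "f ` U \<subseteq> V"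
    "\<And>i. i < mdim N' \<Longrightarrow> smooth_fun_on (mdim N) (\<phi> ` U) (\<lambda>y. \<psi> (f (inv_into U \<phi> y)) i)"
proof -
  from f p have "\<exists>(U, \<phi>)\<in>mcharts N. \<exists>(V, \<psi>)\<in>mcharts N'. p \<in> U \<and> f ` U \<subseteq> V \<and>
        (\<forall>i<mdim N'. smooth_fun_on (mdim N) (\<phi> ` U) (\<lambda>y. \<psi> (f (inv_into U \<phi> y)) i))"
    unfolding smooth_map_def by blast
  then show thesis using that by fastforce
qed

context
  fixes N :: "'a manifold" and N' :: "'b manifold"
  assumes N: "smooth_structure N" and N': "smooth_structure N'"
begin

text \<open>The definition speaks of components only. In a target chart these are smooth, hence
  continuous, and the inverse of the chart is continuous too.\<close>

lemma smooth_map_continuous: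
  assumes f: "smooth_map N N' f"
  shows "continuous_map (mtop N) (mtop N') f"
proof -
  let ?I = "{U. openin (mtop N) U \<and> continuous_map (subtopology (mtop N) U) (mtop N') f}"
  show ?thesis
  proof (rule pasting_lemma[where I="?I" and T="\<lambda>U. U" and f="\<lambda>_. f"])
    fix p assume "p \<in> mpoints N"
    from smooth_map_chartE[OF f this] obtain U \<phi> V \<psi> where UV: "(U, \<phi>) \<in> mcharts N" "(V, \<psi>) \<in> mcharts N'"
      "p \<in> U" "f ` U \<subseteq> V"
      "\<And>i. i < mdim N' \<Longrightarrow> smooth_fun_on (mdim N) (\<phi> ` U) (\<lambda>y. \<psi> (f (inv_into U \<phi> y)) i)" by metis
    note D = mcharts_is_chart[OF N' UV(2)] and O = mchart_openin[OF N UV(1)]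
    have UT: "U \<subseteq> mpoints N" by (rule openin_subset[OF O])
    have c: "continuous_map (subtopology (mtop N) U) euclideanreal (\<lambda>p. \<psi> (f p) i)" if "i < mdim N'" for i
      by (rule smooth_real_continuous[OF N O smooth_real_chartI[OF N UV(1) UV(5)[OF that]]])
    have "continuous_map (subtopology (mtop N) U) (Euclidean_space (mdim N'))
        (\<lambda>p i. if i < mdim N' then \<psi> (f p) i else 0)"
      unfolding continuous_map_componentwise_Euclidean_space using c by blast
    then have "continuous_map (subtopology (mtop N) U) (Euclidean_space (mdim N')) (\<lambda>p. \<psi> (f p))"
    proof (rule continuous_map_eq)
      fix p assume "p \<in> topspace (subtopology (mtop N) U)"
      then have "f p \<in> V" using UV(4) by auto
      from chart_in_Rn[OF D this] show "(\<lambda>i. if i < mdim N' then \<psi> (f p) i else 0) = \<psi> (f p)"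
        by (auto simp: topspace_Euclidean_space fun_eq_iff)
    qed
    then have "continuous_map (subtopology (mtop N) U) (subtopology (Euclidean_space (mdim N')) (\<psi> ` V)) (\<lambda>p. \<psi> (f p))"
      using UV(4) by (auto simp: continuous_map_in_subtopology)
    from continuous_map_compose[OF this chart_inv_continuous[OF D]]
    have "continuous_map (subtopology (mtop N) U) (mtop N') f"
      by (rule continuous_map_eq) (use UV(4) chart_inv[OF D] in auto)
    then show "\<exists>U. U \<in> ?I \<and> p \<in> U \<and> f p = f p" using O UV(3) by blast
  qed auto
qed

lemma smooth_map_real:
  assumes f: "smooth_map N N' f" and B: "openin (mtop N') B" and g: "smooth_real N' B g"
  shows "smooth_real N {p \<in> mpoints N. f p \<in> B} (\<lambda>p. g (f p))"
proof (rule smooth_real_local[OF N])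
  fix p assume "p \<in> {p \<in> mpoints N. f p \<in> B}"
  then have p: "p \<in> mpoints N" "f p \<in> B" by auto
  from smooth_map_chartE[OF f p(1)] obtain U \<phi> V \<psi> where UV: "(U, \<phi>) \<in> mcharts N" "(V, \<psi>) \<in> mcharts N'"
    "p \<in> U" "f ` U \<subseteq> V"
    "\<And>i. i < mdim N' \<Longrightarrow> smooth_fun_on (mdim N) (\<phi> ` U) (\<lambda>y. \<psi> (f (inv_into U \<phi> y)) i)" by metis
  note D = mcharts_is_chart[OF N' UV(2)] and O = mchart_openin[OF N UV(1)]
  let ?A = "{p \<in> U. f p \<in> B}"
  have A: "openin (mtop N) ?A"
    by (rule openin_continuous_map_preimage_gen[OF smooth_map_continuous[OF f] O B])
  have VB: "openin (mtop N') (V \<inter> B)" using chart_openin[OF D] B by blast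
  have "smooth_real N ?A (\<lambda>p. g (inv_into V \<psi> (\<psi> (f p))))"
  proof (rule smooth_real_compose[OF N A chart_open_image[OF D VB],
        where F="\<lambda>y. g (inv_into V \<psi> y)" and g="\<lambda>p. \<psi> (f p)"])
    show "smooth_fun_on (mdim N') (\<psi> ` (V \<inter> B)) (\<lambda>y. g (inv_into V \<psi> y))"
      by (rule smooth_realD[OF N' g UV(2) VB]) auto
    show "smooth_real N ?A (\<lambda>p. \<psi> (f p) j)" if "j < mdim N'" for j
      by (rule smooth_real_subset[OF N smooth_real_chartI[OF N UV(1) UV(5)[OF that]] A]) auto
  qed (use UV in auto)
  then have "smooth_real N ?A (\<lambda>p. g (f p))"
    by (rule smooth_real_cong[OF N, rotated]) (use UV(4) chart_inv[OF D] in auto)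
  then show "\<exists>B'. p \<in> B' \<and> B' \<subseteq> {p \<in> mpoints N. f p \<in> B} \<and> smooth_real N B' (\<lambda>p. g (f p))"
    using UV(3) p openin_subset[OF O] by (intro exI[of _ ?A]) auto
qed

text \<open>Given continuity, the domain can be shrunk until f maps it into the target chart, so it
  remains to look at the components of f on some open set around the point.\<close>

lemma smooth_mapI:
  assumes f: "continuous_map (mtop N) (mtop N') f"
    and loc: "\<And>p. p \<in> mpoints N \<Longrightarrow> \<exists>V \<psi> A. (V, \<psi>) \<in> mcharts N' \<and> f p \<in> V \<and> openin (mtop N) A \<and> p \<in> A \<and>
        (\<forall>i<mdim N'. smooth_real N A (\<lambda>p. \<psi> (f p) i))"
  shows "smooth_map N N' f"
  unfolding smooth_map_def
proof (intro conjI ballI)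
  show "f \<in> mpoints N \<rightarrow> mpoints N'" using f continuous_map_funspace by blast
  fix p assume p: "p \<in> mpoints N"
  obtain V \<psi> A where V: "(V, \<psi>) \<in> mcharts N'" "f p \<in> V" "openin (mtop N) A" "p \<in> A"
     "\<And>i. i < mdim N' \<Longrightarrow> smooth_real N A (\<lambda>p. \<psi> (f p) i)" using loc[OF p] by blast
  let ?B = "{p \<in> A. f p \<in> V}"
  have B: "openin (mtop N) ?B"
    by (rule openin_continuous_map_preimage_gen[OF f V(3) mchart_openin[OF N' V(1)]])
  have "p \<in> ?B" using V by simp
  from mcharts_at[OF N B this] obtain U \<phi> where U: "(U, \<phi>) \<in> mcharts N" "p \<in> U" "U \<subseteq> ?B" .
  have "smooth_fun_on (mdim N) (\<phi> ` U) (\<lambda>y. \<psi> (f (inv_into U \<phi> y)) i)" if "i < mdim N'" for i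
    by (rule smooth_realD[OF N V(5)[OF that] U(1) mchart_openin[OF N U(1)]]) (use U(3) in auto)
  then show "\<exists>(U, \<phi>)\<in>mcharts N. \<exists>(V, \<psi>)\<in>mcharts N'. p \<in> U \<and> f ` U \<subseteq> V \<and>
        (\<forall>i<mdim N'. smooth_fun_on (mdim N) (\<phi> ` U) (\<lambda>y. \<psi> (f (inv_into U \<phi> y)) i))"
    using U V by (intro bexI[of _ "(U, \<phi>)"] bexI[of _ "(V, \<psi>)"]) auto
qed

end

lemma smooth_map_compose:
  assumes "smooth_structure N" "smooth_structure N'" "smooth_structure N''"
    and f: "smooth_map N N' f" and g: "smooth_map N' N'' g"
  shows "smooth_map N N'' (\<lambda>p. g (f p))"
proof (rule smooth_mapI[OF assms(1,3)])
  note cf = smooth_map_continuous[OF assms(1,2) f] and cg = smooth_map_continuous[OF assms(2,3) g]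
  show "continuous_map (mtop N) (mtop N'') (\<lambda>p. g (f p))"
    using continuous_map_compose[OF cf cg] by (simp add: o_def)
  fix p assume p: "p \<in> mpoints N"
  then have fp: "f p \<in> mpoints N'" using cf by (auto simp: continuous_map_def)
  then have "g (f p) \<in> mpoints N''" using cg by (auto simp: continuous_map_def)
  then obtain V \<psi> where V: "(V, \<psi>) \<in> mcharts N''" "g (f p) \<in> V" using mcharts_cover[OF assms(3)] by blast
  let ?B = "{q \<in> mpoints N'. g q \<in> V}"
  have B: "openin (mtop N') ?B" by (rule openin_continuous_map_preimage[OF cg mchart_openin[OF assms(3) V(1)]])
  let ?A = "{q \<in> mpoints N. f q \<in> ?B}"
  have A: "openin (mtop N) ?A" by (rule openin_continuous_map_preimage[OF cf B])
  have "smooth_real N ?A (\<lambda>p. \<psi> (g (f p)) i)" for i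
    by (rule smooth_map_real[OF assms(1,2) f B])
      (rule smooth_map_real[OF assms(2,3) g mchart_openin[OF assms(3) V(1)] smooth_real_coord[OF assms(3) V(1)]])
  then show "\<exists>V \<psi> A. (V, \<psi>) \<in> mcharts N'' \<and> g (f p) \<in> V \<and> openin (mtop N) A \<and> p \<in> A \<and>
        (\<forall>i<mdim N''. smooth_real N A (\<lambda>p. \<psi> (g (f p)) i))"
    using V A p fp by blast
qed


section \<open>Seminorms and the smooth topology\<close>

lemma fun_diff_in_space:
  assumes V: "linear_function_space S V" and f: "f \<in> V" "g \<in> V"
  shows "fun_diff S f g \<in> V"
proof -
  have "fun_add S f (fun_scale S (-1) g) \<in> V" using V f unfolding linear_function_space_def by blast
  moreover have "fun_add S f (fun_scale S (-1) g) = fun_diff S f g"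
    by (auto simp: fun_add_def fun_scale_def fun_diff_def fun_eq_iff)
  ultimately show ?thesis by simp
qed

lemma seminorm_fun_diff_triangle:
  assumes V: "linear_function_space S V" and q: "seminorm_on S V q" and f: "f \<in> V" "g \<in> V" "h \<in> V"
  shows "q (fun_diff S f h) \<le> q (fun_diff S f g) + q (fun_diff S g h)"
proof -
  have "fun_add S (fun_diff S f g) (fun_diff S g h) = fun_diff S f h"
    by (auto simp: fun_add_def fun_diff_def fun_eq_iff)
  then show ?thesis
    using q fun_diff_in_space[OF V] f unfolding seminorm_on_def by metis
qed

lemma seminorm_fun_diff_self:
  assumes V: "linear_function_space S V" and q: "seminorm_on S V q" and f: "f \<in> V"
  shows "q (fun_diff S f f) = 0"
proof -
  have "fun_diff S f f = fun_scale S 0 f" by (auto simp: fun_scale_def fun_diff_def)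
  then show ?thesis using q f unfolding seminorm_on_def by simp
qed

text \<open>The usual criterion for continuity of a seminorm in the topology given by P. Here h is
  any functional, so that the notion applies to a seminorm composed with a map.\<close>

definition dominated :: "('a \<Rightarrow> real) set \<Rightarrow> (('a \<Rightarrow> real) \<Rightarrow> real) set \<Rightarrow> (('a \<Rightarrow> real) \<Rightarrow> real) \<Rightarrow> bool" where
  "dominated V P h \<longleftrightarrow> (\<exists>G C. finite G \<and> G \<subseteq> P \<and> 0 \<le> C \<and> (\<forall>f\<in>V. h f \<le> C * (\<Sum>q\<in>G. q f)))"

lemma dominated_member: "h \<in> P \<Longrightarrow> dominated V P h"
  unfolding dominated_def by (intro exI[of _ "{h}"] exI[of _ 1]) auto

lemma dominated_zero: "dominated V P (\<lambda>f. 0)"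
  unfolding dominated_def by (intro exI[of _ "{}"] exI[of _ 0]) simp

lemma dominated_mono:
  "dominated V P h \<Longrightarrow> (\<And>f. f \<in> V \<Longrightarrow> g f \<le> h f) \<Longrightarrow> dominated V P g"
  unfolding dominated_def by (meson order_trans)

lemma dominated_scale:
  assumes "dominated V P h" "0 \<le> c"
  shows "dominated V P (\<lambda>f. c * h f)"
proof -
  obtain G C where "finite G" "G \<subseteq> P" "0 \<le> C" "\<And>f. f \<in> V \<Longrightarrow> h f \<le> C * (\<Sum>q\<in>G. q f)"
    using assms(1) unfolding dominated_def by blast
  then show ?thesis unfolding dominated_def
    using assms(2) by (intro exI[of _ G] exI[of _ "c * C"]) (auto simp: mult.assoc mult_left_mono)
qed

lemma dominated_add:
  assumes P: "\<forall>q\<in>P. \<forall>f\<in>V. 0 \<le> q f" and "dominated V P g" "dominated V P h"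
  shows "dominated V P (\<lambda>f. g f + h f)"
proof -
  obtain G C where G: "finite G" "G \<subseteq> P" "0 \<le> C" "\<And>f. f \<in> V \<Longrightarrow> g f \<le> C * (\<Sum>q\<in>G. q f)"
    using assms(2) unfolding dominated_def by blast
  obtain H D where H: "finite H" "H \<subseteq> P" "0 \<le> D" "\<And>f. f \<in> V \<Longrightarrow> h f \<le> D * (\<Sum>q\<in>H. q f)"
    using assms(3) unfolding dominated_def by blast
  have "g f + h f \<le> (C + D) * (\<Sum>q\<in>G \<union> H. q f)" if f: "f \<in> V" for f
  proof -
    have "(\<Sum>q\<in>G. q f) \<le> (\<Sum>q\<in>G \<union> H. q f)" "(\<Sum>q\<in>H. q f) \<le> (\<Sum>q\<in>G \<union> H. q f)"
      using G H P f by (auto intro!: sum_mono2)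
    then have "C * (\<Sum>q\<in>G. q f) \<le> C * (\<Sum>q\<in>G \<union> H. q f)" "D * (\<Sum>q\<in>H. q f) \<le> D * (\<Sum>q\<in>G \<union> H. q f)"
      using G H by (auto intro: mult_left_mono)
    then show ?thesis using G(4)[OF f] H(4)[OF f] by (simp add: distrib_right)
  qed
  then show ?thesis unfolding dominated_def
    using G H by (intro exI[of _ "G \<union> H"] exI[of _ "C + D"]) auto
qed

lemma dominated_sum:
  assumes P: "\<forall>q\<in>P. \<forall>f\<in>V. 0 \<le> q f" and "\<And>j. j \<in> J \<Longrightarrow> dominated V P (h j)"
  shows "dominated V P (\<lambda>f. \<Sum>j\<in>J. h j f)"
  using assms(2)
proof (induction J rule: infinite_finite_induct)
  case (insert j J)
  then have "dominated V P (\<lambda>f. h j f + (\<Sum>j\<in>J. h j f))" by (intro dominated_add[OF P]) simp_all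
  then show ?case using insert.hyps by simp
qed (use dominated_zero in simp_all)

lemma dominated_trans:
  assumes P: "\<forall>q\<in>P. \<forall>f\<in>V. 0 \<le> q f"
    and h: "dominated V' P' h" and L: "\<And>f. f \<in> V \<Longrightarrow> L f \<in> V'"
    and P': "\<And>q. q \<in> P' \<Longrightarrow> dominated V P (\<lambda>f. q (L f))"
  shows "dominated V P (\<lambda>f. h (L f))"
proof -
  obtain G C where G: "finite G" "G \<subseteq> P'" "0 \<le> C" "\<And>f. f \<in> V' \<Longrightarrow> h f \<le> C * (\<Sum>q\<in>G. q f)"
    using h unfolding dominated_def by blast
  have "dominated V P (\<lambda>f. C * (\<Sum>q\<in>G. q (L f)))"
    using G P' by (intro dominated_scale dominated_sum[OF P]) auto
  then show ?thesis by (rule dominated_mono) (use G(4) L in auto)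
qed

lemma continuous_map_seminorm_topology:
  assumes V: "linear_function_space S V" and L: "\<And>f. f \<in> V \<Longrightarrow> L f \<in> V'"
    and diff: "\<And>f g. f \<in> V \<Longrightarrow> g \<in> V \<Longrightarrow> L (fun_diff S f g) = fun_diff S' (L f) (L g)"
    and dom: "\<And>q. q \<in> P' \<Longrightarrow> dominated V P (\<lambda>f. q (L f))"
    and P: "\<forall>q\<in>P. \<forall>f\<in>V. 0 \<le> q f"
  shows "continuous_map (seminorm_topology S V P) (seminorm_topology S' V' P') L"
  unfolding continuous_map_def topspace_seminorm_topology
proof (intro conjI allI impI)
  show "L \<in> V \<rightarrow> V'" using L by blast
  fix W assume W: "openin (seminorm_topology S' V' P') W"
  show "openin (seminorm_topology S V P) {f \<in> V. L f \<in> W}"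
    unfolding openin_seminorm_topology
  proof (intro conjI ballI)
    fix f assume f: "f \<in> {f \<in> V. L f \<in> W}"
    then obtain F e where F: "finite F" "F \<subseteq> P'" "e > 0" "{g \<in> V'. \<forall>q\<in>F. q (fun_diff S' g (L f)) < e} \<subseteq> W"
      using W unfolding openin_seminorm_topology by blast
    have "\<forall>q\<in>F. \<exists>G C. finite G \<and> G \<subseteq> P \<and> 0 \<le> C \<and> (\<forall>f\<in>V. q (L f) \<le> C * (\<Sum>p\<in>G. p f))"
      using dom F(2) unfolding dominated_def by blast
    then obtain G C where GC: "\<And>q. q \<in> F \<Longrightarrow> finite (G q) \<and> G q \<subseteq> P \<and> 0 \<le> C q \<and>
        (\<forall>f\<in>V. q (L f) \<le> C q * (\<Sum>p\<in>G q. p f))" by metis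
    \<comment> \<open>D bounds the constants of all q in F at once, a sum over \<open>G q\<close>
      being at most \<open>card (G q)\<close> times the radius. The 1 added in the definition of d
      covers D = 0 and makes \<open>D * d < e\<close> strict.\<close>
    define D where "D = (\<Sum>q\<in>F. C q * card (G q))"
    have D: "C q * card (G q) \<le> D" if "q \<in> F" for q
      unfolding D_def by (rule member_le_sum[OF that]) (use GC F(1) in auto)
    have D0: "D \<ge> 0" unfolding D_def using GC by (auto intro: sum_nonneg)
    define d where "d = e / (D + 1)"
    have d0: "d > 0" using F(3) D0 by (simp add: d_def)
    have De: "D * d < e" using F(3) D0 by (simp add: d_def field_simps)
    have "{g \<in> V. \<forall>p\<in>\<Union>(G ` F). p (fun_diff S g f) < d} \<subseteq> {f \<in> V. L f \<in> W}"
    proof safe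
      fix g assume g: "g \<in> V" "\<forall>p\<in>\<Union>(G ` F). p (fun_diff S g f) < d"
      have "q (fun_diff S' (L g) (L f)) < e" if q: "q \<in> F" for q
      proof -
        have gf: "fun_diff S g f \<in> V" using fun_diff_in_space[OF V] g f by blast
        have "q (fun_diff S' (L g) (L f)) = q (L (fun_diff S g f))" using diff g f by simp
        also have "\<dots> \<le> C q * (\<Sum>p\<in>G q. p (fun_diff S g f))" using GC[OF q] gf by blast
        also have "\<dots> \<le> C q * (\<Sum>p\<in>G q. d)"
          using GC[OF q] g(2) q by (intro mult_left_mono sum_mono) (auto intro: less_imp_le)
        also have "\<dots> = C q * card (G q) * d" by simp
        also have "\<dots> \<le> D * d" using D[OF q] d0 by (intro mult_right_mono) auto
        finally show ?thesis using De by simp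
      qed
      then show "L g \<in> W" using F(4) L[OF g(1)] by blast
    qed
    then show "\<exists>F \<epsilon>. finite F \<and> F \<subseteq> P \<and> \<epsilon> > 0 \<and> {g \<in> V. \<forall>q\<in>F. q (fun_diff S g f) < \<epsilon>} \<subseteq> {f \<in> V. L f \<in> W}"
      using F(1) GC d0 by (intro exI[of _ "\<Union>(G ` F)"] exI[of _ d]) auto
  qed blast
qed

lemma seminorm_topology_eqI:
  assumes V: "linear_function_space S V"
    and "\<forall>q\<in>P. \<forall>f\<in>V. 0 \<le> q f" "\<forall>q\<in>P'. \<forall>f\<in>V. 0 \<le> q f"
    and "\<And>q. q \<in> P' \<Longrightarrow> dominated V P q" "\<And>q. q \<in> P \<Longrightarrow> dominated V P' q"
  shows "seminorm_topology S V P = seminorm_topology S V P'"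
proof -
  have id: "continuous_map (seminorm_topology S V A) (seminorm_topology S V B) (\<lambda>f. f)"
    if "\<And>q. q \<in> B \<Longrightarrow> dominated V A q" "\<forall>q\<in>A. \<forall>f\<in>V. 0 \<le> q f" for A B
    by (rule continuous_map_seminorm_topology[OF V]) (use that in auto)
  have "openin (seminorm_topology S V A) W"
    if "continuous_map (seminorm_topology S V A) (seminorm_topology S V B) (\<lambda>f. f)"
      "openin (seminorm_topology S V B) W" for A B W
    using openin_continuous_map_preimage[OF that] openin_subset[OF that(2)]
    by (simp add: Collect_conj_eq inf_absorb2)
  then show ?thesis unfolding topology_eq using id assms by blast
qed

text \<open>A union of seminorm balls is open by the triangle inequality. The parameter R selects
  admissible balls about points of W; it will say that the trace of a ball on a subspace lies in a
  given set.\<close>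

lemma openin_seminorm_topology_hull:
  assumes V: "linear_function_space S V" and P: "\<And>q. q \<in> P \<Longrightarrow> seminorm_on S V q"
    and W: "W \<subseteq> V"
  shows "openin (seminorm_topology S V P) {g \<in> V. \<exists>f\<in>W. \<exists>F e. finite F \<and> F \<subseteq> P \<and> 0 < e \<and> R f F e \<and>
     (\<forall>q\<in>F. q (fun_diff S g f) < e)}" (is "openin _ ?H")
  unfolding openin_seminorm_topology
proof (intro conjI ballI)
  fix g assume "g \<in> ?H"
  then obtain f F e where g: "g \<in> V" "f \<in> W" "finite F" "F \<subseteq> P" "0 < e" "R f F e"
    "\<And>q. q \<in> F \<Longrightarrow> q (fun_diff S g f) < e" by blast
  \<comment> \<open>The smallest distance left to the rim of the ball; 1 is inserted for empty
    F.\<close>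
  define d where "d = Min (insert 1 ((\<lambda>q. e - q (fun_diff S g f)) ` F))"
  have d: "d > 0" "\<And>q. q \<in> F \<Longrightarrow> d \<le> e - q (fun_diff S g f)"
    using g(3,7) by (auto simp: d_def)
  have "{h \<in> V. \<forall>q\<in>F. q (fun_diff S h g) < d} \<subseteq> ?H"
  proof safe
    fix h assume h: "h \<in> V" "\<forall>q\<in>F. q (fun_diff S h g) < d"
    have "q (fun_diff S h f) < e" if "q \<in> F" for q
    proof -
      have "seminorm_on S V q" using P g(4) that by blast
      then have "q (fun_diff S h f) \<le> q (fun_diff S h g) + q (fun_diff S g f)"
        using seminorm_fun_diff_triangle[OF V] h(1) g(1,2) W by blast
      then show ?thesis using h(2) d(2)[OF that] that by fastforce
    qed
    then show "\<exists>f\<in>W. \<exists>F e. finite F \<and> F \<subseteq> P \<and> 0 < e \<and> R f F e \<and> (\<forall>q\<in>F. q (fun_diff S h f) < e)"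
      using g by blast
  qed
  then show "\<exists>F \<epsilon>. finite F \<and> F \<subseteq> P \<and> \<epsilon> > 0 \<and> {h \<in> V. \<forall>q\<in>F. q (fun_diff S h g) < \<epsilon>} \<subseteq> ?H"
    using g(3,4) d(1) by blast
qed blast

text \<open>An open set W of the subspace has to be the trace of an open set of V. The union of the
  balls about points of W whose trace lies in W does it, as every point of W is the centre of such a
  ball.\<close>

lemma subtopology_seminorm_topology:
  assumes V: "linear_function_space S V" and P: "\<And>q. q \<in> P \<Longrightarrow> seminorm_on S V q"
    and V': "V' \<subseteq> V"
  shows "subtopology (seminorm_topology S V P) V' = seminorm_topology S V' P"
  unfolding topology_eq
proof (intro allI iffI)
  fix W assume "openin (subtopology (seminorm_topology S V P) V') W"
  then obtain W0 where W0: "openin (seminorm_topology S V P) W0" "W = W0 \<inter> V'"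
    unfolding openin_subtopology by blast
  show "openin (seminorm_topology S V' P) W"
    unfolding openin_seminorm_topology
  proof (intro conjI ballI)
    show "W \<subseteq> V'" using W0 by blast
    fix f assume "f \<in> W"
    then obtain F e where "finite F" "F \<subseteq> P" "e > 0" "{g \<in> V. \<forall>q\<in>F. q (fun_diff S g f) < e} \<subseteq> W0"
      using W0 unfolding openin_seminorm_topology by blast
    then show "\<exists>F \<epsilon>. finite F \<and> F \<subseteq> P \<and> \<epsilon> > 0 \<and> {g \<in> V'. \<forall>q\<in>F. q (fun_diff S g f) < \<epsilon>} \<subseteq> W"
      using W0(2) V' by (intro exI[of _ F] exI[of _ e]) blast
  qed
next
  fix W assume W: "openin (seminorm_topology S V' P) W"
  let ?R = "\<lambda>f F e. {g \<in> V'. \<forall>q\<in>F. q (fun_diff S g f) < e} \<subseteq> W"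
  let ?H = "{g \<in> V. \<exists>f\<in>W. \<exists>F e. finite F \<and> F \<subseteq> P \<and> 0 < e \<and> ?R f F e \<and> (\<forall>q\<in>F. q (fun_diff S g f) < e)}"
  have WV: "W \<subseteq> V'" using W unfolding openin_seminorm_topology by blast
  have H: "openin (seminorm_topology S V P) ?H"
    by (rule openin_seminorm_topology_hull[OF V P]) (use WV V' in auto)
  have "W = ?H \<inter> V'"
  proof (rule subset_antisym)
    show "?H \<inter> V' \<subseteq> W" by auto
    show "W \<subseteq> ?H \<inter> V'"
    proof
      fix f assume f: "f \<in> W"
      then obtain F e where F: "finite F" "F \<subseteq> P" "e > 0" "?R f F e"
        using W unfolding openin_seminorm_topology by blast
      have "q (fun_diff S f f) < e" if "q \<in> F" for q
      proof -
        have "q \<in> P" "f \<in> V" using that F(2) f WV V' by auto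
        have "q (fun_diff S f f) = 0" by (rule seminorm_fun_diff_self[OF V P]) fact+
        then show ?thesis using F(3) by simp
      qed
      then show "f \<in> ?H \<inter> V'" using f F WV V' by blast
    qed
  qed
  then show "openin (subtopology (seminorm_topology S V P) V') W"
    using H unfolding openin_subtopology by blast
qed

text \<open>The same seminorms serve. A Cauchy sequence in the subspace converges in the large
  space, and a limit outside the closed set V' would have a seminorm ball free of points of
  V'.\<close>

lemma frechet_space_closed_subspace:
  assumes T: "frechet_space S T" and V': "linear_function_space S V'" "closedin T V'"
  shows "frechet_space S (subtopology T V')"
proof -
  define V where "V = topspace T"
  note T' = T[unfolded frechet_space_def, folded V_def]
  have V: "linear_function_space S V" using T' by (rule conjunct1)
  from T'[THEN conjunct2] obtain P where P': "countable P \<and> (\<forall>q\<in>P. seminorm_on S V q) \<and>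
        T = seminorm_topology S V P \<and> (\<forall>f\<in>V. (\<forall>q\<in>P. q f = 0) \<longrightarrow> f = (\<lambda>x\<in>S. 0)) \<and>
        (\<forall>u. range u \<subseteq> V \<and>
             (\<forall>q\<in>P. \<forall>\<epsilon>>0. \<exists>k::nat. \<forall>i\<ge>k. \<forall>j\<ge>k. q (fun_diff S (u i) (u j)) < \<epsilon>) \<longrightarrow>
             (\<exists>f\<in>V. \<forall>q\<in>P. (\<lambda>i. q (fun_diff S (u i) f)) \<longlonglongrightarrow> 0))" by (rule exE)
  note P = P'[THEN conjunct1] bspec[OF P'[THEN conjunct2, THEN conjunct1]]
    P'[THEN conjunct2, THEN conjunct2, THEN conjunct1]
    bspec[OF P'[THEN conjunct2, THEN conjunct2, THEN conjunct2, THEN conjunct1]]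
    spec[OF P'[THEN conjunct2, THEN conjunct2, THEN conjunct2, THEN conjunct2]]
  have V'V: "V' \<subseteq> V" using V'(2) closedin_subset V_def by blast
  have top: "topspace (subtopology T V') = V'" using V'V V_def by (simp add: inf_absorb2)
  have a1: "subtopology T V' = seminorm_topology S V' P"
    unfolding P(3) by (rule subtopology_seminorm_topology[OF V P(2) V'V])
  have a2: "\<forall>q\<in>P. seminorm_on S V' q"
  proof
    fix q assume "q \<in> P"
    from P(2)[OF this] V'V show "seminorm_on S V' q" unfolding seminorm_on_def by blast
  qed
  have a3: "\<exists>f\<in>V'. \<forall>q\<in>P. (\<lambda>i. q (fun_diff S (u i) f)) \<longlonglongrightarrow> 0"
    if u: "range u \<subseteq> V'" "\<forall>q\<in>P. \<forall>\<epsilon>>0. \<exists>k::nat. \<forall>i\<ge>k. \<forall>j\<ge>k. q (fun_diff S (u i) (u j)) < \<epsilon>" for u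
  proof -
    have "\<exists>f\<in>V. \<forall>q\<in>P. (\<lambda>i. q (fun_diff S (u i) f)) \<longlonglongrightarrow> 0"
      by (rule mp[OF P(5) conjI[OF order_trans[OF u(1) V'V] u(2)]])
    then obtain f where f: "f \<in> V" "\<And>q. q \<in> P \<Longrightarrow> (\<lambda>i. q (fun_diff S (u i) f)) \<longlonglongrightarrow> 0" by blast
    have "f \<in> V'"
    proof (rule ccontr)
      assume "f \<notin> V'"
      have "openin T (V - V')" using V'(2) by (simp add: V_def closedin_def)
      then obtain F e where F: "finite F" "F \<subseteq> P" "e > 0" "{g \<in> V. \<forall>q\<in>F. q (fun_diff S g f) < e} \<subseteq> V - V'"
        using \<open>f \<notin> V'\<close> f(1) unfolding P(3) openin_seminorm_topology by blast
      have "\<forall>\<^sub>F i in sequentially. q (fun_diff S (u i) f) < e" if "q \<in> F" for q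
        using order_tendstoD(2)[OF f(2) F(3)] that F(2) by blast
      then have "\<forall>\<^sub>F i in sequentially. \<forall>q\<in>F. q (fun_diff S (u i) f) < e"
        by (intro eventually_ball_finite[OF F(1)] ballI)
      from eventually_happens'[OF sequentially_bot this]
      obtain i where "\<forall>q\<in>F. q (fun_diff S (u i) f) < e" by (rule exE)
      then show False using F(4) u(1) V'V by blast
    qed
    then show ?thesis using f(2) by blast
  qed
  have a4: "\<forall>f\<in>V'. (\<forall>q\<in>P. q f = 0) \<longrightarrow> f = (\<lambda>x\<in>S. 0)" using P(4) V'V by blast
  have a5: "\<forall>u. range u \<subseteq> V' \<and>
             (\<forall>q\<in>P. \<forall>\<epsilon>>0. \<exists>k::nat. \<forall>i\<ge>k. \<forall>j\<ge>k. q (fun_diff S (u i) (u j)) < \<epsilon>) \<longrightarrow>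
             (\<exists>f\<in>V'. \<forall>q\<in>P. (\<lambda>i. q (fun_diff S (u i) f)) \<longlonglongrightarrow> 0)"
    by (intro allI impI, erule conjE) (rule a3)
  show ?thesis unfolding frechet_space_def top
    by (rule conjI[OF V'(1)], rule exI[where x=P], intro conjI P(1) a2 a1 a4 a5)
qed

section \<open>Estimates for the seminorms of the smooth topology\<close>

abbreviation chart_deriv :: "'a set \<Rightarrow> ('a \<Rightarrow> nat \<Rightarrow> real) \<Rightarrow> nat list \<Rightarrow> ('a \<Rightarrow> real) \<Rightarrow> 'a \<Rightarrow> real" where
  "chart_deriv U \<phi> js f p \<equiv> iter_partial js (f \<circ> inv_into U \<phi>) (\<phi> p)"

definition cinf_seminorms :: "'a manifold \<Rightarrow> (('a \<Rightarrow> real) \<Rightarrow> real) set" where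
  "cinf_seminorms N = {cinf_seminorm (U, \<phi>) K js | U \<phi> K js. (U, \<phi>) \<in> mcharts N \<and> compactin (mtop N) K \<and>
        K \<noteq> {} \<and> K \<subseteq> U \<and> js \<in> lists {..<mdim N}}"

lemma cinf_topology_eq: "cinf_topology N = seminorm_topology (mpoints N) (smooth_functions N) (cinf_seminorms N)"
  by (simp add: cinf_topology_def cinf_seminorms_def)

lemma topspace_cinf_topology [simp]: "topspace (cinf_topology N) = smooth_functions N"
  by (simp add: cinf_topology_eq)

context
  fixes N :: "'a manifold"
  assumes N: "smooth_structure N"
begin

lemma smooth_functions_extensional: "f \<in> smooth_functions N \<Longrightarrow> f \<in> extensional (mpoints N)"
  unfolding smooth_functions_def by simp

lemma mchart_subset_points: "(U, \<phi>) \<in> mcharts N \<Longrightarrow> U \<subseteq> mpoints N"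
  using mchart_openin[OF N] openin_subset by blast

lemma mchart_open_range: "(U, \<phi>) \<in> mcharts N \<Longrightarrow> openin (Euclidean_space (mdim N)) (\<phi> ` U)"
  using chart_open_range[OF mcharts_is_chart[OF N]] .

lemma smooth_functions_chart:
  "f \<in> smooth_functions N \<Longrightarrow> (U, \<phi>) \<in> mcharts N \<Longrightarrow> smooth_fun_on (mdim N) (\<phi> ` U) (f \<circ> inv_into U \<phi>)"
  unfolding smooth_functions_def by auto

lemma smooth_functionsI:
  "smooth_real N (mpoints N) f \<Longrightarrow> (\<lambda>p\<in>mpoints N. f p) \<in> smooth_functions N"
  unfolding smooth_functions_iff[OF N] by (auto intro: smooth_real_cong[OF N])

lemma linear_smooth_functions: "linear_function_space (mpoints N) (smooth_functions N)"
proof -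
  have "fun_add (mpoints N) f g \<in> smooth_functions N" if "f \<in> smooth_functions N" "g \<in> smooth_functions N" for f g
    unfolding fun_add_def
    by (intro smooth_functionsI smooth_real_add[OF N]) (use that in \<open>auto simp: smooth_functions_iff[OF N]\<close>)
  moreover have "fun_scale (mpoints N) c f \<in> smooth_functions N" if "f \<in> smooth_functions N" for f c
    unfolding fun_scale_def
    by (intro smooth_functionsI smooth_real_mult[OF N] smooth_real_const[OF N])
      (use that in \<open>auto simp: smooth_functions_iff[OF N]\<close>)
  moreover have "(\<lambda>x\<in>mpoints N. 0) \<in> smooth_functions N"
    by (intro smooth_functionsI smooth_real_const[OF N]) simp
  ultimately show ?thesis
    unfolding linear_function_space_def using smooth_functions_extensional by blast
qed

lemma chart_deriv_linear:
  assumes U: "(U, \<phi>) \<in> mcharts N" and f: "f \<in> smooth_functions N" "g \<in> smooth_functions N"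
    and h: "\<And>x. x \<in> mpoints N \<Longrightarrow> h x = a * f x + b * g x"
    and js: "js \<in> lists {..<mdim N}" and p: "p \<in> U"
  shows "chart_deriv U \<phi> js h p = a * chart_deriv U \<phi> js f p + b * chart_deriv U \<phi> js g p"
proof -
  note O = mchart_open_range[OF U]
  have "chart_deriv U \<phi> js h p = iter_partial js (\<lambda>y. a * (f \<circ> inv_into U \<phi>) y + b * (g \<circ> inv_into U \<phi>) y) (\<phi> p)"
    by (rule iter_partial_cong[OF O _ js]) (use p h mchart_subset_points[OF U] mchart_inv[OF N U] in auto)
  also have "\<dots> = a * chart_deriv U \<phi> js f p + b * chart_deriv U \<phi> js g p"
    by (rule iter_partial_linear[OF O smooth_functions_chart[OF f(1) U] smooth_functions_chart[OF f(2) U] js])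
      (use p in auto)
  finally show ?thesis .
qed

lemma chart_fun_bounded:
  fixes a :: "(nat \<Rightarrow> real) \<Rightarrow> real"
  assumes U: "(U, \<phi>) \<in> mcharts N" and B: "openin (mtop N) B" "B \<subseteq> U" and a: "continuous_on (\<phi> ` B) a"
    and K: "compactin (mtop N) K" "K \<subseteq> B"
  obtains C where "C \<ge> 0" "\<And>p. p \<in> K \<Longrightarrow> \<bar>a (\<phi> p)\<bar> \<le> C"
proof -
  have R: "\<phi> ` B \<subseteq> Rn (mdim N)" using mchart_open_image[OF N U B] openin_subset by blast
  have "continuous_map (subtopology (mtop N) B) (Euclidean_space (mdim N)) \<phi>"
    using continuous_map_from_subtopology_mono[OF chart_continuous[OF mcharts_is_chart[OF N U]] B(2)] .
  then have 1: "continuous_map (subtopology (mtop N) B) (subtopology (Euclidean_space (mdim N)) (\<phi> ` B)) \<phi>"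
    by (auto simp: continuous_map_in_subtopology)
  have 2: "continuous_map (subtopology (Euclidean_space (mdim N)) (\<phi> ` B)) euclideanreal a"
    using continuous_map_Euclidean_real_iff[OF R] a by blast
  have "compactin euclideanreal ((a \<circ> \<phi>) ` K)"
    by (rule image_compactin[OF _ continuous_map_compose[OF 1 2]]) (use K in \<open>auto simp: compactin_subtopology\<close>)
  then have "bounded ((a \<circ> \<phi>) ` K)" by (simp add: compact_imp_bounded)
  then obtain C where C: "\<And>p. p \<in> K \<Longrightarrow> \<bar>a (\<phi> p)\<bar> \<le> C" unfolding bounded_iff by auto
  \<comment> \<open>For empty K the bound C may be negative.\<close>
  show thesis by (rule that[of "max C 0"]) (use C in \<open>auto simp: le_max_iff_disj\<close>)
qed

lemma chart_deriv_le_seminorm: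
  assumes U: "(U, \<phi>) \<in> mcharts N" and K: "compactin (mtop N) K" "K \<subseteq> U" and js: "js \<in> lists {..<mdim N}"
    and f: "f \<in> smooth_functions N" and p: "p \<in> K"
  shows "\<bar>chart_deriv U \<phi> js f p\<bar> \<le> cinf_seminorm (U, \<phi>) K js f"
proof -
  have c: "continuous_on (\<phi> ` U) (iter_partial js (f \<circ> inv_into U \<phi>))"
    by (rule smooth_fun_on_D(1)[OF mchart_open_range[OF U] smooth_functions_chart[OF f U] js])
  from chart_fun_bounded[OF U mchart_openin[OF N U] order.refl c K] obtain C
    where "\<And>p. p \<in> K \<Longrightarrow> \<bar>chart_deriv U \<phi> js f p\<bar> \<le> C" by blast
  then show ?thesis unfolding cinf_seminorm_def prod.case
    using p by (intro cSUP_upper) (auto intro!: bdd_aboveI2)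
qed

lemma cinf_seminorm_least:
  assumes "K \<noteq> {}" "\<And>p. p \<in> K \<Longrightarrow> \<bar>chart_deriv U \<phi> js f p\<bar> \<le> C"
  shows "cinf_seminorm (U, \<phi>) K js f \<le> C"
  unfolding cinf_seminorm_def prod.case using assms by (rule cSUP_least)

lemma seminorm_cinf_seminorm:
  assumes "q \<in> cinf_seminorms N"
  shows "seminorm_on (mpoints N) (smooth_functions N) q"
proof -
  obtain U \<phi> K js where q: "q = cinf_seminorm (U, \<phi>) K js" and U: "(U, \<phi>) \<in> mcharts N"
    and K: "compactin (mtop N) K" "K \<noteq> {}" "K \<subseteq> U" and js: "js \<in> lists {..<mdim N}"
    using assms unfolding cinf_seminorms_def by blast
  note up = chart_deriv_le_seminorm[OF U K(1,3) js] and least = cinf_seminorm_least[OF K(2), where U=U and \<phi>=\<phi> and js=js]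
  note lin = linear_smooth_functions[unfolded linear_function_space_def]
  \<comment> \<open>Only one inequality is proved directly; used for c and for 1 / c it gives
    equality.\<close>
  have scale_le: "q (fun_scale (mpoints N) c f) \<le> \<bar>c\<bar> * q f" if f: "f \<in> smooth_functions N" for c f
    unfolding q
  proof (rule least)
    fix p assume p: "p \<in> K"
    have "chart_deriv U \<phi> js (fun_scale (mpoints N) c f) p = c * chart_deriv U \<phi> js f p + 0 * chart_deriv U \<phi> js f p"
      by (rule chart_deriv_linear[OF U f f _ js]) (use p K in \<open>auto simp: fun_scale_def\<close>)
    then show "\<bar>chart_deriv U \<phi> js (fun_scale (mpoints N) c f) p\<bar> \<le> \<bar>c\<bar> * cinf_seminorm (U, \<phi>) K js f"
      using up[OF f p] by (simp add: abs_mult mult_left_mono)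
  qed
  have nonneg: "0 \<le> q f" if f: "f \<in> smooth_functions N" for f
    using up[OF f] K(2) unfolding q by (metis abs_ge_zero ex_in_conv order_trans)
  show ?thesis unfolding seminorm_on_def
  proof (intro conjI allI ballI)
    show "0 \<le> q f" if "f \<in> smooth_functions N" for f using nonneg that .
    show "q (fun_add (mpoints N) f g) \<le> q f + q g" if f: "f \<in> smooth_functions N" and g: "g \<in> smooth_functions N" for f g
      unfolding q
    proof (rule least)
      fix p assume p: "p \<in> K"
      have "chart_deriv U \<phi> js (fun_add (mpoints N) f g) p = 1 * chart_deriv U \<phi> js f p + 1 * chart_deriv U \<phi> js g p"
        by (rule chart_deriv_linear[OF U f g _ js]) (use p K in \<open>auto simp: fun_add_def\<close>)
      then show "\<bar>chart_deriv U \<phi> js (fun_add (mpoints N) f g) p\<bar> \<le>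
          cinf_seminorm (U, \<phi>) K js f + cinf_seminorm (U, \<phi>) K js g"
        using up[OF f p] up[OF g p] by linarith
    qed
    show "q (fun_scale (mpoints N) c f) = \<bar>c\<bar> * q f" if f: "f \<in> smooth_functions N" for c f
    proof (rule antisym[OF scale_le[OF f]])
      have cf: "fun_scale (mpoints N) c f \<in> smooth_functions N" using lin f by blast
      show "\<bar>c\<bar> * q f \<le> q (fun_scale (mpoints N) c f)"
      proof (cases "c = 0")
        case True
        then show ?thesis using nonneg[OF cf] by simp
      next
        case False
        \<comment> \<open>This uses that f is extensional: off the manifold \<open>fun_scale\<close>
          returns \<open>undefined\<close>.\<close>
        have "fun_scale (mpoints N) (1 / c) (fun_scale (mpoints N) c f) = f"
          using False smooth_functions_extensional[OF f]
          by (auto simp: fun_scale_def fun_eq_iff extensional_def)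
        then have "q f \<le> \<bar>1 / c\<bar> * q (fun_scale (mpoints N) c f)" using scale_le[OF cf, of "1 / c"] by simp
        then show ?thesis using False by (simp add: field_simps)
      qed
    qed
  qed
qed

lemma cinf_seminorm_nonneg: "q \<in> cinf_seminorms N \<Longrightarrow> f \<in> smooth_functions N \<Longrightarrow> 0 \<le> q f"
  using seminorm_cinf_seminorm unfolding seminorm_on_def by blast

text \<open>The coefficients that express derivatives in one chart through those in the other are
  continuous on the overlap, hence bounded on the compact set L. F and C are the same for all f and
  p, which turns the pointwise estimate into one between seminorms.\<close>

lemma chart_deriv_change:
  assumes U: "(U, \<phi>) \<in> mcharts N" and V: "(V, \<psi>) \<in> mcharts N"
    and L: "compactin (mtop N) L" "L \<subseteq> U" "L \<subseteq> V" and js: "js \<in> lists {..<mdim N}"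
  shows "\<exists>F C. finite F \<and> F \<subseteq> lists {..<mdim N} \<and> 0 \<le> C \<and> (\<forall>f\<in>smooth_functions N. \<forall>p\<in>L.
     \<bar>chart_deriv V \<psi> js f p\<bar> \<le> C * (\<Sum>s\<in>F. \<bar>chart_deriv U \<phi> s f p\<bar>))"
proof -
  let ?n = "mdim N"
  have B: "openin (mtop N) (V \<inter> U)" using mchart_openin[OF N U] mchart_openin[OF N V] by blast
  have OB: "openin (Euclidean_space ?n) (\<psi> ` (V \<inter> U))" by (rule mchart_open_image[OF N V B]) auto
  have "\<exists>l. (\<forall>(s, a) \<in> set l. s \<in> lists {..<?n} \<and> smooth_fun_on ?n (\<psi> ` (V \<inter> U)) a) \<and>
     (\<forall>f. smooth_fun_on ?n (\<phi> ` U) f \<longrightarrow> (\<forall>x\<in>\<psi> ` (V \<inter> U). iter_partial js (\<lambda>x. f (\<phi> (inv_into V \<psi> x))) x =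
        (\<Sum>(s, a)\<leftarrow>l. a x * iter_partial s f (\<phi> (inv_into V \<psi> x)))))"
  proof (rule iter_partial_compose_expand[OF OB mchart_open_range[OF U] _ _ js])
    show "\<phi> (inv_into V \<psi> x) \<in> \<phi> ` U" if "x \<in> \<psi> ` (V \<inter> U)" for x
      using that mchart_inv[OF N V] by auto
    show "smooth_fun_on ?n (\<psi> ` (V \<inter> U)) (\<lambda>x. \<phi> (inv_into V \<psi> x) j)" if "j < ?n" for j
      by (rule mcharts_transition[OF N V U that])
  qed
  then obtain l where l: "\<And>s a. (s, a) \<in> set l \<Longrightarrow> s \<in> lists {..<?n} \<and> smooth_fun_on ?n (\<psi> ` (V \<inter> U)) a"
    "\<And>f x. smooth_fun_on ?n (\<phi> ` U) f \<Longrightarrow> x \<in> \<psi> ` (V \<inter> U) \<Longrightarrow>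
       iter_partial js (\<lambda>x. f (\<phi> (inv_into V \<psi> x))) x =
        (\<Sum>(s, a)\<leftarrow>l. a x * iter_partial s f (\<phi> (inv_into V \<psi> x)))" by blast
  define F where "F = fst ` set l"
  have expand: "chart_deriv V \<psi> js f p = (\<Sum>(s, a)\<leftarrow>l. a (\<psi> p) * chart_deriv U \<phi> s f p)"
    if f: "f \<in> smooth_functions N" and p: "p \<in> L" for f p
  proof -
    have pUV: "p \<in> V \<inter> U" using p L by blast
    have "chart_deriv V \<psi> js f p = iter_partial js (\<lambda>x. (f \<circ> inv_into U \<phi>) (\<phi> (inv_into V \<psi> x))) (\<psi> p)"
      by (rule iter_partial_cong[OF OB _ js]) (use pUV mchart_inv[OF N V] mchart_inv[OF N U] in auto)
    also have "\<dots> = (\<Sum>(s, a)\<leftarrow>l. a (\<psi> p) * iter_partial s (f \<circ> inv_into U \<phi>) (\<phi> (inv_into V \<psi> (\<psi> p))))"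
      by (rule l(2)[OF smooth_functions_chart[OF f U]]) (use pUV in auto)
    finally show ?thesis using mchart_inv[OF N V, of p] pUV by simp
  qed
  \<comment> \<open>The bound is accumulated along the list. Each summand is measured against the
    full sum over F, so that the constants simply add up.\<close>
  have "set l' \<subseteq> set l \<Longrightarrow> \<exists>C\<ge>0. \<forall>f. \<forall>p\<in>L. \<bar>\<Sum>(s, a)\<leftarrow>l'. a (\<psi> p) * chart_deriv U \<phi> s f p\<bar> \<le>
      C * (\<Sum>s\<in>F. \<bar>chart_deriv U \<phi> s f p\<bar>)" for l'
  proof (induction l')
    case (Cons sa l')
    obtain s a where sa: "sa = (s, a)" by (cases sa)
    then have in_l: "(s, a) \<in> set l" using Cons.prems by auto
    obtain C where C: "C \<ge> 0" "\<And>f p. p \<in> L \<Longrightarrow> \<bar>\<Sum>(s, a)\<leftarrow>l'. a (\<psi> p) * chart_deriv U \<phi> s f p\<bar> \<le>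
      C * (\<Sum>s\<in>F. \<bar>chart_deriv U \<phi> s f p\<bar>)" using Cons.IH Cons.prems by (meson set_subset_Cons order_trans)
    have "continuous_on (\<psi> ` (V \<inter> U)) a"
      using smooth_fun_on_D(1)[OF OB, of a "[]"] l(1)[OF in_l] by simp
    from chart_fun_bounded[OF V B _ this L(1)] L obtain D where D: "D \<ge> 0" "\<And>p. p \<in> L \<Longrightarrow> \<bar>a (\<psi> p)\<bar> \<le> D"
      by blast
    have "\<bar>\<Sum>(s, a)\<leftarrow>sa # l'. a (\<psi> p) * chart_deriv U \<phi> s f p\<bar> \<le> (D + C) * (\<Sum>s\<in>F. \<bar>chart_deriv U \<phi> s f p\<bar>)"
      if p: "p \<in> L" for f p
    proof -
      have sF: "s \<in> F" using in_l by (force simp: F_def)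
      have "\<bar>chart_deriv U \<phi> s f p\<bar> \<le> (\<Sum>s\<in>F. \<bar>chart_deriv U \<phi> s f p\<bar>)"
        by (rule member_le_sum[OF sF, where f="\<lambda>s. \<bar>chart_deriv U \<phi> s f p\<bar>"]) (auto simp: F_def)
      then have "\<bar>a (\<psi> p) * chart_deriv U \<phi> s f p\<bar> \<le> D * (\<Sum>s\<in>F. \<bar>chart_deriv U \<phi> s f p\<bar>)"
        unfolding abs_mult using D p by (intro mult_mono) auto
      moreover have "(\<Sum>(s, a)\<leftarrow>sa # l'. a (\<psi> p) * chart_deriv U \<phi> s f p) =
         a (\<psi> p) * chart_deriv U \<phi> s f p + (\<Sum>(s, a)\<leftarrow>l'. a (\<psi> p) * chart_deriv U \<phi> s f p)"
        by (simp add: sa)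
      ultimately show ?thesis using C(2)[OF p, of f] unfolding distrib_right by linarith
    qed
    then show ?case using C(1) D(1) by (intro exI[of _ "D + C"] conjI allI ballI add_nonneg_nonneg)
  next
    case Nil
    show ?case by (intro exI[of _ 0]) simp
  qed
  from this[OF order.refl] obtain C where "C \<ge> 0" "\<And>f p. p \<in> L \<Longrightarrow> \<bar>\<Sum>(s, a)\<leftarrow>l. a (\<psi> p) * chart_deriv U \<phi> s f p\<bar> \<le>
      C * (\<Sum>s\<in>F. \<bar>chart_deriv U \<phi> s f p\<bar>)" by blast
  moreover have "finite F" by (simp add: F_def)
  moreover have "F \<subseteq> lists {..<?n}" unfolding F_def using l(1) by (metis image_subsetI prod.collapse)
  ultimately show ?thesis using expand by (intro exI[of _ F] exI[of _ C]) auto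
qed

lemma compactin_finite_cover:
  assumes K: "compactin T K" and cover: "\<And>p. p \<in> K \<Longrightarrow> \<exists>B. openin T B \<and> p \<in> B \<and> R B"
  shows "\<exists>\<B>. finite \<B> \<and> K \<subseteq> \<Union>\<B> \<and> (\<forall>B\<in>\<B>. R B)"
proof -
  let ?\<U> = "{B. openin T B \<and> R B}"
  have "\<forall>U\<in>?\<U>. openin T U" "K \<subseteq> \<Union>?\<U>" using cover by blast+
  then obtain \<B> where "finite \<B>" "\<B> \<subseteq> ?\<U>" "K \<subseteq> \<Union>\<B>"
    using K unfolding compactin_def by meson
  then show ?thesis by blast
qed

text \<open>The local test for domination: around each point of K some compact chart piece must have
  all its seminorms in P. Finitely many neighbourhoods inside pieces cover K, and a change of charts
  handles each. It serves for a countable family of pieces and for the small charts on both sides of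
  the orbit projection.\<close>

lemma dominated_cinf_seminorm:
  assumes H: "Hausdorff_space (mtop N)" and P: "P \<subseteq> cinf_seminorms N"
    and V: "(V, \<psi>) \<in> mcharts N" and K: "compactin (mtop N) K" "K \<noteq> {}" "K \<subseteq> V" and js: "js \<in> lists {..<mdim N}"
    and cover: "\<And>p. p \<in> K \<Longrightarrow> \<exists>B U \<phi> L. openin (mtop N) B \<and> p \<in> B \<and> B \<subseteq> L \<and> (U, \<phi>) \<in> mcharts N \<and>
      compactin (mtop N) L \<and> L \<subseteq> U \<and> (\<forall>s\<in>lists {..<mdim N}. cinf_seminorm (U, \<phi>) L s \<in> P)"
  shows "dominated (smooth_functions N) P (cinf_seminorm (V, \<psi>) K js)"
proof -
  \<comment> \<open>\<open>?R B\<close> records a dominated bound h for the derivatives over B; its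
    nonnegativity permits replacing the bound of one B by the sum over the cover.\<close>
  let ?E = "smooth_functions N" and ?R = "\<lambda>B. \<exists>h. dominated (smooth_functions N) P h \<and> (\<forall>f\<in>smooth_functions N. 0 \<le> h f \<and>
       (\<forall>p\<in>B \<inter> K. \<bar>chart_deriv V \<psi> js f p\<bar> \<le> h f))"
  have P0: "\<forall>q\<in>P. \<forall>f\<in>?E. 0 \<le> q f" using P cinf_seminorm_nonneg by blast
  have cov: "\<exists>B. openin (mtop N) B \<and> p \<in> B \<and> ?R B" if p: "p \<in> K" for p
  proof -
    obtain B U \<phi> L where B: "openin (mtop N) B" "p \<in> B" "B \<subseteq> L" "(U, \<phi>) \<in> mcharts N"
      "compactin (mtop N) L" "L \<subseteq> U" "\<And>s. s \<in> lists {..<mdim N} \<Longrightarrow> cinf_seminorm (U, \<phi>) L s \<in> P"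
      using cover[OF p] by blast
    \<comment> \<open>The piece L need not lie in V, but its part in K does; this part is compact
      because L is closed in a Hausdorff space.\<close>
    have LK: "compactin (mtop N) (L \<inter> K)"
      by (rule closed_Int_compactin[OF compactin_imp_closedin[OF H B(5)] K(1)])
    from chart_deriv_change[OF B(4) V LK _ _ js] B(6) K(3) obtain F C where F: "finite F" "F \<subseteq> lists {..<mdim N}" "0 \<le> C"
      "\<And>f p. f \<in> ?E \<Longrightarrow> p \<in> L \<inter> K \<Longrightarrow> \<bar>chart_deriv V \<psi> js f p\<bar> \<le> C * (\<Sum>s\<in>F. \<bar>chart_deriv U \<phi> s f p\<bar>)" by blast
    let ?h = "\<lambda>f. C * (\<Sum>s\<in>F. cinf_seminorm (U, \<phi>) L s f)"
    have "dominated ?E P ?h"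
      using F(2,3) B(7) by (intro dominated_scale dominated_sum[OF P0] dominated_member) blast+
    moreover have "0 \<le> ?h f \<and> (\<forall>p\<in>B \<inter> K. \<bar>chart_deriv V \<psi> js f p\<bar> \<le> ?h f)" if f: "f \<in> ?E" for f
    proof (intro conjI ballI)
      have "0 \<le> cinf_seminorm (U, \<phi>) L s f" if "s \<in> F" for s using F(2) B(7) P0 f that by blast
      then show "0 \<le> ?h f" using F(3) by (intro mult_nonneg_nonneg sum_nonneg)
      fix p assume p: "p \<in> B \<inter> K"
      then have "p \<in> L \<inter> K" using B by blast
      from F(4)[OF f this] have "\<bar>chart_deriv V \<psi> js f p\<bar> \<le> C * (\<Sum>s\<in>F. \<bar>chart_deriv U \<phi> s f p\<bar>)" .
      also have "\<dots> \<le> ?h f"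
        by (intro mult_left_mono sum_mono chart_deriv_le_seminorm[OF B(4,5,6) _ f]) (use F p B in auto)
      finally show "\<bar>chart_deriv V \<psi> js f p\<bar> \<le> ?h f" .
    qed
    ultimately have "?R B" by blast
    then show ?thesis using B by blast
  qed
  from compactin_finite_cover[where R="?R", OF K(1) cov] obtain \<B>
    where \<B>': "finite \<B> \<and> K \<subseteq> \<Union>\<B> \<and> (\<forall>B\<in>\<B>. ?R B)" by (rule exE)
  note \<B> = \<B>'[THEN conjunct1] \<B>'[THEN conjunct2, THEN conjunct1]
  from bchoice[OF \<B>'[THEN conjunct2, THEN conjunct2]] obtain h where
    h': "\<forall>B\<in>\<B>. dominated ?E P (h B) \<and> (\<forall>f\<in>?E. 0 \<le> h B f \<and>
       (\<forall>p\<in>B \<inter> K. \<bar>chart_deriv V \<psi> js f p\<bar> \<le> h B f))" by (rule exE)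
  note h = bspec[OF h']
  have "dominated ?E P (\<lambda>f. \<Sum>B\<in>\<B>. h B f)" by (rule dominated_sum[OF P0]) (rule h[THEN conjunct1])
  then show ?thesis
  proof (rule dominated_mono)
    fix f assume f: "f \<in> ?E"
    show "cinf_seminorm (V, \<psi>) K js f \<le> (\<Sum>B\<in>\<B>. h B f)"
    proof (rule cinf_seminorm_least[OF K(2)])
      fix p assume p: "p \<in> K"
      then obtain B where B: "B \<in> \<B>" "p \<in> B" using \<B>(2) by blast
      have "\<bar>chart_deriv V \<psi> js f p\<bar> \<le> h B f" using h[OF B(1)] f B p by blast
      also have "\<dots> \<le> (\<Sum>B\<in>\<B>. h B f)" by (rule member_le_sum[OF B(1)]) (use h f \<B>(1) in auto)
      finally show "\<bar>chart_deriv V \<psi> js f p\<bar> \<le> (\<Sum>B\<in>\<B>. h B f)" .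
    qed
  qed
qed

lemma compact_neighbourhood:
  assumes A: "openin (mtop N) A" "p \<in> A"
  obtains B K where "openin (mtop N) B" "p \<in> B" "B \<subseteq> K" "compactin (mtop N) K" "K \<subseteq> A"
proof -
  obtain U \<phi> where U: "(U, \<phi>) \<in> mcharts N" "p \<in> U" "U \<subseteq> A" using mcharts_at[OF N A] .
  note C = mcharts_is_chart[OF N U(1)]
  obtain e where e: "e > 0" "open_box (mdim N) (\<phi> p) e \<subseteq> \<phi> ` U"
    using Rn_box_obtain[OF chart_open_range[OF C], of "\<phi> p"] U(2) by blast
  \<comment> \<open>Half the side length makes the closed box fit into the chart range.\<close>
  let ?cb = "closed_box (mdim N) (\<phi> p) (e / 2)" and ?ob = "open_box (mdim N) (\<phi> p) (e / 2)"
  have cb: "?cb \<subseteq> \<phi> ` U"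
    by (rule order_trans[OF closed_box_subset_open_box e(2)]) (use e(1) in simp)
  have pR: "\<phi> p \<in> Rn (mdim N)" by (rule chart_in_Rn[OF C U(2)])
  show thesis
  proof (rule that)
    show "openin (mtop N) {q \<in> U. \<phi> q \<in> ?ob}" by (rule chart_open_vimage[OF C openin_open_box])
    show "compactin (mtop N) (inv_into U \<phi> ` ?cb)"
      by (rule image_compactin[OF _ chart_inv_continuous[OF C]])
        (use cb compactin_closed_box in \<open>auto simp: compactin_subtopology\<close>)
    show "p \<in> {q \<in> U. \<phi> q \<in> ?ob}" using U(2) e(1) pR by (auto simp: open_box_def)
    show "{q \<in> U. \<phi> q \<in> ?ob} \<subseteq> inv_into U \<phi> ` ?cb"
    proof safe
      fix q assume "q \<in> U" "\<phi> q \<in> ?ob"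
      then show "q \<in> inv_into U \<phi> ` ?cb"
        using open_box_subset_closed_box chart_inv[OF C, of q] by (metis image_eqI subsetD)
    qed
    show "inv_into U \<phi> ` ?cb \<subseteq> A" using cb U(3) chart_inv[OF C] by (auto simp: subset_iff image_iff)
  qed
qed

text \<open>Points are compact and the empty word gives the value itself, so the sequence converges
  pointwise. On compact chart pieces all derivatives are uniformly Cauchy, so the limit is smooth
  and the derivatives converge to its derivatives.\<close>

lemma cinf_complete:
  assumes u: "\<And>i. u i \<in> smooth_functions N"
    and cauchy: "\<And>q \<epsilon>. q \<in> cinf_seminorms N \<Longrightarrow> \<epsilon> > 0 \<Longrightarrow>
       \<exists>k::nat. \<forall>i\<ge>k. \<forall>j\<ge>k. q (fun_diff (mpoints N) (u i) (u j)) < \<epsilon>"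
  shows "\<exists>f\<in>smooth_functions N. \<forall>q\<in>cinf_seminorms N. (\<lambda>i. q (fun_diff (mpoints N) (u i) f)) \<longlonglongrightarrow> 0"
proof -
  let ?S = "mpoints N" and ?n = "mdim N"
  note diff_in = fun_diff_in_space[OF linear_smooth_functions]
  have deriv_diff: "chart_deriv U \<phi> js (fun_diff ?S f g) p = chart_deriv U \<phi> js f p - chart_deriv U \<phi> js g p"
    if "(U, \<phi>) \<in> mcharts N" "f \<in> smooth_functions N" "g \<in> smooth_functions N" "js \<in> lists {..<?n}" "p \<in> U"
    for U \<phi> js f g p
    using chart_deriv_linear[OF that(1-3) _ that(4,5), of "fun_diff ?S f g" 1 "-1"] by (simp add: fun_diff_def)
  have unif: "\<exists>k. \<forall>i\<ge>k. \<forall>j\<ge>k. \<forall>p\<in>K. \<bar>chart_deriv U \<phi> js (u i) p - chart_deriv U \<phi> js (u j) p\<bar> < \<epsilon>"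
    if U: "(U, \<phi>) \<in> mcharts N" and K: "compactin (mtop N) K" "K \<subseteq> U" and js: "js \<in> lists {..<?n}" and "\<epsilon> > 0"
    for U \<phi> K js \<epsilon>
  proof (cases "K = {}")
    case False
    then have "cinf_seminorm (U, \<phi>) K js \<in> cinf_seminorms N"
      using U K js unfolding cinf_seminorms_def by blast
    from cauchy[OF this \<open>\<epsilon> > 0\<close>] obtain k where k: "\<And>i j. i \<ge> k \<Longrightarrow> j \<ge> k \<Longrightarrow>
      cinf_seminorm (U, \<phi>) K js (fun_diff ?S (u i) (u j)) < \<epsilon>" by blast
    have "\<bar>chart_deriv U \<phi> js (u i) p - chart_deriv U \<phi> js (u j) p\<bar> < \<epsilon>" if "i \<ge> k" "j \<ge> k" "p \<in> K" for i j p
      using chart_deriv_le_seminorm[OF U K js diff_in[OF u u] that(3), of i j] k[OF that(1,2)] K(2) that(3)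
        deriv_diff[OF U u u js, of p i j] by auto
    then show ?thesis by blast
  qed auto
  have conv: "convergent (\<lambda>i. u i p)" if p: "p \<in> ?S" for p
  proof -
    obtain U \<phi> where U: "(U, \<phi>) \<in> mcharts N" "p \<in> U" using mcharts_cover[OF N p] by blast
    have "compactin (mtop N) {p}" using p by simp
    have "Cauchy (\<lambda>i. u i p)"
    proof (rule metric_CauchyI)
      fix e :: real assume "e > 0"
      from unif[OF U(1) \<open>compactin (mtop N) {p}\<close> _ _ this, of "[]"] U(2) mchart_inv[OF N U]
      show "\<exists>M. \<forall>m\<ge>M. \<forall>n\<ge>M. dist (u m p) (u n p) < e" by (simp add: dist_real_def)
    qed
    then show ?thesis by (simp add: Cauchy_convergent_iff)
  qed
  define f where "f = (\<lambda>p\<in>?S. lim (\<lambda>i. u i p))"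
  have lim: "(\<lambda>i. u i p) \<longlonglongrightarrow> f p" if "p \<in> ?S" for p
    using conv[OF that] that by (simp add: f_def convergent_LIMSEQ_iff)
  have lim_chart: "smooth_fun_on ?n (\<phi> ` U) (f \<circ> inv_into U \<phi>)"
    "js \<in> lists {..<?n} \<Longrightarrow> p \<in> U \<Longrightarrow> (\<lambda>i. chart_deriv U \<phi> js (u i) p) \<longlonglongrightarrow> chart_deriv U \<phi> js f p"
    if U: "(U, \<phi>) \<in> mcharts N" for U \<phi> js p
  proof -
    note O = mchart_open_range[OF U] and S = smooth_functions_chart[OF u U]
    have 1: "\<exists>W. openin (Euclidean_space ?n) W \<and> x \<in> W \<and> W \<subseteq> \<phi> ` U \<and>
       uniformly_Cauchy_on W (\<lambda>i. iter_partial js (u i \<circ> inv_into U \<phi>))"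
      if js: "js \<in> lists {..<?n}" and x: "x \<in> \<phi> ` U" for js x
    proof -
      obtain p where p: "p \<in> U" "x = \<phi> p" using x by blast
      obtain B K where B: "openin (mtop N) B" "p \<in> B" "B \<subseteq> K" "compactin (mtop N) K" "K \<subseteq> U"
        using compact_neighbourhood[OF mchart_openin[OF N U] p(1)] .
      have BU: "B \<subseteq> U" using B by blast
      have "uniformly_Cauchy_on (\<phi> ` B) (\<lambda>i. iter_partial js (u i \<circ> inv_into U \<phi>))"
        unfolding uniformly_Cauchy_on_def
      proof (intro allI impI)
        fix e :: real assume "e > 0"
        from unif[OF U B(4,5) js this] B(3)
        show "\<exists>M. \<forall>x\<in>\<phi> ` B. \<forall>m\<ge>M. \<forall>n\<ge>M. dist (iter_partial js (u m \<circ> inv_into U \<phi>) x)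
             (iter_partial js (u n \<circ> inv_into U \<phi>) x) < e" by (fastforce simp: dist_real_def)
      qed
      then show ?thesis using mchart_open_image[OF N U B(1) BU] BU p B(2) by blast
    qed
    have 2: "(\<lambda>i. (u i \<circ> inv_into U \<phi>) x) \<longlonglongrightarrow> (f \<circ> inv_into U \<phi>) x" if "x \<in> \<phi> ` U" for x
      using that lim mchart_subset_points[OF U] mchart_inv[OF N U] by auto
    show "smooth_fun_on ?n (\<phi> ` U) (f \<circ> inv_into U \<phi>)"
      by (rule smooth_fun_on_limit(1)[OF O S 1 2])
    show "js \<in> lists {..<?n} \<Longrightarrow> p \<in> U \<Longrightarrow> (\<lambda>i. chart_deriv U \<phi> js (u i) p) \<longlonglongrightarrow> chart_deriv U \<phi> js f p"
      by (rule smooth_fun_on_limit(2)[OF O S 1 2]) auto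
  qed
  have f: "f \<in> smooth_functions N"
    unfolding smooth_functions_def using lim_chart(1) by (auto simp: f_def)
  have "(\<lambda>i. q (fun_diff ?S (u i) f)) \<longlonglongrightarrow> 0" if q: "q \<in> cinf_seminorms N" for q
  proof -
    obtain U \<phi> K js where q': "q = cinf_seminorm (U, \<phi>) K js" and U: "(U, \<phi>) \<in> mcharts N"
      and K: "compactin (mtop N) K" "K \<noteq> {}" "K \<subseteq> U" and js: "js \<in> lists {..<?n}"
      using q unfolding cinf_seminorms_def by blast
    show ?thesis
    proof (rule LIMSEQ_I)
      fix r :: real assume r: "r > 0"
      then have "r / 2 > 0" by simp
      from unif[OF U K(1,3) js this] obtain k where k: "\<And>i j p. i \<ge> k \<Longrightarrow> j \<ge> k \<Longrightarrow> p \<in> K \<Longrightarrow>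
        \<bar>chart_deriv U \<phi> js (u i) p - chart_deriv U \<phi> js (u j) p\<bar> < r / 2" by blast
      have "norm (q (fun_diff ?S (u i) f) - 0) < r" if i: "i \<ge> k" for i
      proof -
        have "q (fun_diff ?S (u i) f) \<le> r / 2"
          unfolding q'
        proof (rule cinf_seminorm_least[OF K(2)])
          fix p assume p: "p \<in> K"
          then have pU: "p \<in> U" using K by blast
          \<comment> \<open>The second index tends to infinity in the Cauchy estimate; the limit
            keeps only a weak inequality, which is why the estimate was taken with r / 2.\<close>
          have "(\<lambda>j. \<bar>chart_deriv U \<phi> js (u i) p - chart_deriv U \<phi> js (u j) p\<bar>) \<longlonglongrightarrow>
              \<bar>chart_deriv U \<phi> js (u i) p - chart_deriv U \<phi> js f p\<bar>"
            by (intro tendsto_intros lim_chart(2)[OF U js pU])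
          moreover have "\<forall>\<^sub>F j in sequentially. \<bar>chart_deriv U \<phi> js (u i) p - chart_deriv U \<phi> js (u j) p\<bar> \<le> r / 2"
            unfolding eventually_sequentially using k[OF i _ p] by (intro exI[of _ k]) (auto intro: less_imp_le)
          ultimately have "\<bar>chart_deriv U \<phi> js (u i) p - chart_deriv U \<phi> js f p\<bar> \<le> r / 2"
            by (rule tendsto_upperbound) simp
          then show "\<bar>chart_deriv U \<phi> js (fun_diff ?S (u i) f) p\<bar> \<le> r / 2"
            using deriv_diff[OF U u f js pU] by simp
        qed
        then show ?thesis using cinf_seminorm_nonneg[OF q diff_in[OF u f], of i] r by simp
      qed
      then show "\<exists>k. \<forall>i\<ge>k. norm (q (fun_diff ?S (u i) f) - 0) < r" by blast
    qed
  qed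
  then show ?thesis using f by blast
qed

end

text \<open>Countability is the issue: second countability gives a countable cover by open sets
  inside compact chart pieces, and with the countably many words this leaves countably many
  seminorms that dominate all others.\<close>

theorem frechet_space_cinf_topology:
  assumes "smooth_manifold N"
  shows "frechet_space (mpoints N) (cinf_topology N)"
proof -
  have H: "Hausdorff_space (mtop N)" and sc: "second_countable (mtop N)" and N: "smooth_structure N"
    using assms by (auto simp: smooth_manifold_iff)
  let ?E = "smooth_functions N" and ?S = "mpoints N"
  have "\<exists>B U \<phi> K. openin (mtop N) B \<and> p \<in> B \<and> B \<subseteq> K \<and> (U, \<phi>) \<in> mcharts N \<and> compactin (mtop N) K \<and> K \<subseteq> U"
    if p: "p \<in> ?S" for p
  proof -
    obtain U \<phi> where U: "(U, \<phi>) \<in> mcharts N" "p \<in> U" using mcharts_cover[OF N p] by blast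
    obtain B K where "openin (mtop N) B" "p \<in> B" "B \<subseteq> K" "compactin (mtop N) K" "K \<subseteq> U"
      using compact_neighbourhood[OF N mchart_openin[OF N U(1)] U(2)] .
    then show ?thesis using U by blast
  qed
  then obtain B U \<phi> K where BK: "\<And>p. p \<in> ?S \<Longrightarrow> openin (mtop N) (B p) \<and> p \<in> B p \<and> B p \<subseteq> K p \<and>
     (U p, \<phi> p) \<in> mcharts N \<and> compactin (mtop N) (K p) \<and> K p \<subseteq> U p" by metis
  have "\<forall>V\<in>B ` ?S. openin (mtop N) V" using BK by blast
  moreover have "\<Union>(B ` ?S) = ?S"
  proof
    show "\<Union>(B ` ?S) \<subseteq> ?S" using BK openin_subset by blast
    show "?S \<subseteq> \<Union>(B ` ?S)" using BK by blast
  qed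
  ultimately obtain \<V> where \<V>: "countable \<V>" "\<V> \<subseteq> B ` ?S" "\<Union>\<V> = ?S"
    using second_countable_imp_Lindelof_space[OF sc] unfolding Lindelof_space_def by meson
  then obtain C where C: "countable C" "C \<subseteq> ?S" "\<V> = B ` C"
    using countable_subset_image by metis
  define P where "P = (\<lambda>(p, js). cinf_seminorm (U p, \<phi> p) (K p) js) ` (C \<times> lists {..<mdim N})"
  have P_sub: "P \<subseteq> cinf_seminorms N"
  proof
    fix q assume "q \<in> P"
    then obtain p js where q: "q = cinf_seminorm (U p, \<phi> p) (K p) js" "p \<in> C" "js \<in> lists {..<mdim N}"
      unfolding P_def by auto
    have "p \<in> ?S" using C(2) q(2) by blast
    then have "(U p, \<phi> p) \<in> mcharts N" "compactin (mtop N) (K p)" "K p \<subseteq> U p" "K p \<noteq> {}" using BK[of p] by auto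
    then show "q \<in> cinf_seminorms N" unfolding cinf_seminorms_def q(1) using q(3) by blast
  qed
  have cover: "\<exists>p\<in>C. x \<in> B p" if "x \<in> ?S" for x using \<V>(3) C(3) that by blast
  have dom: "dominated ?E P q" if "q \<in> cinf_seminorms N" for q
  proof -
    obtain V \<psi> L js where q: "q = cinf_seminorm (V, \<psi>) L js" and V: "(V, \<psi>) \<in> mcharts N"
      and L: "compactin (mtop N) L" "L \<noteq> {}" "L \<subseteq> V" and js: "js \<in> lists {..<mdim N}"
      using \<open>q \<in> cinf_seminorms N\<close> unfolding cinf_seminorms_def by blast
    show ?thesis unfolding q
    proof (rule dominated_cinf_seminorm[OF N H P_sub V L js])
      fix x assume "x \<in> L"
      then have "x \<in> ?S" using L(1) compactin_subset_topspace by blast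
      then obtain p where p: "p \<in> C" "x \<in> B p" using cover by blast
      then have "\<forall>s\<in>lists {..<mdim N}. cinf_seminorm (U p, \<phi> p) (K p) s \<in> P" unfolding P_def by force
      moreover have "p \<in> ?S" using C(2) p(1) by blast
      ultimately show "\<exists>B U \<phi> L. openin (mtop N) B \<and> x \<in> B \<and> B \<subseteq> L \<and> (U, \<phi>) \<in> mcharts N \<and>
         compactin (mtop N) L \<and> L \<subseteq> U \<and> (\<forall>s\<in>lists {..<mdim N}. cinf_seminorm (U, \<phi>) L s \<in> P)"
        using BK[of p] p(2) by blast
    qed
  qed
  have lin: "linear_function_space ?S ?E" by (rule linear_smooth_functions[OF N])
  have sem: "seminorm_on ?S ?E q" if "q \<in> P" for q using seminorm_cinf_seminorm[OF N] P_sub that by blast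
  have top: "cinf_topology N = seminorm_topology ?S ?E P"
    unfolding cinf_topology_eq
    by (rule seminorm_topology_eqI[OF lin])
      (use cinf_seminorm_nonneg[OF N] P_sub dom in \<open>auto intro: dominated_member\<close>)
  \<comment> \<open>The empty word sees the value of f at every point of the pieces, which cover the
    manifold; elsewhere both functions are \<open>undefined\<close>.\<close>
  have sep: "f = (\<lambda>x\<in>?S. 0)" if f: "f \<in> ?E" "\<forall>q\<in>P. q f = 0" for f
  proof
    fix x
    show "f x = (\<lambda>x\<in>?S. 0) x"
    proof (cases "x \<in> ?S")
      case True
      then obtain p where p: "p \<in> C" "x \<in> B p" using cover by blast
      then have pS: "p \<in> ?S" using C(2) by blast
      have "cinf_seminorm (U p, \<phi> p) (K p) [] \<in> P" using p unfolding P_def by force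
      then have "cinf_seminorm (U p, \<phi> p) (K p) [] f = 0" using f(2) by blast
      moreover have "\<bar>chart_deriv (U p) (\<phi> p) [] f x\<bar> \<le> cinf_seminorm (U p, \<phi> p) (K p) [] f"
        by (rule chart_deriv_le_seminorm[OF N]) (use BK[OF pS] p(2) f(1) in auto)
      moreover have "inv_into (U p) (\<phi> p) (\<phi> p x) = x"
        by (rule mchart_inv[OF N]) (use BK[OF pS] p(2) in auto)
      ultimately show ?thesis using True by simp
    next
      case False
      then show ?thesis using smooth_functions_extensional[OF N f(1)] by (simp add: extensional_def)
    qed
  qed
  have complete: "\<exists>f\<in>?E. \<forall>q\<in>P. (\<lambda>i. q (fun_diff ?S (u i) f)) \<longlonglongrightarrow> 0"
    if u: "range u \<subseteq> ?E" and cauchy: "\<forall>q\<in>P. \<forall>\<epsilon>>0. \<exists>k::nat. \<forall>i\<ge>k. \<forall>j\<ge>k. q (fun_diff ?S (u i) (u j)) < \<epsilon>" for u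
  proof -
    have "\<exists>k. \<forall>i\<ge>k. \<forall>j\<ge>k. q (fun_diff ?S (u i) (u j)) < \<epsilon>" if q: "q \<in> cinf_seminorms N" and "\<epsilon> > 0" for q \<epsilon>
    proof -
      obtain G D where G: "finite G" "G \<subseteq> P" "0 \<le> D" "\<And>f. f \<in> ?E \<Longrightarrow> q f \<le> D * (\<Sum>p\<in>G. p f)"
        using dom[OF q] unfolding dominated_def by blast
      \<comment> \<open>Chosen so that D times a sum of \<open>card G\<close> terms below d stays
        below \<epsilon>; the 1 keeps the denominator positive.\<close>
      define d where "d = \<epsilon> / (D * card G + 1)"
      have D1: "D * card G + 1 > 0" using G(3) by (simp add: add_nonneg_pos)
      then have d: "d > 0" using \<open>\<epsilon> > 0\<close> by (simp add: d_def)
      have "(D * card G + 1) * d = \<epsilon>" using D1 by (simp add: d_def)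
      then have dD: "D * (card G * d) < \<epsilon>" using d by (simp add: algebra_simps)
      have "\<forall>p\<in>G. \<exists>k. \<forall>i\<ge>k. \<forall>j\<ge>k. p (fun_diff ?S (u i) (u j)) < d" using cauchy G(2) d by blast
      then obtain k where k: "\<And>p i j. p \<in> G \<Longrightarrow> i \<ge> k p \<Longrightarrow> j \<ge> k p \<Longrightarrow> p (fun_diff ?S (u i) (u j)) < d" by metis
      have "q (fun_diff ?S (u i) (u j)) < \<epsilon>" if ij: "i \<ge> Max (insert 0 (k ` G))" "j \<ge> Max (insert 0 (k ` G))" for i j
      proof -
        have "q (fun_diff ?S (u i) (u j)) \<le> D * (\<Sum>p\<in>G. p (fun_diff ?S (u i) (u j)))"
          by (intro G(4) fun_diff_in_space[OF lin]) (use u in auto)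
        also have "\<dots> \<le> D * (\<Sum>p\<in>G. d)"
          using ij G(1,3) k by (intro mult_left_mono sum_mono) (auto intro: less_imp_le)
        finally show ?thesis using dD by simp
      qed
      then show ?thesis by blast
    qed
    then have "\<exists>f\<in>?E. \<forall>q\<in>cinf_seminorms N. (\<lambda>i. q (fun_diff ?S (u i) f)) \<longlonglongrightarrow> 0"
      by (intro cinf_complete[OF N]) (use u in auto)
    then show ?thesis using P_sub by blast
  qed
  have cP: "countable P" unfolding P_def using C(1) by (intro countable_image countable_SIGMA) auto
  have a2: "\<forall>q\<in>P. seminorm_on ?S ?E q" using sem by blast
  have a4: "\<forall>f\<in>?E. (\<forall>q\<in>P. q f = 0) \<longrightarrow> f = (\<lambda>x\<in>?S. 0)" by (intro ballI impI) (rule sep)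
  have a5: "\<forall>u. range u \<subseteq> ?E \<and>
             (\<forall>q\<in>P. \<forall>\<epsilon>>0. \<exists>k::nat. \<forall>i\<ge>k. \<forall>j\<ge>k. q (fun_diff ?S (u i) (u j)) < \<epsilon>) \<longrightarrow>
             (\<exists>f\<in>?E. \<forall>q\<in>P. (\<lambda>i. q (fun_diff ?S (u i) f)) \<longlonglongrightarrow> 0)"
    by (intro allI impI, erule conjE) (rule complete)
  show ?thesis unfolding frechet_space_def topspace_cinf_topology
    by (rule conjI[OF lin], rule exI[where x=P], intro conjI cP a2 top a4 a5)
qed


section \<open>Product manifolds and Euclidean spaces\<close>

lemma continuous_map_Euclidean_coord: "continuous_map (Euclidean_space n) euclideanreal (\<lambda>x. x i)"
  unfolding continuous_map_Euclidean_space_iff by (rule continuous_on_coord)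

lemma Rn_ext: "x \<in> Rn n \<Longrightarrow> (\<lambda>i. if i < n then x i else 0) = x"
  by (auto simp: topspace_Euclidean_space fun_eq_iff)

lemma continuous_map_into_Euclidean:
  assumes "\<And>x. x \<in> topspace X \<Longrightarrow> f x \<in> Rn n"
    and "\<And>i. i < n \<Longrightarrow> continuous_map X euclideanreal (\<lambda>x. f x i)"
  shows "continuous_map X (Euclidean_space n) f"
proof -
  have "continuous_map X (Euclidean_space n) (\<lambda>x i. if i < n then f x i else 0)"
    unfolding continuous_map_componentwise_Euclidean_space using assms(2) by blast
  then show ?thesis by (rule continuous_map_eq) (rule Rn_ext[OF assms(1)])
qed

section \<open>Product charts and product manifolds\<close>

definition prod_coord :: "nat \<Rightarrow> ('a \<Rightarrow> nat \<Rightarrow> real) \<Rightarrow> ('b \<Rightarrow> nat \<Rightarrow> real) \<Rightarrow> 'a \<times> 'b \<Rightarrow> nat \<Rightarrow> real" where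
  "prod_coord k \<phi> \<psi> = (\<lambda>(x, y) i. if i < k then \<phi> x i else \<psi> y (i - k))"

lemma prod_chart_eq: "prod_chart k (U, \<phi>) (V, \<psi>) = (U \<times> V, prod_coord k \<phi> \<psi>)"
  by (simp add: prod_chart_def prod_coord_def)

definition fst_coords :: "nat \<Rightarrow> (nat \<Rightarrow> real) \<Rightarrow> nat \<Rightarrow> real" where
  "fst_coords k z = (\<lambda>i. if i < k then z i else 0)"

definition snd_coords :: "nat \<Rightarrow> (nat \<Rightarrow> real) \<Rightarrow> nat \<Rightarrow> real" where
  "snd_coords k z = (\<lambda>i. z (i + k))"

lemma fst_coords_in: "fst_coords k z \<in> Rn k"
  by (simp add: fst_coords_def topspace_Euclidean_space)

lemma snd_coords_in: "z \<in> Rn (k + l) \<Longrightarrow> snd_coords k z \<in> Rn l"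
  by (simp add: snd_coords_def topspace_Euclidean_space)

lemma fst_coords_prod: "\<phi> x \<in> Rn k \<Longrightarrow> fst_coords k (prod_coord k \<phi> \<psi> (x, y)) = \<phi> x"
  by (auto simp: fst_coords_def prod_coord_def topspace_Euclidean_space fun_eq_iff)

lemma snd_coords_prod: "snd_coords k (prod_coord k \<phi> \<psi> (x, y)) = \<psi> y"
  by (auto simp: snd_coords_def prod_coord_def)

lemma prod_coord_split:
  "\<phi> x = fst_coords k z \<Longrightarrow> \<psi> y = snd_coords k z \<Longrightarrow> prod_coord k \<phi> \<psi> (x, y) = z"
  by (auto simp: fst_coords_def snd_coords_def prod_coord_def fun_eq_iff)

lemma continuous_map_fst_coords: "continuous_map (Euclidean_space (k + l)) (Euclidean_space k) (fst_coords k)"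
  by (rule continuous_map_into_Euclidean[OF fst_coords_in])
    (simp add: fst_coords_def continuous_map_Euclidean_coord)

lemma continuous_map_snd_coords: "continuous_map (Euclidean_space (k + l)) (Euclidean_space l) (snd_coords k)"
  by (rule continuous_map_into_Euclidean[OF snd_coords_in])
    (simp_all add: snd_coords_def continuous_map_Euclidean_coord)

context
  fixes k l :: nat and S :: "'a topology" and T :: "'b topology" and U \<phi> V \<psi>
  assumes U: "is_chart k S (U, \<phi>)" and V: "is_chart l T (V, \<psi>)"
begin

lemma prod_coord_range:
  "prod_coord k \<phi> \<psi> ` (U \<times> V) = {z \<in> Rn (k + l). fst_coords k z \<in> \<phi> ` U \<and> snd_coords k z \<in> \<psi> ` V}"
proof (rule subset_antisym; rule subsetI)
  fix z assume "z \<in> prod_coord k \<phi> \<psi> ` (U \<times> V)"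
  then obtain x y where z: "z = prod_coord k \<phi> \<psi> (x, y)" "x \<in> U" "y \<in> V" by auto
  have "\<phi> x \<in> Rn k" "\<psi> y \<in> Rn l" using chart_in_Rn[OF U z(2)] chart_in_Rn[OF V z(3)] .
  moreover from this have "z \<in> Rn (k + l)"
    unfolding z(1) by (auto simp: prod_coord_def topspace_Euclidean_space)
  ultimately show "z \<in> {z \<in> Rn (k + l). fst_coords k z \<in> \<phi> ` U \<and> snd_coords k z \<in> \<psi> ` V}"
    using z by (simp add: fst_coords_prod snd_coords_prod)
next
  fix z assume "z \<in> {z \<in> Rn (k + l). fst_coords k z \<in> \<phi> ` U \<and> snd_coords k z \<in> \<psi> ` V}"
  then obtain x y where "x \<in> U" "\<phi> x = fst_coords k z" "y \<in> V" "\<psi> y = snd_coords k z" by force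
  then show "z \<in> prod_coord k \<phi> \<psi> ` (U \<times> V)" using prod_coord_split[of \<phi> x k z \<psi> y] by force
qed

lemma is_chart_prod: "is_chart (k + l) (prod_topology S T) (U \<times> V, prod_coord k \<phi> \<psi>)"
proof -
  let ?c = "prod_coord k \<phi> \<psi>" and ?E = "Euclidean_space (k + l)"
  let ?W = "{z \<in> Rn (k + l). fst_coords k z \<in> \<phi> ` U \<and> snd_coords k z \<in> \<psi> ` V}"
  let ?g = "\<lambda>z. (inv_into U \<phi> (fst_coords k z), inv_into V \<psi> (snd_coords k z))"
  have W: "openin ?E ?W"
  proof -
    have "openin ?E ({z \<in> Rn (k + l). fst_coords k z \<in> \<phi> ` U} \<inter> {z \<in> Rn (k + l). snd_coords k z \<in> \<psi> ` V})"
      by (intro openin_Int openin_continuous_map_preimage[OF continuous_map_fst_coords chart_open_range[OF U]]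
          openin_continuous_map_preimage[OF continuous_map_snd_coords chart_open_range[OF V]])
    then show ?thesis by (rule back_subst[of "openin ?E"]) blast
  qed
  have sub: "subtopology (prod_topology S T) (U \<times> V) = prod_topology (subtopology S U) (subtopology T V)"
    by (simp add: subtopology_Times)
  have UV: "U \<subseteq> topspace S" "V \<subseteq> topspace T"
    using openin_subset[OF chart_openin[OF U]] openin_subset[OF chart_openin[OF V]] .
  have c1: "continuous_map (subtopology (prod_topology S T) (U \<times> V)) ?E ?c"
  proof (rule continuous_map_into_Euclidean)
    fix p assume "p \<in> topspace (subtopology (prod_topology S T) (U \<times> V))"
    then have "?c p \<in> ?c ` (U \<times> V)" by (intro imageI) simp
    then show "?c p \<in> Rn (k + l)" unfolding prod_coord_range by blast
  next
    fix i
    have 1: "continuous_map (prod_topology (subtopology S U) (subtopology T V)) (Euclidean_space k) (\<phi> \<circ> fst)"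
      by (rule continuous_map_compose[OF continuous_map_fst chart_continuous[OF U]])
    have 2: "continuous_map (prod_topology (subtopology S U) (subtopology T V)) (Euclidean_space l) (\<psi> \<circ> snd)"
      by (rule continuous_map_compose[OF continuous_map_snd chart_continuous[OF V]])
    show "continuous_map (subtopology (prod_topology S T) (U \<times> V)) euclideanreal (\<lambda>p. ?c p i)"
      unfolding sub
      using continuous_map_compose[OF 1 continuous_map_Euclidean_coord, of i]
        continuous_map_compose[OF 2 continuous_map_Euclidean_coord, of "i - k"]
      by (cases "i < k") (simp_all add: prod_coord_def o_def case_prod_beta)
  qed
  have c2: "continuous_map (subtopology ?E ?W) (prod_topology S T) ?g"
  proof (rule continuous_map_pairedI)
    have "continuous_map (subtopology ?E ?W) (subtopology (Euclidean_space k) (\<phi> ` U)) (fst_coords k)"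
      using continuous_map_from_subtopology[OF continuous_map_fst_coords, of k l ?W]
      by (auto simp: continuous_map_in_subtopology)
    from continuous_map_compose[OF this chart_inv_continuous[OF U]]
    show "continuous_map (subtopology ?E ?W) S (\<lambda>z. inv_into U \<phi> (fst_coords k z))" by (simp add: o_def)
    have "continuous_map (subtopology ?E ?W) (subtopology (Euclidean_space l) (\<psi> ` V)) (snd_coords k)"
      using continuous_map_from_subtopology[OF continuous_map_snd_coords, of k l ?W]
      by (auto simp: continuous_map_in_subtopology)
    from continuous_map_compose[OF this chart_inv_continuous[OF V]]
    show "continuous_map (subtopology ?E ?W) T (\<lambda>z. inv_into V \<psi> (snd_coords k z))" by (simp add: o_def)
  qed
  have gc: "?g (?c p) = p" if "p \<in> U \<times> V" for p
    using that chart_inv[OF U] chart_inv[OF V] chart_in_Rn[OF U]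
    by (auto simp: fst_coords_prod snd_coords_prod)
  have cg: "?c (?g z) = z" "?g z \<in> U \<times> V" if "z \<in> ?W" for z
    using that chart_inv[OF U] chart_inv[OF V] by (auto intro!: prod_coord_split)
  have "homeomorphic_maps (subtopology (prod_topology S T) (U \<times> V)) (subtopology ?E ?W) ?c ?g"
    unfolding homeomorphic_maps_def
  proof (intro conjI ballI)
    show "continuous_map (subtopology (prod_topology S T) (U \<times> V)) (subtopology ?E ?W) ?c"
      using c1 prod_coord_range by (auto simp: continuous_map_in_subtopology)
    show "continuous_map (subtopology ?E ?W) (subtopology (prod_topology S T) (U \<times> V)) ?g"
      unfolding continuous_map_in_subtopology using c2 cg(2) by auto
    show "?g (?c p) = p" if "p \<in> topspace (subtopology (prod_topology S T) (U \<times> V))" for p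
      by (rule gc) (use that in simp)
    show "?c (?g z) = z" if "z \<in> topspace (subtopology ?E ?W)" for z
      by (rule cg(1)) (use that in simp)
  qed
  then have "homeomorphic_map (subtopology (prod_topology S T) (U \<times> V)) (subtopology ?E ?W) ?c"
    unfolding homeomorphic_map_maps by blast
  then show ?thesis
    unfolding is_chart_iff prod_coord_range
    using W chart_openin[OF U] chart_openin[OF V] by (simp add: openin_prod_Times_iff)
qed

end

lemma smooth_fun_on_fst_coords:
  assumes "openin (Euclidean_space n) W"
  shows "smooth_fun_on n W (\<lambda>z. fst_coords k z j)"
  by (cases "j < k") (simp_all add: fst_coords_def smooth_fun_on_coord[OF assms] smooth_fun_on_const[OF assms])

lemma smooth_fun_on_snd_coords:
  assumes "openin (Euclidean_space n) W"
  shows "smooth_fun_on n W (\<lambda>z. snd_coords k z j)"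
  by (simp add: snd_coords_def smooth_fun_on_coord[OF assms])

lemma prod_manifold_sel [simp]:
  "mdim (prod_manifold X Y) = mdim X + mdim Y"
  "mtop (prod_manifold X Y) = prod_topology (mtop X) (mtop Y)"
  by (simp_all add: prod_manifold_def)

context
  fixes X :: "'a manifold" and Y :: "'b manifold"
  assumes X: "smooth_structure X" and Y: "smooth_structure Y"
begin

lemma prod_chart_is_chart:
  assumes "(U, \<phi>) \<in> mcharts X" "(V, \<psi>) \<in> mcharts Y"
  shows "is_chart (mdim X + mdim Y) (prod_topology (mtop X) (mtop Y)) (U \<times> V, prod_coord (mdim X) \<phi> \<psi>)"
  by (rule is_chart_prod[OF mcharts_is_chart[OF X assms(1)] mcharts_is_chart[OF Y assms(2)]])

lemma prod_chart_transition:
  assumes U: "(U, \<phi>) \<in> mcharts X" "(U', \<phi>') \<in> mcharts X" and V: "(V, \<psi>) \<in> mcharts Y" "(V', \<psi>') \<in> mcharts Y"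
  shows "smooth_transition (mdim X + mdim Y) (U \<times> V, prod_coord (mdim X) \<phi> \<psi>) (U' \<times> V', prod_coord (mdim X) \<phi>' \<psi>')"
  unfolding smooth_transition_def prod.case
proof (intro allI impI)
  fix i assume i: "i < mdim X + mdim Y"
  let ?k = "mdim X" and ?l = "mdim Y"
  let ?c = "prod_coord ?k \<phi> \<psi>" and ?c' = "prod_coord ?k \<phi>' \<psi>'"
  let ?B = "(U \<times> V) \<inter> (U' \<times> V')"
  note C = prod_chart_is_chart[OF U(1) V(1)] and C' = prod_chart_is_chart[OF U(2) V(2)]
  have B: "openin (prod_topology (mtop X) (mtop Y)) ?B"
    by (intro openin_Int chart_openin[OF C] chart_openin[OF C'])
  have O: "openin (Euclidean_space (?k + ?l)) (?c ` ?B)" by (rule chart_open_image[OF C B]) auto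
  have UU: "openin (mtop X) (U \<inter> U')" by (rule openin_Int[OF mchart_openin[OF X U(1)] mchart_openin[OF X U(2)]])
  have VV: "openin (mtop Y) (V \<inter> V')" by (rule openin_Int[OF mchart_openin[OF Y V(1)] mchart_openin[OF Y V(2)]])
  have fc: "fst_coords ?k (?c (x, y)) = \<phi> x" if "x \<in> U" for x y
    using fst_coords_prod[of \<phi> x ?k \<psi> y] chart_in_Rn[OF mcharts_is_chart[OF X U(1)] that] by simp
  show "smooth_fun_on (?k + ?l) (?c ` ?B) (\<lambda>z. ?c' (inv_into (U \<times> V) ?c z) i)"
  proof (cases "i < ?k")
    case True
    \<comment> \<open>In its first k components the transition is that of X after the linear
      projection to the first k coordinates; the other components are treated alike with Y.\<close>
    have "smooth_fun_on (?k + ?l) (?c ` ?B) (\<lambda>z. \<phi>' (inv_into U \<phi> (fst_coords ?k z)) i)"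
    proof (rule smooth_fun_on_compose[OF O mchart_open_image[OF X U(1) UU] mcharts_transition[OF X U True]])
      show "fst_coords ?k z \<in> \<phi> ` (U \<inter> U')" if "z \<in> ?c ` ?B" for z using that fc by auto
    qed (auto intro: smooth_fun_on_fst_coords[OF O])
    then show ?thesis
      by (rule smooth_fun_on_cong[OF O, rotated])
        (use True fc chart_inv[OF C] mchart_inv[OF X U(1)] in \<open>auto simp: prod_coord_def[of ?k \<phi>' \<psi>']\<close>)
  next
    case False
    then have i': "i - ?k < ?l" using i by simp
    have "smooth_fun_on (?k + ?l) (?c ` ?B) (\<lambda>z. \<psi>' (inv_into V \<psi> (snd_coords ?k z)) (i - ?k))"
    proof (rule smooth_fun_on_compose[OF O mchart_open_image[OF Y V(1) VV] mcharts_transition[OF Y V i']])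
      show "snd_coords ?k z \<in> \<psi> ` (V \<inter> V')" if "z \<in> ?c ` ?B" for z using that by (auto simp: snd_coords_prod)
    qed (auto intro: smooth_fun_on_snd_coords[OF O])
    then show ?thesis
      by (rule smooth_fun_on_cong[OF O, rotated])
        (use False chart_inv[OF C] mchart_inv[OF Y V(1)] in \<open>auto simp: snd_coords_prod prod_coord_def[of ?k \<phi>' \<psi>']\<close>)
  qed
qed

lemma atlas_prod:
  "atlas (mdim X + mdim Y) (prod_topology (mtop X) (mtop Y))
     {prod_chart (mdim X) c d | c d. c \<in> mcharts X \<and> d \<in> mcharts Y}" (is "atlas ?n ?T ?A")
proof -
  have A: "\<exists>U \<phi> V \<psi>. (U, \<phi>) \<in> mcharts X \<and> (V, \<psi>) \<in> mcharts Y \<and> c = (U \<times> V, prod_coord (mdim X) \<phi> \<psi>)"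
    if "c \<in> ?A" for c
    using that by (auto simp: prod_chart_eq)
  have A': "(U \<times> V, prod_coord (mdim X) \<phi> \<psi>) \<in> ?A" if "(U, \<phi>) \<in> mcharts X" "(V, \<psi>) \<in> mcharts Y" for U \<phi> V \<psi>
    using that prod_chart_eq[of "mdim X" U \<phi> V \<psi>, symmetric] by blast
  have chart: "is_chart ?n ?T c" if "c \<in> ?A" for c using A[OF that] prod_chart_is_chart by blast
  show ?thesis unfolding atlas_def
  proof (intro conjI ballI)
    show "is_chart ?n ?T c" if "c \<in> ?A" for c by (rule chart[OF that])
    show "compatible_charts ?n c d" if "c \<in> ?A" "d \<in> ?A" for c d
      unfolding compatible_charts_def using A[OF that(1)] A[OF that(2)] prod_chart_transition by blast
    show "(\<Union>(U, \<phi>)\<in>?A. U) = topspace ?T"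
    proof (rule subset_antisym; rule subsetI)
      fix p assume "p \<in> (\<Union>(U, \<phi>)\<in>?A. U)"
      then obtain c where c: "c \<in> ?A" "p \<in> (case c of (U, \<phi>) \<Rightarrow> U)" by (rule UN_E)
      then have pc: "p \<in> fst c" by (simp add: case_prod_beta)
      from c(1)
      have "is_chart ?n ?T (fst c, snd c)" using chart by simp
      then show "p \<in> topspace ?T" using openin_subset[OF chart_openin] pc by blast
    next
      fix p assume p: "p \<in> topspace ?T"
      obtain x y where xy: "p = (x, y)" by (cases p)
      then have "x \<in> mpoints X" "y \<in> mpoints Y" using p by auto
      then obtain U \<phi> V \<psi> where "(U, \<phi>) \<in> mcharts X" "x \<in> U" "(V, \<psi>) \<in> mcharts Y" "y \<in> V"
        using mcharts_cover[OF X] mcharts_cover[OF Y] by blast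
      then show "p \<in> (\<Union>(U, \<phi>)\<in>?A. U)" using A'[of U \<phi> V \<psi>] xy by blast
    qed
  qed
qed

lemma smooth_structure_prod: "smooth_structure (prod_manifold X Y)"
  unfolding prod_manifold_def by (rule smooth_structure_maximal_atlas[OF atlas_prod])

lemma prod_chart_mem:
  assumes "(U, \<phi>) \<in> mcharts X" "(V, \<psi>) \<in> mcharts Y"
  shows "(U \<times> V, prod_coord (mdim X) \<phi> \<psi>) \<in> mcharts (prod_manifold X Y)"
proof -
  have "prod_chart (mdim X) (U, \<phi>) (V, \<psi>) \<in> {prod_chart (mdim X) c d | c d. c \<in> mcharts X \<and> d \<in> mcharts Y}"
    using assms by blast
  then show ?thesis
    unfolding prod_chart_eq[symmetric] prod_manifold_def manifold.simps
    by (rule subsetD[OF maximal_atlas_structure(3)[OF atlas_prod]])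
qed

lemma smooth_map_fst: "smooth_map (prod_manifold X Y) X fst"
proof (rule smooth_mapI[OF smooth_structure_prod X])
  fix p assume "p \<in> mpoints (prod_manifold X Y)"
  then have "fst p \<in> mpoints X" "snd p \<in> mpoints Y" by auto
  then obtain U \<phi> V \<psi> where UV: "(U, \<phi>) \<in> mcharts X" "fst p \<in> U" "(V, \<psi>) \<in> mcharts Y" "snd p \<in> V"
    using mcharts_cover[OF X] mcharts_cover[OF Y] by blast
  note m = prod_chart_mem[OF UV(1,3)]
  have "smooth_real (prod_manifold X Y) (U \<times> V) (\<lambda>p. \<phi> (fst p) i)" if "i < mdim X" for i
    by (rule smooth_real_cong[OF smooth_structure_prod _ smooth_real_coord[OF smooth_structure_prod m, of i]])
      (use that in \<open>auto simp: prod_coord_def\<close>)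
  then show "\<exists>V \<psi> A. (V, \<psi>) \<in> mcharts X \<and> fst p \<in> V \<and> openin (mtop (prod_manifold X Y)) A \<and> p \<in> A \<and>
        (\<forall>i<mdim X. smooth_real (prod_manifold X Y) A (\<lambda>p. \<psi> (fst p) i))"
    using UV mchart_openin[OF smooth_structure_prod m] by (metis mem_Times_iff)
qed (simp add: continuous_map_fst)

lemma smooth_map_snd: "smooth_map (prod_manifold X Y) Y snd"
proof (rule smooth_mapI[OF smooth_structure_prod Y])
  fix p assume "p \<in> mpoints (prod_manifold X Y)"
  then have "fst p \<in> mpoints X" "snd p \<in> mpoints Y" by auto
  then obtain U \<phi> V \<psi> where UV: "(U, \<phi>) \<in> mcharts X" "fst p \<in> U" "(V, \<psi>) \<in> mcharts Y" "snd p \<in> V"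
    using mcharts_cover[OF X] mcharts_cover[OF Y] by blast
  note m = prod_chart_mem[OF UV(1,3)]
  have "smooth_real (prod_manifold X Y) (U \<times> V) (\<lambda>p. \<psi> (snd p) i)" for i
    by (rule smooth_real_cong[OF smooth_structure_prod _ smooth_real_coord[OF smooth_structure_prod m, of "i + mdim X"]])
      (auto simp: prod_coord_def)
  then show "\<exists>V \<psi> A. (V, \<psi>) \<in> mcharts Y \<and> snd p \<in> V \<and> openin (mtop (prod_manifold X Y)) A \<and> p \<in> A \<and>
        (\<forall>i<mdim Y. smooth_real (prod_manifold X Y) A (\<lambda>p. \<psi> (snd p) i))"
    using UV mchart_openin[OF smooth_structure_prod m] by (metis mem_Times_iff)
qed (simp add: continuous_map_snd)

lemma smooth_map_pair:
  assumes Z: "smooth_structure Z" and f: "smooth_map Z X f" and g: "smooth_map Z Y g"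
  shows "smooth_map Z (prod_manifold X Y) (\<lambda>z. (f z, g z))"
proof (rule smooth_mapI[OF Z smooth_structure_prod])
  note cf = smooth_map_continuous[OF Z X f] and cg = smooth_map_continuous[OF Z Y g]
  show "continuous_map (mtop Z) (mtop (prod_manifold X Y)) (\<lambda>z. (f z, g z))"
    using cf cg by (simp add: continuous_map_pairedI)
  fix p assume p: "p \<in> mpoints Z"
  then have "f p \<in> mpoints X" "g p \<in> mpoints Y" using cf cg by (auto simp: continuous_map_def)
  then obtain U \<phi> V \<psi> where UV: "(U, \<phi>) \<in> mcharts X" "f p \<in> U" "(V, \<psi>) \<in> mcharts Y" "g p \<in> V"
    using mcharts_cover[OF X] mcharts_cover[OF Y] by blast
  let ?A1 = "{p \<in> mpoints Z. f p \<in> U}" and ?A2 = "{p \<in> mpoints Z. g p \<in> V}"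
  note OU = mchart_openin[OF X UV(1)] and OV = mchart_openin[OF Y UV(3)]
  have A1: "openin (mtop Z) ?A1" by (rule openin_continuous_map_preimage[OF cf OU])
  have A2: "openin (mtop Z) ?A2" by (rule openin_continuous_map_preimage[OF cg OV])
  have A: "openin (mtop Z) (?A1 \<inter> ?A2)" using A1 A2 by (rule openin_Int)
  have 1: "smooth_real Z (?A1 \<inter> ?A2) (\<lambda>p. \<phi> (f p) i)" for i
    by (rule smooth_real_subset[OF Z smooth_map_real[OF Z X f OU smooth_real_coord[OF X UV(1)]] A]) auto
  have 2: "smooth_real Z (?A1 \<inter> ?A2) (\<lambda>p. \<psi> (g p) i)" for i
    by (rule smooth_real_subset[OF Z smooth_map_real[OF Z Y g OV smooth_real_coord[OF Y UV(3)]] A]) auto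
  have "smooth_real Z (?A1 \<inter> ?A2) (\<lambda>p. prod_coord (mdim X) \<phi> \<psi> (f p, g p) i)" for i
    using 1[of i] 2[of "i - mdim X"] by (cases "i < mdim X") (simp_all add: prod_coord_def)
  then show "\<exists>V \<psi> A. (V, \<psi>) \<in> mcharts (prod_manifold X Y) \<and> (f p, g p) \<in> V \<and> openin (mtop Z) A \<and> p \<in> A \<and>
        (\<forall>i<mdim (prod_manifold X Y). smooth_real Z A (\<lambda>p. \<psi> (f p, g p) i))"
    using prod_chart_mem[OF UV(1,3)] UV A p by blast
qed

end

section \<open>Euclidean spaces as manifolds, and pullbacks of functions\<close>

lemma is_chart_euclidean: "is_chart m (Euclidean_space m) (Rn m, \<lambda>x. x)"
  using homeomorphic_map_id[of "Euclidean_space m"] by (simp add: is_chart_iff id_def)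

lemma inv_into_id: "y \<in> W \<Longrightarrow> inv_into W (\<lambda>x. x) y = y"
  by (metis f_inv_into_f image_ident)

lemma atlas_euclidean: "atlas m (Euclidean_space m) {(Rn m, \<lambda>x. x)}"
proof -
  have "smooth_fun_on m (Rn m) (\<lambda>y. inv_into (Rn m) (\<lambda>x. x) y i)" for i
    by (rule smooth_fun_on_cong[OF openin_topspace _ smooth_fun_on_coord[OF openin_topspace]])
      (simp add: inv_into_id)
  then show ?thesis
    using is_chart_euclidean by (simp add: atlas_def compatible_charts_def smooth_transition_def)
qed

lemma smooth_structure_euclidean: "smooth_structure (euclidean_manifold m)"
  unfolding euclidean_manifold_def by (rule smooth_structure_maximal_atlas[OF atlas_euclidean])

lemma euclidean_manifold_sel [simp]:
  "mdim (euclidean_manifold m) = m" "mtop (euclidean_manifold m) = Euclidean_space m"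
  by (simp_all add: euclidean_manifold_def)

lemma euclidean_chart: "(Rn m, \<lambda>x. x) \<in> mcharts (euclidean_manifold m)"
  using maximal_atlas_structure(3)[OF atlas_euclidean, of m] by (simp add: euclidean_manifold_def)

lemma smooth_real_euclideanD:
  assumes "openin (Euclidean_space m) A" "smooth_real (euclidean_manifold m) A f"
  shows "smooth_fun_on m A f"
proof -
  note E = smooth_structure_euclidean
  have "smooth_fun_on (mdim (euclidean_manifold m)) ((\<lambda>x. x) ` A) (\<lambda>y. f (inv_into (Rn m) (\<lambda>x. x) y))"
    by (rule smooth_realD[OF E assms(2) euclidean_chart]) (use assms(1) openin_subset in auto)
  then have "smooth_fun_on m A (\<lambda>y. f (inv_into (Rn m) (\<lambda>x. x) y))" by simp
  then show ?thesis
    by (rule smooth_fun_on_cong[OF assms(1), rotated]) (use openin_subset[OF assms(1)] in \<open>auto simp: inv_into_id\<close>)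
qed

lemma smooth_real_euclideanI:
  assumes A: "openin (Euclidean_space m) A" and f: "smooth_fun_on m A f"
  shows "smooth_real (euclidean_manifold m) A f"
proof -
  note E = smooth_structure_euclidean
  have c: "(A, \<lambda>x. x) \<in> mcharts (euclidean_manifold m)"
    by (rule mcharts_restrict[OF E euclidean_chart]) (use A openin_subset in auto)
  show ?thesis
    by (rule smooth_real_chart_fun[OF E c, of f]) (simp add: f)
qed

lemma smooth_map_euclideanI:
  assumes N: "smooth_structure N" and g: "\<And>p. p \<in> mpoints N \<Longrightarrow> g p \<in> Rn m"
    "\<And>i. i < m \<Longrightarrow> smooth_real N (mpoints N) (\<lambda>p. g p i)"
  shows "smooth_map N (euclidean_manifold m) g"
proof (rule smooth_mapI[OF N smooth_structure_euclidean])
  show "continuous_map (mtop N) (mtop (euclidean_manifold m)) g"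
    using smooth_real_continuous[OF N openin_topspace g(2)] g(1)
    by (auto intro!: continuous_map_into_Euclidean)
  fix p assume "p \<in> mpoints N"
  then show "\<exists>V \<psi> A. (V, \<psi>) \<in> mcharts (euclidean_manifold m) \<and> g p \<in> V \<and> openin (mtop N) A \<and> p \<in> A \<and>
        (\<forall>i<mdim (euclidean_manifold m). smooth_real N A (\<lambda>p. \<psi> (g p) i))"
    using euclidean_chart g by (intro exI[of _ "Rn m"] exI[of _ "\<lambda>x. x"] exI[of _ "mpoints N"]) auto
qed

lemma tuple_map_in_Rn: "tuple_map m s p \<in> Rn m"
  by (simp add: tuple_map_def topspace_Euclidean_space)

lemma pullback_eq: "pullback N f F = (\<lambda>x\<in>mpoints N. F (f x))"
  by (simp add: pullback_def compose_def)

lemma smooth_functions_pullback: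
  assumes N: "smooth_structure N" "smooth_structure N'" and f: "smooth_map N N' f" and F: "F \<in> smooth_functions N'"
  shows "pullback N f F \<in> smooth_functions N"
  unfolding pullback_eq
proof (rule smooth_functionsI[OF N(1)])
  have "smooth_real N' (mpoints N') F" using F by (simp add: smooth_functions_iff[OF N(2)])
  from smooth_map_real[OF N f openin_topspace this]
  have "smooth_real N {p \<in> mpoints N. f p \<in> mpoints N'} (\<lambda>p. F (f p))" .
  moreover have "{p \<in> mpoints N. f p \<in> mpoints N'} = mpoints N"
    using smooth_map_continuous[OF N f] by (auto simp: continuous_map_def)
  ultimately show "smooth_real N (mpoints N) (\<lambda>p. F (f p))" by simp
qed


section \<open>The orbit manifold of a free proper action\<close>

lemma open_submanifold_sel [simp]:
  "mdim (open_submanifold N A) = mdim N" "mtop (open_submanifold N A) = subtopology (mtop N) A"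
  by (simp_all add: open_submanifold_def)

lemma mcharts_open_submanifold:
  "(V, \<psi>) \<in> mcharts (open_submanifold N A) \<longleftrightarrow> (V, \<psi>) \<in> mcharts N \<and> V \<subseteq> A"
  by (simp add: open_submanifold_def)

lemma smooth_map_restrict:
  assumes N: "smooth_structure N" and N': "smooth_structure N'" and f: "smooth_map N N' f"
    and A: "openin (mtop N) A" and B: "openin (mtop N') B" and AB: "f ` A \<subseteq> B"
  shows "smooth_map (open_submanifold N A) (open_submanifold N' B) f"
proof (rule smooth_mapI[OF smooth_structure_open_submanifold[OF N A] smooth_structure_open_submanifold[OF N' B]])
  note cf = smooth_map_continuous[OF N N' f]
  show "continuous_map (mtop (open_submanifold N A)) (mtop (open_submanifold N' B)) f"
    using continuous_map_from_subtopology[OF cf, of A] AB by (auto simp: continuous_map_in_subtopology)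
  fix p assume "p \<in> mpoints (open_submanifold N A)"
  then have p: "p \<in> A" "f p \<in> B" using AB by auto
  from mcharts_at[OF N' B p(2)] obtain V \<psi> where V: "(V, \<psi>) \<in> mcharts N'" "f p \<in> V" "V \<subseteq> B" .
  let ?A = "{x \<in> A. f x \<in> V}"
  have O: "openin (mtop N) ?A" by (rule openin_continuous_map_preimage_gen[OF cf A mchart_openin[OF N' V(1)]])
  have "smooth_real N ?A (\<lambda>x. \<psi> (f x) i)" for i
    by (rule smooth_real_subset[OF N smooth_map_real[OF N N' f mchart_openin[OF N' V(1)] smooth_real_coord[OF N' V(1)]] O])
      (use openin_subset[OF A] in auto)
  then have "smooth_real (open_submanifold N A) ?A (\<lambda>x. \<psi> (f x) i)" for i
    by (subst smooth_real_open_submanifold) auto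
  moreover have "openin (mtop (open_submanifold N A)) ?A" using O A by (simp add: openin_open_subtopology)
  ultimately show "\<exists>V \<psi> A'. (V, \<psi>) \<in> mcharts (open_submanifold N' B) \<and> f p \<in> V \<and> openin (mtop (open_submanifold N A)) A' \<and> p \<in> A' \<and>
        (\<forall>i<mdim (open_submanifold N' B). smooth_real (open_submanifold N A) A' (\<lambda>p. \<psi> (f p) i))"
    using V p by (intro exI[of _ V] exI[of _ \<psi>] exI[of _ ?A]) (auto simp: mcharts_open_submanifold)
qed

section \<open>The action and its orbit projection\<close>

locale free_proper_action =
  fixes G :: "('g, 'b) monoid_scheme" (structure)
    and \<alpha> :: "'g \<Rightarrow> 'a \<Rightarrow> 'a"
    and M :: "'a manifold"
  assumes manifold: "smooth_manifold M"
    and smooth: "smooth_action G \<alpha> M"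
    and free: "free_action G \<alpha> M"
    and proper: "proper_action G \<alpha> M"
begin

abbreviation "\<pi> \<equiv> orbit G \<alpha>"
abbreviation "TQ \<equiv> orbit_topology G \<alpha> M"

lemma M: "smooth_structure M" and Hausdorff_M: "Hausdorff_space (mtop M)"
  and second_countable_M: "second_countable (mtop M)"
  using manifold by (auto simp: smooth_manifold_iff)

lemma action: "group_action G (mpoints M) \<alpha>"
  using smooth by (simp add: smooth_action_def)

lemma group_G: "group G"
  using action by (simp add: group_action_def group_hom_def)

lemma act_smooth: "g \<in> carrier G \<Longrightarrow> smooth_map M M (\<alpha> g)"
  using smooth by (simp add: smooth_action_def)

lemma act_closed: "g \<in> carrier G \<Longrightarrow> p \<in> mpoints M \<Longrightarrow> \<alpha> g p \<in> mpoints M"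
  using group_action.element_image[OF action] by blast

lemma act_mult: "p \<in> mpoints M \<Longrightarrow> g \<in> carrier G \<Longrightarrow> h \<in> carrier G \<Longrightarrow> \<alpha> (g \<otimes> h) p = \<alpha> g (\<alpha> h p)"
  by (rule group_action.composition_rule[OF action])

lemma act_inv: "g \<in> carrier G \<Longrightarrow> p \<in> mpoints M \<Longrightarrow> \<alpha> (inv g) (\<alpha> g p) = p"
  using group_action.orbit_sym_aux[OF action] by blast

lemma inv_closed: "g \<in> carrier G \<Longrightarrow> inv g \<in> carrier G"
  using group.inv_closed[OF group_G] .

lemma act_inv': "g \<in> carrier G \<Longrightarrow> p \<in> mpoints M \<Longrightarrow> \<alpha> g (\<alpha> (inv g) p) = p"
  using act_inv[OF inv_closed] group.inv_inv[OF group_G] by metis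

lemma act_one: "p \<in> mpoints M \<Longrightarrow> \<alpha> \<one> p = p"
  using group_action.id_eq_one[OF action] by (metis restrict_apply')

lemma act_free: "g \<in> carrier G \<Longrightarrow> p \<in> mpoints M \<Longrightarrow> \<alpha> g p = p \<Longrightarrow> g = \<one>"
  using free unfolding free_action_def by blast

lemma orbit_act:
  assumes "g \<in> carrier G" "p \<in> mpoints M"
  shows "\<pi> (\<alpha> g p) = \<pi> p"
proof -
  have "\<alpha> g p \<in> \<pi> p" using assms by (auto simp: orbit_def)
  have q: "\<alpha> g p \<in> mpoints M" by (rule act_closed[OF assms])
  show ?thesis
  proof (rule subset_antisym; rule subsetI)
    fix x assume "x \<in> \<pi> (\<alpha> g p)"
    then obtain h where h: "h \<in> carrier G" "x = \<alpha> h (\<alpha> g p)" by (auto simp: orbit_def)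
    then have "x = \<alpha> (h \<otimes> g) p" using act_mult assms by simp
    moreover have "h \<otimes> g \<in> carrier G" using group_G h assms by (simp add: group.is_monoid monoid.m_closed)
    ultimately show "x \<in> \<pi> p" by (auto simp: orbit_def)
  next
    fix x assume "x \<in> \<pi> p"
    then obtain h where h: "h \<in> carrier G" "x = \<alpha> h p" by (auto simp: orbit_def)
    then have "x = \<alpha> (h \<otimes> inv g) (\<alpha> g p)" using act_mult[OF q h(1) inv_closed] act_inv assms by simp
    moreover have "h \<otimes> inv g \<in> carrier G"
      using group_G h assms inv_closed by (simp add: group.is_monoid monoid.m_closed)
    ultimately show "x \<in> \<pi> (\<alpha> g p)" by (auto simp: orbit_def)
  qed
qed

lemma orbit_eqE:
  assumes "p \<in> mpoints M" "q \<in> mpoints M" "\<pi> p = \<pi> q"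
  obtains g where "g \<in> carrier G" "q = \<alpha> g p"
proof -
  have "q \<in> \<pi> p" using group_action.orbit_refl[OF action assms(2)] assms(3) by simp
  then show thesis using that by (auto simp: orbit_def)
qed

lemma act_continuous: "g \<in> carrier G \<Longrightarrow> continuous_map (mtop M) (mtop M) (\<alpha> g)"
  by (rule smooth_map_continuous[OF M M act_smooth])

lemma act_image_eq:
  assumes "g \<in> carrier G" "B \<subseteq> mpoints M"
  shows "\<alpha> g ` B = {p \<in> mpoints M. \<alpha> (inv g) p \<in> B}"
proof (rule subset_antisym; rule subsetI)
  fix p assume "p \<in> \<alpha> g ` B"
  then show "p \<in> {p \<in> mpoints M. \<alpha> (inv g) p \<in> B}" using assms act_closed act_inv by auto
next
  fix p assume "p \<in> {p \<in> mpoints M. \<alpha> (inv g) p \<in> B}"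
  then show "p \<in> \<alpha> g ` B" using act_inv'[OF assms(1), of p] by (metis (no_types, lifting) imageI mem_Collect_eq)
qed

lemma act_open:
  assumes g: "g \<in> carrier G" and B: "openin (mtop M) B"
  shows "openin (mtop M) (\<alpha> g ` B)"
  unfolding act_image_eq[OF g openin_subset[OF B]]
  by (rule openin_continuous_map_preimage[OF act_continuous[OF inv_closed[OF g]] B])

lemma points_Q: "topspace TQ = \<pi> ` mpoints M"
  by (simp add: orbit_topology_def)

lemma orbit_continuous: "continuous_map (mtop M) TQ \<pi>"
  unfolding orbit_topology_def by (rule quotient_imp_continuous_map[OF quotient_map_quotient_topology])

text \<open>The saturation of B is a union of translates. For open B these are open, which makes the
  orbit projection an open map.\<close>

lemma orbit_preimage:
  assumes "B \<subseteq> mpoints M"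
  shows "{p \<in> mpoints M. \<pi> p \<in> \<pi> ` B} = (\<Union>g\<in>carrier G. \<alpha> g ` B)"
proof (rule subset_antisym; rule subsetI)
  fix p assume "p \<in> {p \<in> mpoints M. \<pi> p \<in> \<pi> ` B}"
  then obtain q where q: "p \<in> mpoints M" "q \<in> B" "\<pi> q = \<pi> p" by force
  then obtain g where "g \<in> carrier G" "p = \<alpha> g q" using orbit_eqE[of q p] assms by blast
  then show "p \<in> (\<Union>g\<in>carrier G. \<alpha> g ` B)" using q by blast
next
  fix p assume "p \<in> (\<Union>g\<in>carrier G. \<alpha> g ` B)"
  then obtain g q where q: "g \<in> carrier G" "q \<in> B" "p = \<alpha> g q" by blast
  then have "q \<in> mpoints M" using assms by blast
  then show "p \<in> {p \<in> mpoints M. \<pi> p \<in> \<pi> ` B}" using q act_closed orbit_act by auto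
qed

lemma orbit_open:
  assumes B: "openin (mtop M) B"
  shows "openin TQ (\<pi> ` B)"
proof -
  have "openin (mtop M) (\<Union>g\<in>carrier G. \<alpha> g ` B)" using act_open[OF _ B] by blast
  then show ?thesis
    unfolding orbit_topology_def openin_quotient_topology orbit_preimage[OF openin_subset[OF B]]
    using openin_subset[OF B] by blast
qed

text \<open>Proper maps are closed, and S times M is closed for any S because G is discrete. Leaving
  the unit out of S separates the diagonal from the nontrivial translations; S = G gives the whole
  orbit relation.\<close>

lemma act_graph_closed:
  assumes "S \<subseteq> carrier G"
  shows "closedin (prod_topology (mtop M) (mtop M)) ((\<lambda>(g, p). (\<alpha> g p, p)) ` (S \<times> mpoints M))"
proof -
  have "closed_map (prod_topology (discrete_topology (carrier G)) (mtop M))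
       (prod_topology (mtop M) (mtop M)) (\<lambda>(g, p). (\<alpha> g p, p))"
    using proper unfolding proper_action_def proper_map_def by blast
  moreover have "closedin (prod_topology (discrete_topology (carrier G)) (mtop M)) (S \<times> mpoints M)"
    using assms by (simp add: closedin_prod_Times_iff)
  ultimately show ?thesis unfolding closed_map_def by blast
qed

lemma open_rectangle:
  assumes C: "closedin (prod_topology T T') C" and p: "p \<in> topspace T" "q \<in> topspace T'" "(p, q) \<notin> C"
  obtains A B where "openin T A" "openin T' B" "p \<in> A" "q \<in> B" "(A \<times> B) \<inter> C = {}"
proof -
  let ?S = "topspace (prod_topology T T') - C"
  have o: "openin (prod_topology T T') ?S" using C by blast
  have m: "(p, q) \<in> ?S" using p by simp
  have "\<exists>A B. openin T A \<and> openin T' B \<and> p \<in> A \<and> q \<in> B \<and> A \<times> B \<subseteq> ?S"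
    by (rule openin_prod_topology_alt[THEN iffD1, rule_format, OF o m])
  then show thesis by (elim exE conjE) (rule that, auto)
qed

text \<open>
  By freeness the diagonal misses the graph of the nontrivial group elements, which is closed by
  properness; so every point has a neighbourhood disjoint from its nontrivial translates.
\<close>

lemma small_neighbourhood:
  assumes p: "p \<in> mpoints M"
  obtains B where "openin (mtop M) B" "p \<in> B" "inj_on \<pi> B"
proof -
  let ?C = "(\<lambda>(g, p). (\<alpha> g p, p)) ` ((carrier G - {\<one>}) \<times> mpoints M)"
  have C: "closedin (prod_topology (mtop M) (mtop M)) ?C" by (rule act_graph_closed) auto
  have "(p, p) \<notin> ?C" using act_free by auto
  from open_rectangle[OF C p p this] obtain A B where AB: "openin (mtop M) A" "openin (mtop M) B" "p \<in> A" "p \<in> B"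
    "(A \<times> B) \<inter> ?C = {}" .
  have "inj_on \<pi> (A \<inter> B)"
  proof (rule inj_onI)
    fix x y assume xy: "x \<in> A \<inter> B" "y \<in> A \<inter> B" "\<pi> x = \<pi> y"
    then have "x \<in> mpoints M" "y \<in> mpoints M" using openin_subset[OF AB(1)] by blast+
    then obtain g where g: "g \<in> carrier G" "y = \<alpha> g x" using orbit_eqE xy(3) by blast
    have "g = \<one>"
    proof (rule ccontr)
      assume "g \<noteq> \<one>"
      then have "(\<alpha> g x, x) \<in> ?C" using g(1) \<open>x \<in> mpoints M\<close> by force
      then show False using AB(5) xy g by blast
    qed
    then show "x = y" using g act_one \<open>x \<in> mpoints M\<close> by simp
  qed
  then show thesis using that[of "A \<inter> B"] AB by blast
qed

lemma small_chart:
  assumes "openin (mtop M) A" "p \<in> A"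
  obtains U \<phi> where "(U, \<phi>) \<in> mcharts M" "p \<in> U" "U \<subseteq> A" "inj_on \<pi> U"
proof -
  have "p \<in> mpoints M" using assms openin_subset by blast
  then obtain B where B: "openin (mtop M) B" "p \<in> B" "inj_on \<pi> B" by (rule small_neighbourhood)
  have "openin (mtop M) (A \<inter> B)" "p \<in> A \<inter> B" using assms B by auto
  from mcharts_at[OF M this] obtain U \<phi> where "(U, \<phi>) \<in> mcharts M" "p \<in> U" "U \<subseteq> A \<inter> B" .
  then show thesis using that inj_on_subset[OF B(3)] by blast
qed

text \<open>The orbit relation is closed in M \<times> M, being the graph taken over the whole
  group. A product neighbourhood of (p, q) that misses it projects to two disjoint sets, open
  because the projection is open.\<close>

lemma Hausdorff_Q: "Hausdorff_space TQ"
  unfolding Hausdorff_space_def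
proof (intro allI impI)
  fix b c assume bc: "b \<in> topspace TQ \<and> c \<in> topspace TQ \<and> b \<noteq> c"
  then obtain p q where pq: "p \<in> mpoints M" "b = \<pi> p" "q \<in> mpoints M" "c = \<pi> q" unfolding points_Q by blast
  let ?C = "(\<lambda>(g, p). (\<alpha> g p, p)) ` (carrier G \<times> mpoints M)"
  have C: "closedin (prod_topology (mtop M) (mtop M)) ?C" by (rule act_graph_closed) auto
  have "(p, q) \<notin> ?C" using bc pq orbit_act by auto
  from open_rectangle[OF C pq(1,3) this] obtain A B where AB: "openin (mtop M) A" "openin (mtop M) B" "p \<in> A" "q \<in> B"
    "(A \<times> B) \<inter> ?C = {}" .
  have "disjnt (\<pi> ` A) (\<pi> ` B)"
  proof (rule ccontr)
    assume "\<not> disjnt (\<pi> ` A) (\<pi> ` B)"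
    then obtain x y where xy: "x \<in> A" "y \<in> B" "\<pi> y = \<pi> x" unfolding disjnt_def by force
    then have m: "x \<in> mpoints M" "y \<in> mpoints M" using AB openin_subset by blast+
    then obtain g where "g \<in> carrier G" "x = \<alpha> g y" using orbit_eqE xy(3) by blast
    then have "(x, y) \<in> ?C" using m by force
    then show False using AB(5) xy by blast
  qed
  then show "\<exists>U V. openin TQ U \<and> openin TQ V \<and> b \<in> U \<and> c \<in> V \<and> disjnt U V"
    using orbit_open[OF AB(1)] orbit_open[OF AB(2)] AB(3,4) pq by blast
qed

lemma second_countable_Q: "second_countable TQ"
proof (rule second_countable_open_map_image[OF orbit_continuous _ _ second_countable_M])
  show "open_map (mtop M) TQ \<pi>" unfolding open_map_def using orbit_open by blast
  show "\<pi> ` mpoints M = topspace TQ" by (simp add: points_Q)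
qed

lemma orbit_homeo:
  assumes B: "openin (mtop M) B" and inj: "inj_on \<pi> B"
  shows "homeomorphic_map (subtopology (mtop M) B) (subtopology TQ (\<pi> ` B)) \<pi>"
proof (rule bijective_open_imp_homeomorphic_map)
  have t: "topspace (subtopology (mtop M) B) = B" using openin_subset[OF B] by (simp add: inf_absorb2)
  have t': "topspace (subtopology TQ (\<pi> ` B)) = \<pi> ` B"
    using openin_subset[OF orbit_open[OF B]] by (simp add: inf_absorb2)
  show "continuous_map (subtopology (mtop M) B) (subtopology TQ (\<pi> ` B)) \<pi>"
    using continuous_map_from_subtopology[OF orbit_continuous, of B] by (auto simp: continuous_map_in_subtopology)
  show "open_map (subtopology (mtop M) B) (subtopology TQ (\<pi> ` B)) \<pi>"
    unfolding open_map_def using orbit_open B orbit_open[OF B] by (auto simp: openin_open_subtopology)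
  show "\<pi> ` topspace (subtopology (mtop M) B) = topspace (subtopology TQ (\<pi> ` B))" using t t' by simp
  show "inj_on \<pi> (topspace (subtopology (mtop M) B))" using t inj by simp
qed

lemma section_homeo:
  assumes B: "openin (mtop M) B" and inj: "inj_on \<pi> B"
  shows "homeomorphic_map (subtopology TQ (\<pi> ` B)) (subtopology (mtop M) B) (inv_into B \<pi>)"
proof -
  have t: "topspace (subtopology (mtop M) B) = B" using openin_subset[OF B] by (simp add: inf_absorb2)
  show ?thesis using homeomorphic_map_inv_into[OF orbit_homeo[OF B inj]] unfolding t .
qed

section \<open>The smooth structure of the orbit space\<close>

abbreviation quotient_coord :: "'a set \<Rightarrow> ('a \<Rightarrow> nat \<Rightarrow> real) \<Rightarrow> 'a set \<Rightarrow> nat \<Rightarrow> real" where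
  "quotient_coord U \<phi> \<equiv> \<phi> \<circ> inv_into U \<pi>"

definition quotient_atlas :: "'a set chart set" where
  "quotient_atlas = {(\<pi> ` U, quotient_coord U \<phi>) | U \<phi>. (U, \<phi>) \<in> mcharts M \<and> inj_on \<pi> U}"

text \<open>An explicit candidate for \<open>quotient_manifold\<close>, which is a definite
  description; \<open>quotient_manifold_eq\<close> shows that they agree.\<close>

definition Q :: "'a set manifold" where
  "Q = \<lparr>mdim = mdim M, mtop = TQ, mcharts = maximal_atlas (mdim M) TQ quotient_atlas\<rparr>"

context
  fixes U \<phi>
  assumes U: "(U, \<phi>) \<in> mcharts M" and inj: "inj_on \<pi> U"
begin

lemma quotient_coord_image: "B \<subseteq> U \<Longrightarrow> quotient_coord U \<phi> ` (\<pi> ` B) = \<phi> ` B"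
  using inj by (force simp: inv_into_f_f inj_on_subset subset_iff image_image intro!: image_cong)

lemma quotient_chart_is_chart: "is_chart (mdim M) TQ (\<pi> ` U, quotient_coord U \<phi>)"
proof -
  note C = mcharts_is_chart[OF M U]
  have "homeomorphic_map (subtopology TQ (\<pi> ` U)) (subtopology (Euclidean_space (mdim M)) (\<phi> ` U)) (quotient_coord U \<phi>)"
    by (rule homeomorphic_map_compose[OF section_homeo[OF chart_openin[OF C] inj] chart_homeo[OF C]])
  then show ?thesis
    unfolding is_chart_iff quotient_coord_image[OF order.refl]
    using orbit_open[OF chart_openin[OF C]] chart_open_range[OF C] by blast
qed

lemma quotient_coord_inv:
  assumes "y \<in> \<phi> ` U"
  shows "inv_into (\<pi> ` U) (quotient_coord U \<phi>) y = \<pi> (inv_into U \<phi> y)"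
proof -
  obtain p where p: "p \<in> U" "y = \<phi> p" using assms by blast
  then have "quotient_coord U \<phi> (\<pi> p) = y" using inj by (simp add: inv_into_f_f)
  then show ?thesis
    using chart_inv[OF quotient_chart_is_chart, of "\<pi> p"] p mchart_inv[OF M U, of p] by simp
qed

text \<open>Near q, projecting and returning by the section over U is the action of one fixed group
  element, an element that carries q into U. Through this the smoothness of the action reaches the
  section.\<close>

lemma section_translate:
  assumes q: "q \<in> mpoints M" "\<pi> q \<in> \<pi> ` U"
  obtains g B where "g \<in> carrier G" "openin (mtop M) B" "q \<in> B" "B \<subseteq> {x \<in> mpoints M. \<pi> x \<in> \<pi> ` U}"
    "\<forall>x\<in>B. inv_into U \<pi> (\<pi> x) = \<alpha> g x \<and> \<alpha> g x \<in> U"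
proof -
  note O = mchart_openin[OF M U]
  obtain p where p: "p \<in> U" "\<pi> p = \<pi> q" using q by force
  then have "p \<in> mpoints M" using openin_subset[OF O] by blast
  then obtain g where g: "g \<in> carrier G" "p = \<alpha> g q" using orbit_eqE[OF q(1)] p(2) by metis
  let ?B = "{x \<in> mpoints M. \<alpha> g x \<in> U}"
  have s: "inv_into U \<pi> (\<pi> x) = \<alpha> g x" "\<pi> x \<in> \<pi> ` U" if "x \<in> ?B" for x
  proof -
    have "\<pi> x = \<pi> (\<alpha> g x)" using orbit_act[OF g(1)] that by simp
    then show "inv_into U \<pi> (\<pi> x) = \<alpha> g x" "\<pi> x \<in> \<pi> ` U" using that inv_into_f_f[OF inj] by auto
  qed
  show thesis
    by (rule that[OF g(1) openin_continuous_map_preimage[OF act_continuous[OF g(1)] O]]) (use s p g q in auto)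
qed

lemma smooth_real_section:
  assumes f: "smooth_real M U f"
  shows "smooth_real M {x \<in> mpoints M. \<pi> x \<in> \<pi> ` U} (\<lambda>x. f (inv_into U \<pi> (\<pi> x)))"
proof (rule smooth_real_local[OF M])
  fix q assume "q \<in> {x \<in> mpoints M. \<pi> x \<in> \<pi> ` U}"
  then have "q \<in> mpoints M" "\<pi> q \<in> \<pi> ` U" by auto
  from section_translate[OF this] obtain g B where gB: "g \<in> carrier G" "openin (mtop M) B" "q \<in> B"
    "B \<subseteq> {x \<in> mpoints M. \<pi> x \<in> \<pi> ` U}"
    "\<forall>x\<in>B. inv_into U \<pi> (\<pi> x) = \<alpha> g x \<and> \<alpha> g x \<in> U" .
  have "smooth_real M B (\<lambda>x. f (\<alpha> g x))"
    by (rule smooth_real_subset[OF M smooth_map_real[OF M M act_smooth[OF gB(1)] mchart_openin[OF M U] f] gB(2)])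
      (use gB openin_subset[OF gB(2)] in auto)
  then have "smooth_real M B (\<lambda>x. f (inv_into U \<pi> (\<pi> x)))"
    by (rule smooth_real_cong[OF M, rotated]) (use gB(5) in simp)
  then show "\<exists>B. q \<in> B \<and> B \<subseteq> {x \<in> mpoints M. \<pi> x \<in> \<pi> ` U} \<and> smooth_real M B (\<lambda>x. f (inv_into U \<pi> (\<pi> x)))"
    using gB by blast
qed

end

text \<open>A transition between quotient charts is locally a coordinate change of M with a
  translation by a group element in between.\<close>

lemma quotient_transition:
  assumes U: "(U, \<phi>) \<in> mcharts M" "inj_on \<pi> U" and V: "(V, \<psi>) \<in> mcharts M" "inj_on \<pi> V"
  shows "smooth_transition (mdim M) (\<pi> ` U, quotient_coord U \<phi>) (\<pi> ` V, quotient_coord V \<psi>)"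
  unfolding smooth_transition_def prod.case
proof (intro allI impI)
  fix i assume i: "i < mdim M"
  let ?B = "{x \<in> U. \<pi> x \<in> \<pi> ` V}"
  have "\<pi> ` U \<inter> \<pi> ` V = \<pi> ` ?B" by blast
  then have im: "quotient_coord U \<phi> ` (\<pi> ` U \<inter> \<pi> ` V) = \<phi> ` ?B"
    using quotient_coord_image[OF U, of ?B] by auto
  have B: "openin (mtop M) ?B"
    by (rule openin_continuous_map_preimage_gen[OF orbit_continuous mchart_openin[OF M U(1)] orbit_open[OF mchart_openin[OF M V(1)]]])
  have "smooth_fun_on (mdim M) (\<phi> ` ?B) (\<lambda>y. \<psi> (inv_into V \<pi> (\<pi> (inv_into U \<phi> y))) i)"
    by (rule smooth_realD[OF M smooth_real_section[OF V smooth_real_coord[OF M V(1)]] U(1) B])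
      (use openin_subset[OF B] in auto)
  then show "smooth_fun_on (mdim M) (quotient_coord U \<phi> ` (\<pi> ` U \<inter> \<pi> ` V))
      (\<lambda>y. quotient_coord V \<psi> (inv_into (\<pi> ` U) (quotient_coord U \<phi>) y) i)"
    unfolding im
    by (rule smooth_fun_on_cong[OF mchart_open_image[OF M U(1) B], rotated -1])
      (use quotient_coord_inv[OF U] in auto)
qed

lemma atlas_quotient: "atlas (mdim M) TQ quotient_atlas"
  unfolding atlas_def
proof (intro conjI ballI)
  show "is_chart (mdim M) TQ c" if "c \<in> quotient_atlas" for c
    using that quotient_chart_is_chart unfolding quotient_atlas_def by auto
  show "compatible_charts (mdim M) c d" if "c \<in> quotient_atlas" "d \<in> quotient_atlas" for c d
    using that quotient_transition unfolding quotient_atlas_def compatible_charts_def by auto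
  show "(\<Union>(U, \<phi>)\<in>quotient_atlas. U) = topspace TQ"
  proof (rule subset_antisym; rule subsetI)
    fix b assume "b \<in> (\<Union>(U, \<phi>)\<in>quotient_atlas. U)"
    then obtain U \<phi> where "(U, \<phi>) \<in> mcharts M" "b \<in> \<pi> ` U" unfolding quotient_atlas_def by auto
    then show "b \<in> topspace TQ" unfolding points_Q using mchart_subset_points[OF M] by blast
  next
    fix b assume "b \<in> topspace TQ"
    then obtain p where p: "p \<in> mpoints M" "b = \<pi> p" unfolding points_Q by blast
    obtain U \<phi> where "(U, \<phi>) \<in> mcharts M" "p \<in> U" "inj_on \<pi> U"
      using small_chart[OF openin_topspace p(1)] .
    then have "(\<pi> ` U, quotient_coord U \<phi>) \<in> quotient_atlas" "b \<in> \<pi> ` U"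
      using p(2) unfolding quotient_atlas_def by blast+
    then show "b \<in> (\<Union>(U, \<phi>)\<in>quotient_atlas. U)" by blast
  qed
qed

lemma Q_sel [simp]: "mdim Q = mdim M" "mtop Q = TQ"
  by (simp_all add: Q_def)

lemma smooth_structure_Q: "smooth_structure Q"
  unfolding Q_def by (rule smooth_structure_maximal_atlas[OF atlas_quotient])

lemma smooth_manifold_Q: "smooth_manifold Q"
  using smooth_structure_Q Hausdorff_Q second_countable_Q by (simp add: smooth_manifold_iff)

lemma quotient_atlas_subset: "quotient_atlas \<subseteq> mcharts Q"
  unfolding Q_def manifold.simps by (rule maximal_atlas_structure(3)[OF atlas_quotient])

lemma quotient_chart_mem:
  "(U, \<phi>) \<in> mcharts M \<Longrightarrow> inj_on \<pi> U \<Longrightarrow> (\<pi> ` U, quotient_coord U \<phi>) \<in> mcharts Q"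
  using quotient_atlas_subset unfolding quotient_atlas_def by blast

lemma smooth_map_orbit: "smooth_map M Q \<pi>"
proof (rule smooth_mapI[OF M smooth_structure_Q])
  show "continuous_map (mtop M) (mtop Q) \<pi>" using orbit_continuous by simp
  fix p assume p: "p \<in> mpoints M"
  obtain U \<phi> where U: "(U, \<phi>) \<in> mcharts M" "p \<in> U" "inj_on \<pi> U"
    using small_chart[OF openin_topspace p] .
  have "smooth_real M U (\<lambda>x. quotient_coord U \<phi> (\<pi> x) i)" for i
    by (rule smooth_real_cong[OF M _ smooth_real_coord[OF M U(1), of i]]) (use U(3) in \<open>simp add: inv_into_f_f\<close>)
  then show "\<exists>V \<psi> A. (V, \<psi>) \<in> mcharts Q \<and> \<pi> p \<in> V \<and> openin (mtop M) A \<and> p \<in> A \<and>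
        (\<forall>i<mdim Q. smooth_real M A (\<lambda>p. \<psi> (\<pi> p) i))"
    using quotient_chart_mem[OF U(1,3)] U(2) mchart_openin[OF M U(1)] by blast
qed

lemma smooth_real_descend:
  assumes B: "openin (mtop M) B" "inj_on \<pi> B" and f: "smooth_real M B f"
  shows "smooth_real Q (\<pi> ` B) (\<lambda>b. f (inv_into B \<pi> b))"
proof (rule smooth_real_local[OF smooth_structure_Q])
  fix b assume "b \<in> \<pi> ` B"
  then obtain p where p: "p \<in> B" "b = \<pi> p" by blast
  from mcharts_at[OF M B(1) p(1)] obtain U \<phi> where U: "(U, \<phi>) \<in> mcharts M" "p \<in> U" "U \<subseteq> B" .
  have inj: "inj_on \<pi> U" by (rule inj_on_subset[OF B(2) U(3)])
  have "smooth_fun_on (mdim M) (\<phi> ` U) (\<lambda>y. f (inv_into U \<phi> y))"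
    by (rule smooth_realD[OF M f U(1) mchart_openin[OF M U(1)] order.refl U(3)])
  then have "smooth_fun_on (mdim M) (\<phi> ` U) (\<lambda>y. f (inv_into B \<pi> (inv_into (\<pi> ` U) (quotient_coord U \<phi>) y)))"
  proof (rule smooth_fun_on_cong[OF mchart_open_image[OF M U(1) mchart_openin[OF M U(1)] order.refl], rotated])
    fix y assume y: "y \<in> \<phi> ` U"
    then have "inv_into U \<phi> y \<in> B" using U mchart_inv[OF M U(1)] by auto
    then show "f (inv_into U \<phi> y) = f (inv_into B \<pi> (inv_into (\<pi> ` U) (quotient_coord U \<phi>) y))"
      unfolding quotient_coord_inv[OF U(1) inj y] by (simp add: inv_into_f_f[OF B(2)])
  qed
  then have "smooth_real Q (\<pi> ` U) (\<lambda>b. f (inv_into B \<pi> b))"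
    by (intro smooth_real_chartI[OF smooth_structure_Q quotient_chart_mem[OF U(1) inj]])
      (simp only: quotient_coord_image[OF U(1) inj order.refl] Q_sel)
  then show "\<exists>B'. b \<in> B' \<and> B' \<subseteq> \<pi> ` B \<and> smooth_real Q B' (\<lambda>b. f (inv_into B \<pi> b))"
    using U p by blast
qed

lemma diffeomorphism_orbit:
  assumes B: "openin (mtop M) B" and inj: "inj_on \<pi> B"
  shows "diffeomorphism (open_submanifold M B) (open_submanifold Q (\<pi> ` B)) \<pi>"
proof -
  have BM: "B \<subseteq> mpoints M" and V: "openin (mtop Q) (\<pi> ` B)"
    using openin_subset[OF B] orbit_open[OF B] by auto
  have pB: "mpoints (open_submanifold M B) = B" using BM by (simp add: inf_absorb2)
  have pV: "mpoints (open_submanifold Q (\<pi> ` B)) = \<pi> ` B"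
    using openin_subset[OF orbit_open[OF B]] by (simp add: inf_absorb2)
  have "smooth_map (open_submanifold Q (\<pi> ` B)) (open_submanifold M B) (inv_into B \<pi>)"
  proof (rule smooth_mapI[OF smooth_structure_open_submanifold[OF smooth_structure_Q V] smooth_structure_open_submanifold[OF M B]])
    show "continuous_map (mtop (open_submanifold Q (\<pi> ` B))) (mtop (open_submanifold M B)) (inv_into B \<pi>)"
      using homeomorphic_imp_continuous_map[OF section_homeo[OF B inj]] by simp
    fix b assume "b \<in> mpoints (open_submanifold Q (\<pi> ` B))"
    then obtain p where p: "p \<in> B" "b = \<pi> p" unfolding pV by blast
    from mcharts_at[OF M B p(1)] obtain U \<phi> where U: "(U, \<phi>) \<in> mcharts M" "p \<in> U" "U \<subseteq> B" .
    have injU: "inj_on \<pi> U" by (rule inj_on_subset[OF inj U(3)])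
    have eq: "inv_into U \<pi> c = inv_into B \<pi> c" if "c \<in> \<pi> ` U" for c
      using that U(3) by (auto simp: inv_into_f_f[OF injU] inv_into_f_f[OF inj] subset_iff)
    have "smooth_real Q (\<pi> ` U) (\<lambda>c. \<phi> (inv_into B \<pi> c) i)" for i
      by (rule smooth_real_cong[OF smooth_structure_Q _ smooth_real_descend[OF mchart_openin[OF M U(1)] injU smooth_real_coord[OF M U(1)]]])
        (simp add: eq)
    then have "smooth_real (open_submanifold Q (\<pi> ` B)) (\<pi> ` U) (\<lambda>c. \<phi> (inv_into B \<pi> c) i)" for i
      by (subst smooth_real_open_submanifold) (use U in auto)
    moreover have "openin (mtop (open_submanifold Q (\<pi> ` B))) (\<pi> ` U)"
      using orbit_open[OF mchart_openin[OF M U(1)]] orbit_open[OF B] U(3) by (auto simp: openin_open_subtopology)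
    ultimately show "\<exists>V \<psi> A. (V, \<psi>) \<in> mcharts (open_submanifold M B) \<and> inv_into B \<pi> b \<in> V \<and>
        openin (mtop (open_submanifold Q (\<pi> ` B))) A \<and> b \<in> A \<and>
        (\<forall>i<mdim (open_submanifold M B). smooth_real (open_submanifold Q (\<pi> ` B)) A (\<lambda>p. \<psi> (inv_into B \<pi> p) i))"
      using U p inv_into_f_f[OF inj p(1)]
      by (intro exI[of _ U] exI[of _ \<phi>] exI[of _ "\<pi> ` U"]) (auto simp: mcharts_open_submanifold)
  qed
  moreover have "smooth_map (open_submanifold M B) (open_submanifold Q (\<pi> ` B)) \<pi>"
    by (rule smooth_map_restrict[OF M smooth_structure_Q smooth_map_orbit B V order.refl])
  ultimately show ?thesis
    unfolding diffeomorphism_def pB pV using inj by (auto simp: bij_betw_def)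
qed

lemma smooth_covering_map_orbit: "smooth_covering_map M Q \<pi>"
  unfolding smooth_covering_map_def
proof (intro conjI ballI smooth_map_orbit)
  show "\<pi> ` mpoints M = mpoints Q" by (simp add: points_Q)
  fix b assume "b \<in> mpoints Q"
  then obtain p where p: "p \<in> mpoints M" "b = \<pi> p" by (auto simp: points_Q)
  then obtain B where B: "openin (mtop M) B" "p \<in> B" "inj_on \<pi> B" using small_neighbourhood by blast
  have BM: "B \<subseteq> mpoints M" by (rule openin_subset[OF B(1)])
  \<comment> \<open>The sheets over the image of B are the translates of B. Translates by different
    elements are disjoint: this is \<open>same\<close>, from freeness and injectivity of the
    projection on B.\<close>
  let ?\<U> = "(\<lambda>g. \<alpha> g ` B) ` carrier G"
  have same: "g = h" if "g \<in> carrier G" "h \<in> carrier G" "x \<in> B" "y \<in> B" "\<alpha> g x = \<alpha> h y" for g h x y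
  proof -
    have xy: "x \<in> mpoints M" "y \<in> mpoints M" using that BM by auto
    then have "\<pi> x = \<pi> y" using orbit_act that by metis
    then have "x = y" using B(3) that by (auto simp: inj_on_def)
    then have "\<alpha> (inv h \<otimes> g) x = x"
      using that xy act_mult[OF xy(1) inv_closed[OF that(2)] that(1)] act_inv by simp
    then have "inv h \<otimes> g = \<one>"
      using that xy inv_closed group_G by (intro act_free) (auto simp: group.is_monoid monoid.m_closed)
    then show "g = h"
      using group.inv_comm[OF group_G] group.inv_equality[OF group_G] that inv_closed group.inv_inv[OF group_G] by metis
  qed
  have img: "\<pi> ` (\<alpha> g ` B) = \<pi> ` B" if "g \<in> carrier G" for g
    using orbit_act[OF that] BM by (force simp: image_image)
  have injg: "inj_on \<pi> (\<alpha> g ` B)" if g: "g \<in> carrier G" for g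
  proof (rule inj_onI)
    fix x y assume "x \<in> \<alpha> g ` B" "y \<in> \<alpha> g ` B" "\<pi> x = \<pi> y"
    then obtain x' y' where xy: "x = \<alpha> g x'" "x' \<in> B" "y = \<alpha> g y'" "y' \<in> B" by blast
    then have "\<pi> x' = \<pi> y'" using \<open>\<pi> x = \<pi> y\<close> orbit_act[OF g] BM by (metis subsetD)
    then show "x = y" using B(3) xy by (auto simp: inj_on_def)
  qed
  show "\<exists>V. openin (mtop Q) V \<and> b \<in> V \<and>
        (\<exists>\<U>. \<Union>\<U> = {x \<in> mpoints M. \<pi> x \<in> V} \<and> (\<forall>U\<in>\<U>. openin (mtop M) U) \<and>
             pairwise disjnt \<U> \<and>
             (\<forall>U\<in>\<U>. diffeomorphism (open_submanifold M U) (open_submanifold Q V) \<pi>))"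
  proof (rule exI[of _ "\<pi> ` B"], intro conjI exI[of _ ?\<U>] ballI)
    show "openin (mtop Q) (\<pi> ` B)" using orbit_open[OF B(1)] by simp
    show "b \<in> \<pi> ` B" using B p by blast
    show "\<Union>?\<U> = {x \<in> mpoints M. \<pi> x \<in> \<pi> ` B}" using orbit_preimage[OF BM] by simp
    show "openin (mtop M) U" if "U \<in> ?\<U>" for U using that act_open[OF _ B(1)] by blast
    show "pairwise disjnt ?\<U>"
    proof (rule pairwiseI)
      fix U V assume "U \<in> ?\<U>" "V \<in> ?\<U>" "U \<noteq> V"
      then obtain g h where gh: "g \<in> carrier G" "h \<in> carrier G" "U = \<alpha> g ` B" "V = \<alpha> h ` B" by blast
      then have "g \<noteq> h" using \<open>U \<noteq> V\<close> by blast
      then show "disjnt U V" unfolding gh disjnt_def using same[OF gh(1,2)] by force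
    qed
    show "diffeomorphism (open_submanifold M U) (open_submanifold Q (\<pi> ` B)) \<pi>" if U: "U \<in> ?\<U>" for U
    proof -
      obtain g where g: "g \<in> carrier G" "U = \<alpha> g ` B" using U by blast
      show ?thesis
        using diffeomorphism_orbit[OF act_open[OF g(1) B(1)] injg[OF g(1)]] unfolding img[OF g(1)] g(2) .
    qed
  qed
qed

text \<open>The core of uniqueness. In any R for which the projection is a smooth covering map, the
  inverse on a sheet is smooth, and near each point it coincides with the section over U. So the
  coordinates of the quotient charts are smooth for R, and maximality admits these charts.\<close>

lemma quotient_atlas_subset_covering:
  assumes R: "mdim R = mdim M" "mtop R = TQ" "smooth_manifold R" "smooth_covering_map M R \<pi>"
  shows "quotient_atlas \<subseteq> mcharts R"
proof
  have RS: "smooth_structure R" using R(3) by (simp add: smooth_manifold_iff)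
  have sm: "smooth_map M R \<pi>" using R(4) by (simp add: smooth_covering_map_def)
  fix c assume "c \<in> quotient_atlas"
  then obtain U \<phi> where c: "c = (\<pi> ` U, quotient_coord U \<phi>)" and U: "(U, \<phi>) \<in> mcharts M" "inj_on \<pi> U"
    unfolding quotient_atlas_def by blast
  note OU = mchart_openin[OF M U(1)]
  have sec: "smooth_real R (\<pi> ` U) (\<lambda>b. \<phi> (inv_into U \<pi> b) i)" for i
  proof (rule smooth_real_local[OF RS])
    fix b assume "b \<in> \<pi> ` U"
    then obtain p where p: "p \<in> U" "b = \<pi> p" by blast
    then have "p \<in> mpoints M" using openin_subset[OF OU] by blast
    then have "b \<in> mpoints R" using R(2) p points_Q by simp
    from bspec[OF R(4)[unfolded smooth_covering_map_def, THEN conjunct2, THEN conjunct2] this]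
    obtain V \<U> where V: "openin (mtop R) V" "b \<in> V" "\<Union>\<U> = {x \<in> mpoints M. \<pi> x \<in> V}"
      and \<U>: "\<forall>U\<in>\<U>. openin (mtop M) U"
      "\<forall>U\<in>\<U>. diffeomorphism (open_submanifold M U) (open_submanifold R V) \<pi>"
      by (elim exE conjE) (rule that; assumption)
    have "p \<in> \<Union>\<U>" using V(2,3) p \<open>p \<in> mpoints M\<close> by simp
    then obtain W where W: "W \<in> \<U>" "p \<in> W" by blast
    note OW = bspec[OF \<U>(1) W(1)]
    have pW: "mpoints (open_submanifold M W) = W" using openin_subset[OF OW] by (simp add: inf_absorb2)
    have pV: "mpoints (open_submanifold R V) = V" using openin_subset[OF V(1)] by (simp add: inf_absorb2)
    have bij: "bij_betw \<pi> W V" and r: "smooth_map (open_submanifold R V) (open_submanifold M W) (inv_into W \<pi>)"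
      using bspec[OF \<U>(2) W(1)] unfolding diffeomorphism_def pW pV by auto
    note SW = smooth_structure_open_submanifold[OF M OW] and SV = smooth_structure_open_submanifold[OF RS V(1)]
    have UW: "openin (mtop M) (U \<inter> W)" using OU OW by blast
    have "smooth_real (open_submanifold M W) (U \<inter> W) (\<lambda>x. \<phi> x i)"
      by (subst smooth_real_open_submanifold) (auto intro: smooth_real_subset[OF M smooth_real_coord[OF M U(1)] UW])
    moreover have "openin (mtop (open_submanifold M W)) (U \<inter> W)"
      using UW OW by (simp add: openin_open_subtopology)
    ultimately have "smooth_real (open_submanifold R V) {c \<in> V. inv_into W \<pi> c \<in> U \<inter> W} (\<lambda>c. \<phi> (inv_into W \<pi> c) i)"
      using smooth_map_real[OF SV SW r] unfolding pV by blast
    then have sr: "smooth_real R {c \<in> V. inv_into W \<pi> c \<in> U \<inter> W} (\<lambda>c. \<phi> (inv_into W \<pi> c) i)"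
      by (subst (asm) smooth_real_open_submanifold) auto
    \<comment> \<open>A value of the inverse on the sheet that falls into U is a preimage in U, and
      injectivity on U leaves only one.\<close>
    have eq: "inv_into W \<pi> c = inv_into U \<pi> c" "c \<in> \<pi> ` U" if "c \<in> V" "inv_into W \<pi> c \<in> U \<inter> W" for c
    proof -
      have "c \<in> \<pi> ` W" using bij that(1) by (simp add: bij_betw_def)
      then have "\<pi> (inv_into W \<pi> c) = c" by (rule f_inv_into_f)
      then show "inv_into W \<pi> c = inv_into U \<pi> c" "c \<in> \<pi> ` U"
        using that(2) inv_into_f_f[OF U(2), of "inv_into W \<pi> c"] by (auto intro: image_eqI[of c \<pi>])
    qed
    have "smooth_real R {c \<in> V. inv_into W \<pi> c \<in> U \<inter> W} (\<lambda>c. \<phi> (inv_into U \<pi> c) i)"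
      by (rule smooth_real_cong[OF RS _ sr]) (use eq(1) in auto)
    moreover have "inv_into W \<pi> b = p" using bij p W by (simp add: bij_betw_def inv_into_f_f)
    ultimately show "\<exists>B. b \<in> B \<and> B \<subseteq> \<pi> ` U \<and> smooth_real R B (\<lambda>b. \<phi> (inv_into U \<pi> b) i)"
      using V(2) p W eq(2) by (intro exI[of _ "{c \<in> V. inv_into W \<pi> c \<in> U \<inter> W}"]) auto
  qed
  show "c \<in> mcharts R"
  proof (rule mcharts_maximal[OF RS])
    show "is_chart (mdim R) (mtop R) c" using quotient_chart_is_chart[OF U] R c by simp
    fix d assume d: "d \<in> mcharts R"
    obtain V \<psi> where dV: "d = (V, \<psi>)" by (cases d)
    note V = d[unfolded dV]
    note OV = mchart_openin[OF RS V]
    let ?B = "{x \<in> U. \<pi> x \<in> V}"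
    have B: "openin (mtop M) ?B"
      by (rule openin_continuous_map_preimage_gen[OF smooth_map_continuous[OF M RS sm] OU OV])
    have "\<pi> ` U \<inter> V = \<pi> ` ?B" by blast
    then have im: "quotient_coord U \<phi> ` (\<pi> ` U \<inter> V) = \<phi> ` ?B"
      using quotient_coord_image[OF U, of ?B] by auto
    show "compatible_charts (mdim R) c d"
      unfolding compatible_charts_def c dV smooth_transition_def prod.case
    proof (intro conjI allI impI)
      fix i assume i: "i < mdim R"
      have "smooth_fun_on (mdim M) (\<phi> ` ?B) (\<lambda>y. \<psi> (\<pi> (inv_into U \<phi> y)) i)"
        by (rule smooth_realD[OF M smooth_map_real[OF M RS sm OV smooth_real_coord[OF RS V]] U(1) B])
          (use openin_subset[OF B] in auto)
      then show "smooth_fun_on (mdim R) (quotient_coord U \<phi> ` (\<pi> ` U \<inter> V))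
         (\<lambda>y. \<psi> (inv_into (\<pi> ` U) (quotient_coord U \<phi>) y) i)"
        unfolding im R(1)
        by (rule smooth_fun_on_cong[OF mchart_open_image[OF M U(1) B], rotated -1])
          (use quotient_coord_inv[OF U] in auto)
      have VU: "openin (mtop R) (V \<inter> \<pi> ` U)" using OV orbit_open[OF OU] R(2) by auto
      show "smooth_fun_on (mdim R) (\<psi> ` (V \<inter> \<pi> ` U)) (\<lambda>y. quotient_coord U \<phi> (inv_into V \<psi> y) i)"
        using smooth_realD[OF RS sec V VU, of i] by simp
    qed
  qed
qed

text \<open>Both structures are maximal atlases containing \<open>quotient_atlas\<close>. Every
  chart of one is compatible with this common part, and therefore with all charts of the
  other.\<close>

lemma quotient_manifold_eq: "quotient_manifold G \<alpha> M = Q"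
  unfolding quotient_manifold_def
proof (rule the_equality)
  show "mdim Q = mdim M \<and> mtop Q = TQ \<and> smooth_manifold Q \<and> smooth_covering_map M Q \<pi>"
    using smooth_manifold_Q smooth_covering_map_orbit by simp
  fix R assume "mdim R = mdim M \<and> mtop R = TQ \<and> smooth_manifold R \<and> smooth_covering_map M R \<pi>"
  then have R: "mdim R = mdim M" "mtop R = TQ" "smooth_manifold R" "smooth_covering_map M R \<pi>" by auto
  have RS: "smooth_structure R" using R(3) by (simp add: smooth_manifold_iff)
  note sub = quotient_atlas_subset_covering[OF R]
  have max: "c \<in> maximal_atlas (mdim M) TQ A \<longleftrightarrow> is_chart (mdim M) TQ c \<and> (\<forall>d\<in>A. compatible_charts (mdim M) c d)" for c A
    unfolding maximal_atlas_def by simp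
  have R_eq: "c \<in> mcharts R \<longleftrightarrow> c \<in> maximal_atlas (mdim M) TQ (mcharts R)" for c
    using RS R unfolding smooth_structure_def by simp
  have 1: "mcharts R \<subseteq> maximal_atlas (mdim M) TQ quotient_atlas"
  proof
    fix c assume "c \<in> mcharts R"
    then show "c \<in> maximal_atlas (mdim M) TQ quotient_atlas"
      using R_eq[of c] max[of c "mcharts R"] max[of c quotient_atlas] sub by blast
  qed
  have 2: "maximal_atlas (mdim M) TQ quotient_atlas \<subseteq> mcharts R"
  proof
    fix c assume c: "c \<in> maximal_atlas (mdim M) TQ quotient_atlas"
    have "compatible_charts (mdim M) c d" if "d \<in> mcharts R" for d
      using maximal_atlas_structure(1)[OF atlas_quotient] c 1 that unfolding atlas_def by blast
    then show "c \<in> mcharts R" using R_eq[of c] max[of c "mcharts R"] max[of c quotient_atlas] c by blast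
  qed
  have "mcharts R = mcharts Q" using 1 2 by (simp add: Q_def)
  then show "R = Q" using R by (intro manifold.equality) auto
qed

end


section \<open>Invariant functions and the orbit manifold\<close>

context free_proper_action
begin

abbreviation "Inv \<equiv> invariant_functions G \<alpha> M"

lemma points_Q': "mpoints Q = \<pi> ` mpoints M"
  by (simp add: points_Q)

lemma InvD: "f \<in> Inv \<Longrightarrow> f \<in> smooth_functions M"
  and Inv_act: "f \<in> Inv \<Longrightarrow> g \<in> carrier G \<Longrightarrow> p \<in> mpoints M \<Longrightarrow> f (\<alpha> g p) = f p"
  by (auto simp: invariant_functions_def)

lemma Inv_orbit_eq:
  assumes "f \<in> Inv" "p \<in> mpoints M" "q \<in> mpoints M" "\<pi> p = \<pi> q"
  shows "f p = f q"
proof -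
  obtain g where g: "g \<in> carrier G" "q = \<alpha> g p" using orbit_eqE[OF assms(2-4)] .
  then show ?thesis using Inv_act[OF assms(1) g(1) assms(2)] by simp
qed

lemma InvI:
  assumes "smooth_real M (mpoints M) f" "\<And>g p. g \<in> carrier G \<Longrightarrow> p \<in> mpoints M \<Longrightarrow> f (\<alpha> g p) = f p"
  shows "(\<lambda>p\<in>mpoints M. f p) \<in> Inv"
  using smooth_functionsI[OF M assms(1)] assms(2) act_closed by (simp add: invariant_functions_def)

lemma pullback_orbit_Inv:
  assumes "h \<in> smooth_functions Q"
  shows "pullback M \<pi> h \<in> Inv"
  using smooth_functions_pullback[OF M smooth_structure_Q smooth_map_orbit assms] orbit_act act_closed
  by (simp add: invariant_functions_def pullback_eq)

text \<open>The inverse of the pullback on invariant functions. Some representative of the orbit is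
  chosen, and invariance makes the value independent of the choice.\<close>

definition descend :: "('a \<Rightarrow> real) \<Rightarrow> 'a set \<Rightarrow> real" where
  "descend f = (\<lambda>b\<in>mpoints Q. f (inv_into (mpoints M) \<pi> b))"

lemma descend_orbit:
  assumes f: "f \<in> Inv" and p: "p \<in> mpoints M"
  shows "descend f (\<pi> p) = f p"
proof -
  have b: "\<pi> p \<in> \<pi> ` mpoints M" using p by blast
  have "f (inv_into (mpoints M) \<pi> (\<pi> p)) = f p"
    by (rule Inv_orbit_eq[OF f inv_into_into[OF b] p f_inv_into_f[OF b]])
  then show ?thesis using p by (simp add: descend_def points_Q)
qed

lemma descend_smooth:
  assumes f: "f \<in> Inv"
  shows "descend f \<in> smooth_functions Q"
proof -
  have fM: "smooth_real M (mpoints M) f" using InvD[OF f] by (simp add: smooth_functions_iff[OF M])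
  have "smooth_real Q (mpoints Q) (descend f)"
  proof (rule smooth_real_local[OF smooth_structure_Q])
    fix b assume "b \<in> mpoints Q"
    then obtain p where p: "p \<in> mpoints M" "b = \<pi> p" unfolding points_Q' by blast
    from small_neighbourhood[OF p(1)] obtain B where B: "openin (mtop M) B" "p \<in> B" "inj_on \<pi> B" .
    have BM: "B \<subseteq> mpoints M" by (rule openin_subset[OF B(1)])
    \<comment> \<open>The global choice of representatives may be discontinuous; over a small B it
      is replaced by the section with values in B, which gives the same values of f.\<close>
    have "smooth_real Q (\<pi> ` B) (\<lambda>b. f (inv_into B \<pi> b))"
      by (rule smooth_real_descend[OF B(1,3) smooth_real_subset[OF M fM B(1) BM]])
    then have "smooth_real Q (\<pi> ` B) (descend f)"
    proof (rule smooth_real_cong[OF smooth_structure_Q, rotated])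
      fix c assume "c \<in> \<pi> ` B"
      then obtain x where x: "x \<in> B" "c = \<pi> x" by blast
      then show "f (inv_into B \<pi> c) = descend f c"
        using descend_orbit[OF f, of x] BM inv_into_f_f[OF B(3) x(1)] by auto
    qed
    then show "\<exists>B. b \<in> B \<and> B \<subseteq> mpoints Q \<and> smooth_real Q B (descend f)"
      using B p BM points_Q' by (intro exI[of _ "\<pi> ` B"]) auto
  qed
  then show ?thesis unfolding smooth_functions_iff[OF smooth_structure_Q] by (simp add: descend_def)
qed

lemma pullback_descend:
  assumes "f \<in> Inv"
  shows "pullback M \<pi> (descend f) = f"
proof
  fix p
  show "pullback M \<pi> (descend f) p = f p"
    using descend_orbit[OF assms] smooth_functions_extensional[OF M InvD[OF assms]]
    by (cases "p \<in> mpoints M") (simp_all add: pullback_eq extensional_def)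
qed

lemma descend_pullback:
  assumes "h \<in> smooth_functions Q"
  shows "descend (pullback M \<pi> h) = h"
proof
  fix b
  show "descend (pullback M \<pi> h) b = h b"
  proof (cases "b \<in> mpoints Q")
    case True
    then obtain p where p: "p \<in> mpoints M" "b = \<pi> p" unfolding points_Q' by blast
    then show ?thesis using descend_orbit[OF pullback_orbit_Inv[OF assms] p(1)] by (simp add: pullback_eq)
  next
    case False
    then show ?thesis using smooth_functions_extensional[OF smooth_structure_Q assms]
      by (simp add: descend_def extensional_def)
  qed
qed

lemma linear_Inv: "linear_function_space (mpoints M) Inv"
proof -
  note lin = linear_smooth_functions[OF M, unfolded linear_function_space_def]
  have "(\<lambda>x\<in>mpoints M. 0) \<in> Inv" using lin act_closed by (simp add: invariant_functions_def)
  moreover have "fun_add (mpoints M) f g \<in> Inv" if "f \<in> Inv" "g \<in> Inv" for f g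
    using lin that act_closed by (simp add: invariant_functions_def fun_add_def)
  moreover have "fun_scale (mpoints M) c f \<in> Inv" if "f \<in> Inv" for f c
    using lin that act_closed by (simp add: invariant_functions_def fun_scale_def)
  moreover have "Inv \<subseteq> extensional (mpoints M)" using lin InvD by blast
  ultimately show ?thesis unfolding linear_function_space_def by blast
qed

lemma point_seminorm:
  assumes "p \<in> mpoints M"
  obtains q where "q \<in> cinf_seminorms M" "\<And>f. f \<in> smooth_functions M \<Longrightarrow> \<bar>f p\<bar> \<le> q f"
proof -
  obtain U \<phi> where U: "(U, \<phi>) \<in> mcharts M" "p \<in> U" using mcharts_cover[OF M assms] by blast
  have c: "compactin (mtop M) {p}" using assms by simp
  show thesis
  proof (rule that)
    show "cinf_seminorm (U, \<phi>) {p} [] \<in> cinf_seminorms M"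
      unfolding cinf_seminorms_def using U c by blast
    fix f assume f: "f \<in> smooth_functions M"
    have "\<bar>chart_deriv U \<phi> [] f p\<bar> \<le> cinf_seminorm (U, \<phi>) {p} [] f"
      by (rule chart_deriv_le_seminorm[OF M U(1) c _ _ f]) (use U in auto)
    then show "\<bar>f p\<bar> \<le> cinf_seminorm (U, \<phi>) {p} [] f" using mchart_inv[OF M U] by simp
  qed
qed

text \<open>Evaluation at a point is bounded by a seminorm, so a violation of invariance at some g
  and p persists in a seminorm ball around the function.\<close>

lemma closedin_Inv: "closedin (cinf_topology M) Inv"
  unfolding closedin_def topspace_cinf_topology
proof
  show "Inv \<subseteq> smooth_functions M" using InvD by blast
  show "openin (cinf_topology M) (smooth_functions M - Inv)"
    unfolding cinf_topology_eq openin_seminorm_topology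
  proof (intro conjI ballI)
    fix f assume "f \<in> smooth_functions M - Inv"
    then obtain g p where f: "f \<in> smooth_functions M" and gp: "g \<in> carrier G" "p \<in> mpoints M" "f (\<alpha> g p) \<noteq> f p"
      by (auto simp: invariant_functions_def)
    let ?d = "\<bar>f (\<alpha> g p) - f p\<bar>"
    note gpM = act_closed[OF gp(1,2)]
    from point_seminorm[OF gp(2)] obtain q where q: "q \<in> cinf_seminorms M"
      "\<And>f. f \<in> smooth_functions M \<Longrightarrow> \<bar>f p\<bar> \<le> q f" by blast
    from point_seminorm[OF gpM] obtain q' where q': "q' \<in> cinf_seminorms M"
      "\<And>f. f \<in> smooth_functions M \<Longrightarrow> \<bar>f (\<alpha> g p)\<bar> \<le> q' f" by blast
    have "{h \<in> smooth_functions M. \<forall>r\<in>{q, q'}. r (fun_diff (mpoints M) h f) < ?d / 2} \<subseteq> smooth_functions M - Inv"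
    proof safe
      fix h assume h: "h \<in> smooth_functions M" "\<forall>r\<in>{q, q'}. r (fun_diff (mpoints M) h f) < ?d / 2" "h \<in> Inv"
      have hf: "fun_diff (mpoints M) h f \<in> smooth_functions M"
        by (rule fun_diff_in_space[OF linear_smooth_functions[OF M] h(1) f])
      have "\<bar>h p - f p\<bar> < ?d / 2" "\<bar>h (\<alpha> g p) - f (\<alpha> g p)\<bar> < ?d / 2"
        using q(2)[OF hf] q'(2)[OF hf] h(2) gp(2) gpM by (auto simp: fun_diff_def)
      \<comment> \<open>Two errors, each below half of the defect, cannot cancel it.\<close>
      moreover have "?d \<le> \<bar>h p - f p\<bar> + \<bar>h (\<alpha> g p) - f (\<alpha> g p)\<bar>"
        using abs_triangle_ineq4[of "h p - f p" "h (\<alpha> g p) - f (\<alpha> g p)"] Inv_act[OF h(3) gp(1,2)] by simp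
      ultimately show False by simp
    qed
    then show "\<exists>F \<epsilon>. finite F \<and> F \<subseteq> cinf_seminorms M \<and> \<epsilon> > 0 \<and>
        {h \<in> smooth_functions M. \<forall>r\<in>F. r (fun_diff (mpoints M) h f) < \<epsilon>} \<subseteq> smooth_functions M - Inv"
      using q(1) q'(1) gp(3) by (intro exI[of _ "{q, q'}"] exI[of _ "?d / 2"]) auto
  qed blast
qed

section \<open>Comparison of the topologies on M and on its orbit manifold\<close>

lemma cinf_seminorm_pullback:
  assumes U: "(U, \<phi>) \<in> mcharts M" and inj: "inj_on \<pi> U" and L: "L \<subseteq> U" and js: "js \<in> lists {..<mdim M}"
  shows "cinf_seminorm (\<pi> ` U, quotient_coord U \<phi>) (\<pi> ` L) js h = cinf_seminorm (U, \<phi>) L js (pullback M \<pi> h)"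
proof -
  have "chart_deriv (\<pi> ` U) (quotient_coord U \<phi>) js h (\<pi> p) = chart_deriv U \<phi> js (pullback M \<pi> h) p"
    if p: "p \<in> L" for p
  proof -
    have pU: "p \<in> U" using p L by blast
    have "quotient_coord U \<phi> (\<pi> p) = \<phi> p" using inv_into_f_f[OF inj pU] by simp
    moreover have "iter_partial js (h \<circ> inv_into (\<pi> ` U) (quotient_coord U \<phi>)) (\<phi> p) =
        iter_partial js (pullback M \<pi> h \<circ> inv_into U \<phi>) (\<phi> p)"
    proof (rule iter_partial_cong[OF mchart_open_range[OF M U] _ js])
      fix y assume y: "y \<in> \<phi> ` U"
      then have "inv_into U \<phi> y \<in> mpoints M" using mchart_inv[OF M U] mchart_subset_points[OF M U] by auto
      then show "(h \<circ> inv_into (\<pi> ` U) (quotient_coord U \<phi>)) y = (pullback M \<pi> h \<circ> inv_into U \<phi>) y"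
        using quotient_coord_inv[OF U inj y] by (simp add: pullback_eq)
    qed (use pU in auto)
    ultimately show ?thesis by simp
  qed
  then show ?thesis unfolding cinf_seminorm_def prod.case image_image by (metis (no_types, lifting) image_cong)
qed

lemma small_compact_neighbourhood:
  assumes "p \<in> mpoints M"
  obtains U \<phi> B L where "(U, \<phi>) \<in> mcharts M" "inj_on \<pi> U" "openin (mtop M) B" "p \<in> B" "B \<subseteq> L"
    "compactin (mtop M) L" "L \<subseteq> U"
proof -
  from small_chart[OF openin_topspace assms] obtain U \<phi> where U: "(U, \<phi>) \<in> mcharts M" "p \<in> U" "inj_on \<pi> U" .
  from compact_neighbourhood[OF M mchart_openin[OF M U(1)] U(2)] obtain B L where
    "openin (mtop M) B" "p \<in> B" "B \<subseteq> L" "compactin (mtop M) L" "L \<subseteq> U" .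
  then show thesis using that U by blast
qed

lemma dominated_pullback:
  assumes q: "q \<in> cinf_seminorms M"
  shows "dominated (smooth_functions Q) (cinf_seminorms Q) (\<lambda>h. q (pullback M \<pi> h))"
proof -
  \<comment> \<open>Only charts on which the projection is injective have a push-forward. Their
    seminorms dominate q, so the comparison can be restricted to them.\<close>
  define P where "P = {cinf_seminorm (U, \<phi>) L s | U \<phi> L s. (U, \<phi>) \<in> mcharts M \<and> inj_on \<pi> U \<and>
     compactin (mtop M) L \<and> L \<noteq> {} \<and> L \<subseteq> U \<and> s \<in> lists {..<mdim M}}"
  obtain V \<psi> K js where q': "q = cinf_seminorm (V, \<psi>) K js" and V: "(V, \<psi>) \<in> mcharts M"
    and K: "compactin (mtop M) K" "K \<noteq> {}" "K \<subseteq> V" and js: "js \<in> lists {..<mdim M}"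
    using q unfolding cinf_seminorms_def by blast
  have "P \<subseteq> cinf_seminorms M" unfolding P_def cinf_seminorms_def by blast
  then have dom: "dominated (smooth_functions M) P q"
    unfolding q'
  proof (rule dominated_cinf_seminorm[OF M Hausdorff_M _ V K js])
    fix p assume "p \<in> K"
    then have "p \<in> mpoints M" using K(3) mchart_subset_points[OF M V] by blast
    from small_compact_neighbourhood[OF this] obtain U \<phi> B L where UL: "(U, \<phi>) \<in> mcharts M" "inj_on \<pi> U"
      "openin (mtop M) B" "p \<in> B" "B \<subseteq> L" "compactin (mtop M) L" "L \<subseteq> U" .
    then have "L \<noteq> {}" by blast
    then have "cinf_seminorm (U, \<phi>) L s \<in> P" if "s \<in> lists {..<mdim M}" for s
      unfolding P_def using UL that by blast
    then show "\<exists>B U \<phi> L. openin (mtop M) B \<and> p \<in> B \<and> B \<subseteq> L \<and> (U, \<phi>) \<in> mcharts M \<and>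
      compactin (mtop M) L \<and> L \<subseteq> U \<and> (\<forall>s\<in>lists {..<mdim M}. cinf_seminorm (U, \<phi>) L s \<in> P)"
      using UL by blast
  qed
  show ?thesis
  proof (rule dominated_trans[OF _ dom])
    show "\<forall>q\<in>cinf_seminorms Q. \<forall>f\<in>smooth_functions Q. 0 \<le> q f"
      using cinf_seminorm_nonneg[OF smooth_structure_Q] by blast
    show "pullback M \<pi> h \<in> smooth_functions M" if "h \<in> smooth_functions Q" for h
      using InvD[OF pullback_orbit_Inv[OF that]] .
    fix r assume "r \<in> P"
    then obtain U \<phi> L s where r: "r = cinf_seminorm (U, \<phi>) L s" and U: "(U, \<phi>) \<in> mcharts M" "inj_on \<pi> U"
      and L: "compactin (mtop M) L" "L \<noteq> {}" "L \<subseteq> U" and s: "s \<in> lists {..<mdim M}" unfolding P_def by blast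
    have "compactin (mtop Q) (\<pi> ` L)" using image_compactin[OF L(1) orbit_continuous] by simp
    moreover have "s \<in> lists {..<mdim Q}" using s by simp
    ultimately have "cinf_seminorm (\<pi> ` U, quotient_coord U \<phi>) (\<pi> ` L) s \<in> cinf_seminorms Q"
      unfolding cinf_seminorms_def using quotient_chart_mem[OF U] L by blast
    from dominated_member[OF this] show "dominated (smooth_functions Q) (cinf_seminorms Q) (\<lambda>h. r (pullback M \<pi> h))"
      unfolding r cinf_seminorm_pullback[OF U L(3) s] .
  qed
qed

lemma dominated_descend:
  assumes q: "q \<in> cinf_seminorms Q"
  shows "dominated Inv (cinf_seminorms M) (\<lambda>f. q (descend f))"
proof -
  \<comment> \<open>The push-forwards of small charts of M with their compact pieces. They pass the
    local test on Q because the projection is open and continuous.\<close>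
  define P where "P = {cinf_seminorm (\<pi> ` U, quotient_coord U \<phi>) (\<pi> ` L) s | U \<phi> L s. (U, \<phi>) \<in> mcharts M \<and> inj_on \<pi> U \<and>
     compactin (mtop M) L \<and> L \<noteq> {} \<and> L \<subseteq> U \<and> s \<in> lists {..<mdim M}}"
  obtain V \<psi> K js where q': "q = cinf_seminorm (V, \<psi>) K js" and V: "(V, \<psi>) \<in> mcharts Q"
    and K: "compactin (mtop Q) K" "K \<noteq> {}" "K \<subseteq> V" and js: "js \<in> lists {..<mdim Q}"
    using q unfolding cinf_seminorms_def by blast
  have comp: "compactin (mtop Q) (\<pi> ` L)" if "compactin (mtop M) L" for L
    using image_compactin[OF that orbit_continuous] by simp
  have P: "P \<subseteq> cinf_seminorms Q"
  proof
    fix r assume "r \<in> P"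
    then obtain U \<phi> L s where r: "r = cinf_seminorm (\<pi> ` U, quotient_coord U \<phi>) (\<pi> ` L) s"
      and U: "(U, \<phi>) \<in> mcharts M" "inj_on \<pi> U"
      and L: "compactin (mtop M) L" "L \<noteq> {}" "L \<subseteq> U" and s: "s \<in> lists {..<mdim M}" unfolding P_def by blast
    have "s \<in> lists {..<mdim Q}" using s by simp
    then show "r \<in> cinf_seminorms Q"
      unfolding cinf_seminorms_def r using quotient_chart_mem[OF U] L comp[OF L(1)] by blast
  qed
  have HQ: "Hausdorff_space (mtop Q)" using Hausdorff_Q by simp
  have dom: "dominated (smooth_functions Q) P q"
    unfolding q'
  proof (rule dominated_cinf_seminorm[OF smooth_structure_Q HQ P V K js])
    fix b assume "b \<in> K"
    then have "b \<in> mpoints Q" using K(3) mchart_subset_points[OF smooth_structure_Q V] by blast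
    then obtain p where p: "p \<in> mpoints M" "b = \<pi> p" unfolding points_Q' by blast
    from small_compact_neighbourhood[OF p(1)] obtain U \<phi> B L where UL: "(U, \<phi>) \<in> mcharts M" "inj_on \<pi> U"
      "openin (mtop M) B" "p \<in> B" "B \<subseteq> L" "compactin (mtop M) L" "L \<subseteq> U" .
    then have "L \<noteq> {}" by blast
    then have in_P: "\<forall>s\<in>lists {..<mdim Q}. cinf_seminorm (\<pi> ` U, quotient_coord U \<phi>) (\<pi> ` L) s \<in> P"
      unfolding P_def Q_sel using UL by blast
    have "openin (mtop Q) (\<pi> ` B)" using orbit_open[OF UL(3)] by simp
    note facts = this in_P quotient_chart_mem[OF UL(1,2)] comp[OF UL(6)] UL(4,5,7) p(2)
    show "\<exists>B U \<phi> L. openin (mtop Q) B \<and> b \<in> B \<and> B \<subseteq> L \<and> (U, \<phi>) \<in> mcharts Q \<and>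
      compactin (mtop Q) L \<and> L \<subseteq> U \<and> (\<forall>s\<in>lists {..<mdim Q}. cinf_seminorm (U, \<phi>) L s \<in> P)"
      by (rule exI[of _ "\<pi> ` B"], rule exI[of _ "\<pi> ` U"], rule exI[of _ "quotient_coord U \<phi>"],
          rule exI[of _ "\<pi> ` L"])
        (use facts in blast)
  qed
  show ?thesis
  proof (rule dominated_trans[OF _ dom])
    show "\<forall>q\<in>cinf_seminorms M. \<forall>f\<in>Inv. 0 \<le> q f" using cinf_seminorm_nonneg[OF M] InvD by blast
    show "descend f \<in> smooth_functions Q" if "f \<in> Inv" for f using descend_smooth[OF that] .
    fix r assume "r \<in> P"
    then obtain U \<phi> L s where r: "r = cinf_seminorm (\<pi> ` U, quotient_coord U \<phi>) (\<pi> ` L) s"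
      and U: "(U, \<phi>) \<in> mcharts M" "inj_on \<pi> U"
      and L: "compactin (mtop M) L" "L \<noteq> {}" "L \<subseteq> U" and s: "s \<in> lists {..<mdim M}" unfolding P_def by blast
    have "cinf_seminorm (U, \<phi>) L s \<in> cinf_seminorms M" unfolding cinf_seminorms_def using U L s by blast
    from dominated_member[OF this] show "dominated Inv (cinf_seminorms M) (\<lambda>f. r (descend f))"
    proof (rule dominated_mono)
      fix f assume "f \<in> Inv"
      then show "r (descend f) \<le> cinf_seminorm (U, \<phi>) L s f"
        unfolding r cinf_seminorm_pullback[OF U L(3) s] by (simp add: pullback_descend)
    qed
  qed
qed

lemma pullback_fun_add: "pullback M \<pi> (fun_add (mpoints Q) f g) = fun_add (mpoints M) (pullback M \<pi> f) (pullback M \<pi> g)"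
  and pullback_fun_diff: "pullback M \<pi> (fun_diff (mpoints Q) f g) = fun_diff (mpoints M) (pullback M \<pi> f) (pullback M \<pi> g)"
  and pullback_fun_scale: "pullback M \<pi> (fun_scale (mpoints Q) c f) = fun_scale (mpoints M) c (pullback M \<pi> f)"
  by (auto simp: pullback_eq fun_add_def fun_diff_def fun_scale_def points_Q fun_eq_iff)

theorem frechet_isomorphism_pullback:
  "frechet_isomorphism (mpoints Q) (cinf_topology Q) (mpoints M) (subtopology (cinf_topology M) Inv) (pullback M \<pi>)"
proof -
  have sub: "Inv \<subseteq> smooth_functions M" using InvD by blast
  have top: "subtopology (cinf_topology M) Inv = seminorm_topology (mpoints M) Inv (cinf_seminorms M)"
    unfolding cinf_topology_eq
    by (rule subtopology_seminorm_topology[OF linear_smooth_functions[OF M] _ sub]) (rule seminorm_cinf_seminorm[OF M])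
  note top' = top[unfolded cinf_topology_eq]
  have c1: "continuous_map (cinf_topology Q) (subtopology (cinf_topology M) Inv) (pullback M \<pi>)"
    unfolding cinf_topology_eq top'
  proof (rule continuous_map_seminorm_topology[OF linear_smooth_functions[OF smooth_structure_Q] pullback_orbit_Inv])
    show "\<forall>q\<in>cinf_seminorms Q. \<forall>f\<in>smooth_functions Q. 0 \<le> q f"
      using cinf_seminorm_nonneg[OF smooth_structure_Q] by blast
  qed (simp_all only: pullback_fun_diff dominated_pullback)
  have c2: "continuous_map (subtopology (cinf_topology M) Inv) (cinf_topology Q) descend"
    unfolding cinf_topology_eq top'
  proof (rule continuous_map_seminorm_topology[OF linear_Inv descend_smooth])
    show "\<forall>q\<in>cinf_seminorms M. \<forall>f\<in>Inv. 0 \<le> q f" using cinf_seminorm_nonneg[OF M] InvD by blast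
    fix f g assume fg: "f \<in> Inv" "g \<in> Inv"
    \<comment> \<open>Compatibility of \<open>descend\<close> with differences is inherited from the
      pullback, whose inverse it is.\<close>
    have "fun_diff (mpoints M) f g = pullback M \<pi> (fun_diff (mpoints Q) (descend f) (descend g))"
      unfolding pullback_fun_diff using fg by (simp add: pullback_descend)
    moreover have "fun_diff (mpoints Q) (descend f) (descend g) \<in> smooth_functions Q"
      using fun_diff_in_space[OF linear_smooth_functions[OF smooth_structure_Q]] descend_smooth fg by blast
    ultimately show "descend (fun_diff (mpoints M) f g) = fun_diff (mpoints Q) (descend f) (descend g)"
      using descend_pullback by simp
  qed (simp_all only: dominated_descend)
  have topInv: "topspace (subtopology (cinf_topology M) Inv) = Inv" using InvD by auto
  have "homeomorphic_maps (cinf_topology Q) (subtopology (cinf_topology M) Inv) (pullback M \<pi>) descend"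
    unfolding homeomorphic_maps_def topInv using c1 c2 descend_pullback pullback_descend by simp
  then have homeo: "homeomorphic_map (cinf_topology Q) (subtopology (cinf_topology M) Inv) (pullback M \<pi>)"
    unfolding homeomorphic_map_maps by blast
  show ?thesis
    unfolding frechet_isomorphism_def
    using frechet_space_cinf_topology[OF smooth_manifold_Q] homeo pullback_fun_add pullback_fun_scale
      frechet_space_closed_subspace[OF frechet_space_cinf_topology[OF manifold] linear_Inv closedin_Inv]
    by (intro conjI ballI allI)
qed

text \<open>Extension of a chart function by zero; \<open>inv_into\<close> makes sense when \<open>\<pi>\<close> is injective on \<open>U\<close>.\<close>

definition spread :: "'a set \<Rightarrow> ('a \<Rightarrow> nat \<Rightarrow> real) \<Rightarrow> ((nat \<Rightarrow> real) \<Rightarrow> real) \<Rightarrow> 'a \<Rightarrow> real" where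
  "spread U \<phi> g p = (if \<pi> p \<in> \<pi> ` U then g (\<phi> (inv_into U \<pi> (\<pi> p))) else 0)"

lemma spread_act: "g \<in> carrier G \<Longrightarrow> p \<in> mpoints M \<Longrightarrow> spread U \<phi> h (\<alpha> g p) = spread U \<phi> h p"
  by (simp add: spread_def orbit_act)

text \<open>Two open sets cover M: the orbits that meet U, where the function is g in coordinates
  after the section, and the orbits that miss the compact set K over the box, where it is 0. The
  second set is open since the image of K is compact, hence closed in the Hausdorff orbit
  space.\<close>

lemma smooth_real_spread:
  assumes U: "(U, \<phi>) \<in> mcharts M" "inj_on \<pi> U" and box: "closed_box (mdim M) c r \<subseteq> \<phi> ` U"
    and g: "smooth_fun_on (mdim M) (\<phi> ` U) g" "\<And>u. u \<in> \<phi> ` U \<Longrightarrow> u \<notin> closed_box (mdim M) c r \<Longrightarrow> g u = 0"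
  shows "smooth_real M (mpoints M) (spread U \<phi> g)"
proof (rule smooth_real_local[OF M])
  fix p assume p: "p \<in> mpoints M"
  let ?K = "inv_into U \<phi> ` closed_box (mdim M) c r"
  let ?A = "{x \<in> mpoints M. \<pi> x \<in> \<pi> ` U}" and ?B = "{x \<in> mpoints M. \<pi> x \<in> topspace TQ - \<pi> ` ?K}"
  have "compactin (mtop M) ?K"
    by (rule image_compactin[OF _ chart_inv_continuous[OF mcharts_is_chart[OF M U(1)]]])
      (use box compactin_closed_box in \<open>auto simp: compactin_subtopology\<close>)
  then have "closedin TQ (\<pi> ` ?K)"
    by (intro compactin_imp_closedin[OF Hausdorff_Q] image_compactin[OF _ orbit_continuous])
  then have B: "openin (mtop M) ?B"
    by (intro openin_continuous_map_preimage[OF orbit_continuous]) blast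
  have "smooth_real M ?A (\<lambda>x. g (\<phi> (inv_into U \<pi> (\<pi> x))))"
    by (rule smooth_real_section[OF U smooth_real_chart_fun[OF M U(1) g(1)]])
  then have 1: "smooth_real M ?A (spread U \<phi> g)"
    by (rule smooth_real_cong[OF M, rotated]) (simp add: spread_def)
  have 2: "smooth_real M ?B (spread U \<phi> g)"
  proof (rule smooth_real_cong[OF M _ smooth_real_const[OF M B, of 0]])
    fix x assume x: "x \<in> ?B"
    show "0 = spread U \<phi> g x"
    proof (cases "\<pi> x \<in> \<pi> ` U")
      case True
      let ?y = "inv_into U \<pi> (\<pi> x)"
      have y: "?y \<in> U" "\<pi> ?y = \<pi> x" using inv_into_into[OF True] f_inv_into_f[OF True] .
      have "\<phi> ?y \<notin> closed_box (mdim M) c r"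
      proof
        assume "\<phi> ?y \<in> closed_box (mdim M) c r"
        then have "?y \<in> ?K" using mchart_inv[OF M U(1) y(1)] by (metis imageI)
        then have "\<pi> x \<in> \<pi> ` ?K" using y(2) by (metis imageI)
        then show False using x by blast
      qed
      then show ?thesis using g(2)[of "\<phi> ?y"] y(1) True by (simp add: spread_def)
    qed (simp add: spread_def)
  qed
  show "\<exists>B. p \<in> B \<and> B \<subseteq> mpoints M \<and> smooth_real M B (spread U \<phi> g)"
  proof (cases "\<pi> p \<in> \<pi> ` U")
    case True
    then show ?thesis using 1 p by (intro exI[of _ ?A]) auto
  next
    case False
    have "\<pi> ` ?K \<subseteq> \<pi> ` U" using box by (auto intro!: imageI inv_into_into)
    then have "p \<in> ?B" using False p points_Q by blast
    then show ?thesis using 2 by (intro exI[of _ ?B]) auto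
  qed
qed

end

text \<open>For a chart \<zeta> of X, the product charts built from \<zeta> and the identity over
  the chart range, and from \<zeta> and \<phi> over U, have the same image and give the same
  coordinate representation of f.\<close>

lemma smooth_real_chart_slice:
  assumes X: "smooth_structure X" and N: "smooth_structure N" and U: "(U, \<phi>) \<in> mcharts N"
    and f: "smooth_real (prod_manifold X N) (mpoints (prod_manifold X N)) f"
  shows "smooth_real (prod_manifold X (euclidean_manifold (mdim N))) (mpoints X \<times> \<phi> ` U)
    (\<lambda>q. f (fst q, inv_into U \<phi> (snd q)))"
proof -
  let ?E = "euclidean_manifold (mdim N)"
  let ?D = "prod_manifold X ?E" and ?P = "prod_manifold X N"
  note E = smooth_structure_euclidean[of "mdim N"]
  note D = smooth_structure_prod[OF X E] and P = smooth_structure_prod[OF X N]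
  note C = mcharts_is_chart[OF N U]
  have EU: "(\<phi> ` U, \<lambda>x. x) \<in> mcharts ?E"
    by (rule mcharts_restrict[OF E euclidean_chart])
      (use chart_open_range[OF C] openin_subset[OF chart_open_range[OF C]] in auto)
  show ?thesis
  proof (rule smooth_real_local[OF D])
    fix q assume q: "q \<in> mpoints X \<times> \<phi> ` U"
    then have "fst q \<in> mpoints X" by auto
    then obtain V \<zeta> where V: "(V, \<zeta>) \<in> mcharts X" "fst q \<in> V" using mcharts_cover[OF X] by blast
    let ?c = "prod_coord (mdim X) \<zeta> (\<lambda>x. x)" and ?c' = "prod_coord (mdim X) \<zeta> \<phi>"
    note c = prod_chart_mem[OF X E V(1) EU] and c' = prod_chart_mem[OF X N V(1) U]
    have eq: "?c (x, \<phi> y) = ?c' (x, y)" for x y by (simp add: prod_coord_def)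
    have "V \<times> \<phi> ` U = (\<lambda>(x, y). (x, \<phi> y)) ` (V \<times> U)" by auto
    then have im: "?c ` (V \<times> \<phi> ` U) = ?c' ` (V \<times> U)"
      unfolding image_image by (auto simp: eq image_image case_prod_beta)
    have "smooth_fun_on (mdim ?P) (?c' ` (V \<times> U)) (\<lambda>y. f (inv_into (V \<times> U) ?c' y))"
      by (rule smooth_realD[OF P f c' mchart_openin[OF P c'] order.refl openin_subset[OF mchart_openin[OF P c']]])
    then have "smooth_fun_on (mdim ?D) (?c ` (V \<times> \<phi> ` U)) (\<lambda>y. f (inv_into (V \<times> U) ?c' y))"
      unfolding im by simp
    from smooth_real_chart_fun[OF D c this]
    have "smooth_real ?D (V \<times> \<phi> ` U) (\<lambda>q. f (inv_into (V \<times> U) ?c' (?c q)))" .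
    then have "smooth_real ?D (V \<times> \<phi> ` U) (\<lambda>q. f (fst q, inv_into U \<phi> (snd q)))"
    proof (rule smooth_real_cong[OF D, rotated])
      fix q assume "q \<in> V \<times> \<phi> ` U"
      then obtain x y where q: "q = (x, \<phi> y)" "x \<in> V" "y \<in> U" by auto
      then show "f (inv_into (V \<times> U) ?c' (?c q)) = f (fst q, inv_into U \<phi> (snd q))"
        using eq mchart_inv[OF P c', of "(x, y)"] mchart_inv[OF N U, of y] by simp
    qed
    then show "\<exists>B. q \<in> B \<and> B \<subseteq> mpoints X \<times> \<phi> ` U \<and> smooth_real ?D B (\<lambda>q. f (fst q, inv_into U \<phi> (snd q)))"
      using V q mchart_subset_points[OF X V(1)] by (intro exI[of _ "V \<times> \<phi> ` U"]) (auto simp: mem_Times_iff)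
  qed
qed

text \<open>Extension by zero with a parameter from X. The cut-off acts in the second factor, so the
  product of X with the complement of the closed box is an open set on which the function
  vanishes.\<close>

lemma smooth_real_cutoff_slice:
  assumes X: "smooth_structure X" and N: "smooth_structure N" and U: "(U, \<phi>) \<in> mcharts N"
    and f: "smooth_real (prod_manifold X N) (mpoints (prod_manifold X N)) f"
    and box: "closed_box (mdim N) c r \<subseteq> \<phi> ` U" and b: "smooth_fun_on (mdim N) (Rn (mdim N)) b"
    "\<And>u. u \<in> Rn (mdim N) \<Longrightarrow> u \<notin> closed_box (mdim N) c r \<Longrightarrow> b u = 0"
  shows "smooth_real (prod_manifold X (euclidean_manifold (mdim N))) (mpoints X \<times> Rn (mdim N))
    (\<lambda>q. if snd q \<in> \<phi> ` U then b (snd q) * f (fst q, inv_into U \<phi> (snd q)) else 0)"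
    (is "smooth_real ?D ?S ?F")
proof -
  let ?E = "euclidean_manifold (mdim N)"
  note E = smooth_structure_euclidean[of "mdim N"]
  note D = smooth_structure_prod[OF X E]
  have OU: "openin (Euclidean_space (mdim N)) (\<phi> ` U)" by (rule mchart_open_range[OF N U])
  let ?A = "mpoints X \<times> \<phi> ` U" and ?B = "mpoints X \<times> (Rn (mdim N) - closed_box (mdim N) c r)"
  have mt: "mtop ?D = prod_topology (mtop X) (Euclidean_space (mdim N))" by (simp add: prod_manifold_def)
  have A: "openin (mtop ?D) ?A" and B: "openin (mtop ?D) ?B"
    unfolding mt using OU openin_diff_closed_box by (simp_all add: openin_prod_Times_iff)
  have AS: "?A \<subseteq> mpoints ?D" by (rule openin_subset[OF A])
  have "smooth_real ?E (Rn (mdim N)) b" by (rule smooth_real_euclideanI[OF openin_topspace b(1)])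
  then have "smooth_real ?D {q \<in> mpoints ?D. snd q \<in> Rn (mdim N)} (\<lambda>q. b (snd q))"
    by (intro smooth_map_real[OF D E smooth_map_snd[OF X E]]) simp_all
  then have bs: "smooth_real ?D ?A (\<lambda>q. b (snd q))"
    by (rule smooth_real_subset[OF D _ A]) (use AS openin_subset[OF OU] in auto)
  have 1: "smooth_real ?D ?A ?F"
    by (rule smooth_real_cong[OF D _ smooth_real_mult[OF D A bs smooth_real_chart_slice[OF X N U f]]]) auto
  have 2: "smooth_real ?D ?B ?F"
    by (rule smooth_real_cong[OF D _ smooth_real_const[OF D B, of 0]]) (use b(2) in auto)
  show ?thesis
  proof (rule smooth_real_local[OF D])
    fix q assume q: "q \<in> ?S"
    show "\<exists>B. q \<in> B \<and> B \<subseteq> ?S \<and> smooth_real ?D B ?F"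
    proof (cases "snd q \<in> \<phi> ` U")
      case True
      then show ?thesis using 1 q openin_subset[OF OU] by (intro exI[of _ ?A]) (auto simp: mem_Times_iff)
    next
      case False
      then have "snd q \<notin> closed_box (mdim N) c r" using box by blast
      then show ?thesis using 2 q by (intro exI[of _ ?B]) (auto simp: mem_Times_iff)
    qed
  qed
qed


section \<open>Generating invariants\<close>

text \<open>Finitely many small charts with room for nested boxes: the boxes of radius r meet every
  orbit, \<open>bump\<close> is supported in radius 2 r, and the cut-off in \<open>coord\<close> is
  1 up to 2 r and vanishes beyond 4 r. This is the origin of the factor 4 in
  \<open>frame_box\<close>.\<close>

locale invariant_frame = free_proper_action G \<alpha> M
  for G :: "('g, 'b) monoid_scheme" (structure) and \<alpha> :: "'g \<Rightarrow> 'a \<Rightarrow> 'a" and M :: "'a manifold" +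
  fixes I :: "'i set" and U :: "'i \<Rightarrow> 'a set" and \<phi> :: "'i \<Rightarrow> 'a \<Rightarrow> nat \<Rightarrow> real"
    and c :: "'i \<Rightarrow> nat \<Rightarrow> real" and r :: "'i \<Rightarrow> real"
  assumes finite_I: "finite I"
    and frame_chart: "j \<in> I \<Longrightarrow> (U j, \<phi> j) \<in> mcharts M"
    and frame_inj: "j \<in> I \<Longrightarrow> inj_on \<pi> (U j)"
    and frame_radius: "j \<in> I \<Longrightarrow> r j > 0"
    and frame_box: "j \<in> I \<Longrightarrow> closed_box (mdim M) (c j) (4 * r j) \<subseteq> \<phi> j ` U j"
    and frame_cover: "q \<in> mpoints M \<Longrightarrow>
      \<exists>j\<in>I. \<exists>x\<in>U j. \<pi> x = \<pi> q \<and> \<phi> j x \<in> closed_box (mdim M) (c j) (r j)"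
begin

definition bump :: "'i \<Rightarrow> 'a \<Rightarrow> real" where
  "bump j = spread (U j) (\<phi> j) (box_bump (mdim M) (c j) (r j))"

definition coord :: "'i \<Rightarrow> nat \<Rightarrow> 'a \<Rightarrow> real" where
  "coord j k = spread (U j) (\<phi> j) (\<lambda>u. box_bump (mdim M) (c j) (2 * r j) u * u k)"

definition weight :: "'i \<Rightarrow> 'a \<Rightarrow> real" where
  "weight j q = bump j q * inverse (\<Sum>i\<in>I. bump i q)"

lemma bump_nonneg: "bump j q \<ge> 0"
  by (simp add: bump_def spread_def box_bump_nonneg)

lemma bump_sum_pos:
  assumes "q \<in> mpoints M"
  shows "(\<Sum>i\<in>I. bump i q) > 0"
proof -
  obtain j x where j: "j \<in> I" "x \<in> U j" "\<pi> x = \<pi> q" "\<phi> j x \<in> closed_box (mdim M) (c j) (r j)"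
    using frame_cover[OF assms] by blast
  have "inv_into (U j) \<pi> (\<pi> q) = x" using inv_into_f_f[OF frame_inj[OF j(1)] j(2)] j(3) by simp
  moreover have "\<pi> q \<in> \<pi> ` U j" using j(2,3) by (metis imageI)
  ultimately have "bump j q = 1"
    by (simp add: bump_def spread_def box_bump_one[OF frame_radius[OF j(1)] j(4)])
  moreover have "bump j q \<le> (\<Sum>i\<in>I. bump i q)"
    by (rule member_le_sum[OF j(1)]) (use bump_nonneg finite_I in auto)
  ultimately show ?thesis by simp
qed

lemma frame_open_range: "j \<in> I \<Longrightarrow> openin (Euclidean_space (mdim M)) (\<phi> j ` U j)"
  by (rule mchart_open_range[OF M frame_chart])

lemma bump_smooth:
  assumes j: "j \<in> I"
  shows "smooth_real M (mpoints M) (bump j)"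
  unfolding bump_def
proof (rule smooth_real_spread[OF frame_chart[OF j] frame_inj[OF j]])
  show "closed_box (mdim M) (c j) (2 * r j) \<subseteq> \<phi> j ` U j"
    by (rule order_trans[OF closed_box_mono frame_box[OF j]]) (use frame_radius[OF j] in simp)
  show "smooth_fun_on (mdim M) (\<phi> j ` U j) (box_bump (mdim M) (c j) (r j))"
    by (rule smooth_fun_on_box_bump[OF frame_open_range[OF j]])
  show "box_bump (mdim M) (c j) (r j) u = 0" if "u \<in> \<phi> j ` U j" "u \<notin> closed_box (mdim M) (c j) (2 * r j)" for u
    by (rule box_bump_zero[OF frame_radius[OF j] _ that(2)])
      (use that(1) openin_subset[OF frame_open_range[OF j]] in blast)
qed

lemma coord_smooth:
  assumes j: "j \<in> I"
  shows "smooth_real M (mpoints M) (coord j k)"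
  unfolding coord_def
proof (rule smooth_real_spread[OF frame_chart[OF j] frame_inj[OF j] frame_box[OF j]])
  note O = frame_open_range[OF j]
  show "smooth_fun_on (mdim M) (\<phi> j ` U j) (\<lambda>u. box_bump (mdim M) (c j) (2 * r j) u * u k)"
    by (rule smooth_fun_on_mult[OF O smooth_fun_on_box_bump[OF O] smooth_fun_on_coord[OF O]])
  show "box_bump (mdim M) (c j) (2 * r j) u * u k = 0"
    if "u \<in> \<phi> j ` U j" "u \<notin> closed_box (mdim M) (c j) (4 * r j)" for u
    using box_bump_zero[of "2 * r j" u "mdim M" "c j"] frame_radius[OF j] that openin_subset[OF O] by auto
qed

lemma weight_smooth:
  assumes j: "j \<in> I"
  shows "smooth_real M (mpoints M) (weight j)"
proof -
  have S: "smooth_real M (mpoints M) (\<lambda>q. \<Sum>i\<in>I. bump i q)"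
    by (rule smooth_real_sum[OF M openin_topspace bump_smooth])
  have "smooth_real M (mpoints M) (\<lambda>q. inverse (\<Sum>i\<in>I. bump i q))"
    by (rule smooth_real_inverse[OF M openin_topspace S]) (metis bump_sum_pos less_irrefl)
  from smooth_real_mult[OF M openin_topspace bump_smooth[OF j] this]
  show ?thesis unfolding weight_def .
qed

lemma weight_sum: "q \<in> mpoints M \<Longrightarrow> (\<Sum>j\<in>I. weight j q) = 1"
  using bump_sum_pos[of q] by (simp add: weight_def sum_distrib_right[symmetric])

definition generators :: "('a \<Rightarrow> real) set" where
  "generators = (\<lambda>j. restrict (weight j) (mpoints M)) ` I \<union>
     (\<lambda>(j, k). restrict (coord j k) (mpoints M)) ` (I \<times> {..<mdim M})"

lemma finite_generators: "finite generators"
  unfolding generators_def using finite_I by simp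

lemma generators_invariant: "generators \<subseteq> Inv"
proof -
  have "bump j (\<alpha> g q) = bump j q" "coord j k (\<alpha> g q) = coord j k q" if "g \<in> carrier G" "q \<in> mpoints M" for j k g q
    using spread_act[OF that] by (simp_all add: bump_def coord_def)
  then have "restrict (weight j) (mpoints M) \<in> Inv" "restrict (coord j k) (mpoints M) \<in> Inv" if "j \<in> I" for j k
    using that by (auto intro!: InvI weight_smooth coord_smooth simp: weight_def)
  then show ?thesis unfolding generators_def by auto
qed

text \<open>A nonzero weight puts the orbit of q into the box of radius 2 r, where the cut-off
  equals 1; there the generators \<open>coord j k\<close> return the true coordinates of the
  representative in \<open>U j\<close>.\<close>

lemma weight_nonzeroE:
  assumes j: "j \<in> I" and w: "weight j q \<noteq> 0"
  obtains x where "x \<in> U j" "\<pi> x = \<pi> q" "\<phi> j x \<in> closed_box (mdim M) (c j) (2 * r j)"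
    "\<forall>k. coord j k q = \<phi> j x k"
proof -
  let ?x = "inv_into (U j) \<pi> (\<pi> q)"
  have b: "bump j q \<noteq> 0" using w by (auto simp: weight_def)
  then have q: "\<pi> q \<in> \<pi> ` U j" by (auto simp: bump_def spread_def split: if_splits)
  have x: "?x \<in> U j" "\<pi> ?x = \<pi> q" using inv_into_into[OF q] f_inv_into_f[OF q] .
  have R: "\<phi> j ?x \<in> Rn (mdim M)" using x(1) openin_subset[OF frame_open_range[OF j]] by blast
  have "box_bump (mdim M) (c j) (r j) (\<phi> j ?x) \<noteq> 0" using b q by (simp add: bump_def spread_def)
  then have box: "\<phi> j ?x \<in> closed_box (mdim M) (c j) (2 * r j)"
    using box_bump_zero[OF frame_radius[OF j] R] by blast
  have "2 * r j > 0" using frame_radius[OF j] by simp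
  from box_bump_one[OF this box] have "coord j k q = \<phi> j ?x k" for k
    using q by (simp add: coord_def spread_def)
  then show thesis using that x box by blast
qed

text \<open>Besides taking values in R^m, t has only to express the generators as smooth functions
  of it. This covers both uses: t the tuple of the generators themselves, with coordinate functions
  for A, and t given by any generating system.\<close>

lemma invariant_extension:
  fixes X :: "'x manifold"
  assumes X: "smooth_structure X"
    and f: "f \<in> invariant_functions G (\<lambda>g. map_prod id (\<alpha> g)) (prod_manifold X M)"
    and gen: "\<And>a. a \<in> generators \<Longrightarrow> \<exists>A. smooth_fun_on m (Rn m) A \<and> (\<forall>q\<in>mpoints M. A (t q) = a q)"
    and t: "\<And>q. q \<in> mpoints M \<Longrightarrow> t q \<in> Rn m"
  shows "\<exists>F\<in>smooth_functions (prod_manifold X (euclidean_manifold m)).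
    pullback (prod_manifold X M) (map_prod id t) F = f"
proof -
  let ?n = "mdim M" and ?P = "prod_manifold X M"
  let ?Em = "euclidean_manifold m" and ?En = "euclidean_manifold (mdim M)"
  let ?R = "prod_manifold X ?Em" and ?D = "prod_manifold X ?En"
  note Em = smooth_structure_euclidean[of m] and En = smooth_structure_euclidean[of "mdim M"]
  note P = smooth_structure_prod[OF X M] and R = smooth_structure_prod[OF X Em] and D = smooth_structure_prod[OF X En]
  have "\<forall>j\<in>I. \<exists>A. smooth_fun_on m (Rn m) A \<and> (\<forall>q\<in>mpoints M. A (t q) = weight j q)"
  proof
    fix j assume "j \<in> I"
    then have "restrict (weight j) (mpoints M) \<in> generators" unfolding generators_def by blast
    from gen[OF this] show "\<exists>A. smooth_fun_on m (Rn m) A \<and> (\<forall>q\<in>mpoints M. A (t q) = weight j q)" by simp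
  qed
  from bchoice[OF this] obtain A where A: "\<And>j. j \<in> I \<Longrightarrow> smooth_fun_on m (Rn m) (A j)"
    "\<And>j q. j \<in> I \<Longrightarrow> q \<in> mpoints M \<Longrightarrow> A j (t q) = weight j q" by auto
  have "\<forall>z\<in>I \<times> {..<?n}. \<exists>B. smooth_fun_on m (Rn m) B \<and> (\<forall>q\<in>mpoints M. B (t q) = coord (fst z) (snd z) q)"
  proof
    fix z assume z: "z \<in> I \<times> {..<?n}"
    then have "restrict (coord (fst z) (snd z)) (mpoints M) \<in> generators"
      unfolding generators_def by (intro UnI2 image_eqI[OF _ z]) (simp add: case_prod_beta)
    from gen[OF this] show "\<exists>B. smooth_fun_on m (Rn m) B \<and> (\<forall>q\<in>mpoints M. B (t q) = coord (fst z) (snd z) q)" by simp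
  qed
  from bchoice[OF this] obtain B' where B': "\<forall>z\<in>I \<times> {..<?n}. smooth_fun_on m (Rn m) (B' z) \<and>
    (\<forall>q\<in>mpoints M. B' z (t q) = coord (fst z) (snd z) q)" by (rule exE)
  define B where "B = (\<lambda>j k. B' (j, k))"
  have B: "smooth_fun_on m (Rn m) (B j k)" "q \<in> mpoints M \<Longrightarrow> B j k (t q) = coord j k q"
    if "j \<in> I" "k < ?n" for j k q using B' that by (auto simp: B_def)
  \<comment> \<open>\<open>Y j w\<close> reads off from w the would-be coordinates in chart j, with
    zeros from n on so that it lies in R^n. For w off the image of t it may fall outside the chart
    range.\<close>
  define Y where "Y = (\<lambda>j w k. if k < ?n then B j k w else 0)"
  \<comment> \<open>f in the coordinates of chart j, cut off and extended by zero, so that it is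
    smooth at those stray points as well.\<close>
  define H where "H = (\<lambda>j q. if snd q \<in> \<phi> j ` U j then
     box_bump ?n (c j) (2 * r j) (snd q) * f (fst q, inv_into (U j) (\<phi> j) (snd q)) else 0)"
  define F where "F = (\<lambda>q. \<Sum>j\<in>I. A j (snd q) * H j (fst q, Y j (snd q)))"
  have fP: "smooth_real ?P (mpoints ?P) f"
    using f by (simp add: invariant_functions_def smooth_functions_iff[OF P])
  have finv: "f (z, \<alpha> g q) = f (z, q)" if "g \<in> carrier G" "z \<in> mpoints X" "q \<in> mpoints M" for g z q
  proof -
    have "(z, q) \<in> mpoints ?P" using that by simp
    then have "f (map_prod id (\<alpha> g) (z, q)) = f (z, q)"
      using f that(1) unfolding invariant_functions_def by blast
    then show ?thesis by simp
  qed
  have top_R: "mpoints ?R = mpoints X \<times> Rn m" and top_D: "mpoints ?D = mpoints X \<times> Rn ?n" by simp_all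
  have "smooth_real ?R (mpoints ?R) F"
    unfolding F_def
  proof (intro smooth_real_sum[OF R openin_topspace] smooth_real_mult[OF R openin_topspace])
    fix j assume j: "j \<in> I"
    have "smooth_real ?R {q \<in> mpoints ?R. snd q \<in> Rn m} (\<lambda>q. A j (snd q))"
      by (rule smooth_map_real[OF R Em smooth_map_snd[OF X Em] _ smooth_real_euclideanI[OF openin_topspace A(1)[OF j]]])
        simp
    moreover have "{q \<in> mpoints ?R. snd q \<in> Rn m} = mpoints ?R" by auto
    ultimately show "smooth_real ?R (mpoints ?R) (\<lambda>q. A j (snd q))" by simp
    have Hs: "smooth_real ?D (mpoints ?D) (H j)"
      unfolding H_def top_D
    proof (rule smooth_real_cutoff_slice[OF X M frame_chart[OF j] fP frame_box[OF j]])
      show "smooth_fun_on ?n (Rn ?n) (box_bump ?n (c j) (2 * r j))"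
        by (rule smooth_fun_on_box_bump[OF openin_topspace])
      show "box_bump ?n (c j) (2 * r j) u = 0" if "u \<in> Rn ?n" "u \<notin> closed_box ?n (c j) (4 * r j)" for u
        using box_bump_zero[of "2 * r j" u ?n "c j"] frame_radius[OF j] that by simp
    qed
    have "smooth_map ?Em ?En (Y j)"
    proof (rule smooth_map_euclideanI[OF Em])
      show "Y j w \<in> Rn ?n" for w by (simp add: Y_def topspace_Euclidean_space)
      show "smooth_real ?Em (mpoints ?Em) (\<lambda>w. Y j w k)" if "k < ?n" for k
        using smooth_real_euclideanI[OF openin_topspace B(1)[OF j that]] that by (simp add: Y_def)
    qed
    from smooth_map_pair[OF X En R smooth_map_fst[OF X Em] smooth_map_compose[OF R Em En smooth_map_snd[OF X Em] this]]
    have pair: "smooth_map ?R ?D (\<lambda>q. (fst q, Y j (snd q)))" .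
    have "{q \<in> mpoints ?R. (fst q, Y j (snd q)) \<in> mpoints ?D} = mpoints ?R"
      by (auto simp: Y_def topspace_Euclidean_space)
    with smooth_map_real[OF R D pair openin_topspace Hs]
    show "smooth_real ?R (mpoints ?R) (\<lambda>q. H j (fst q, Y j (snd q)))" by simp
  qed
  then have Fs: "restrict F (mpoints ?R) \<in> smooth_functions ?R" by (rule smooth_functionsI[OF R])
  have F_value: "F (z, t q) = f (z, q)" if z: "z \<in> mpoints X" and q: "q \<in> mpoints M" for z q
  proof -
    \<comment> \<open>A vanishing weight kills the summand whatever H is. Otherwise the coordinates
      are genuine and the cut-off is 1, so H gives f at a representative x of the orbit of q, and
      invariance applies.\<close>
    have "A j (t q) * H j (z, Y j (t q)) = weight j q * f (z, q)" if j: "j \<in> I" for j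
    proof (cases "weight j q = 0")
      case False
      from weight_nonzeroE[OF j this] obtain x where x: "x \<in> U j" "\<pi> x = \<pi> q"
        "\<phi> j x \<in> closed_box ?n (c j) (2 * r j)" "\<forall>k. coord j k q = \<phi> j x k" .
      have xM: "x \<in> mpoints M" using x(1) mchart_subset_points[OF M frame_chart[OF j]] by blast
      have Rx: "\<phi> j x \<in> Rn ?n" using x(1) openin_subset[OF frame_open_range[OF j]] by blast
      have "Y j (t q) = (\<lambda>k. if k < ?n then \<phi> j x k else 0)"
        using B(2)[OF j _ q] x(4) by (auto simp: Y_def fun_eq_iff)
      then have Yx: "Y j (t q) = \<phi> j x" by (rule trans[OF _ Rn_ext[OF Rx]])
      have "2 * r j > 0" using frame_radius[OF j] by simp
      from box_bump_one[OF this x(3)] have "H j (z, Y j (t q)) = f (z, x)"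
        using x(1) mchart_inv[OF M frame_chart[OF j] x(1)] by (simp add: H_def Yx)
      moreover obtain g where "g \<in> carrier G" "q = \<alpha> g x" using orbit_eqE[OF xM q x(2)] .
      ultimately show ?thesis using finv[OF _ z xM] A(2)[OF j q] by simp
    qed (simp add: A(2)[OF j q])
    then have "F (z, t q) = (\<Sum>j\<in>I. weight j q * f (z, q))" by (simp add: F_def)
    also have "\<dots> = f (z, q)" using weight_sum[OF q] by (simp add: sum_distrib_right[symmetric])
    finally show ?thesis .
  qed
  have "pullback ?P (map_prod id t) (restrict F (mpoints ?R)) = f"
  proof
    fix p
    show "pullback ?P (map_prod id t) (restrict F (mpoints ?R)) p = f p"
    proof (cases "p \<in> mpoints ?P")
      case True
      then show ?thesis using F_value t by (auto simp: pullback_eq)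
    next
      case False
      moreover have "f \<in> extensional (mpoints ?P)"
        using f by (simp add: invariant_functions_def smooth_functions_def)
      ultimately have "f p = undefined" by (rule extensional_arb[rotated])
      then show ?thesis using False by (simp add: pullback_eq)
    qed
  qed
  then show ?thesis using Fs by blast
qed

end

section \<open>Existence of frames and of generating invariants\<close>

context free_proper_action
begin

lemma invariant_frame_exists:
  assumes "cocompact_action G \<alpha> M"
  shows "\<exists>(I :: 'a set) U \<phi> c r. invariant_frame G \<alpha> M I U \<phi> c r"
proof -
  \<comment> \<open>Domain, coordinates and radius are packed into one z, so that a single choice
    over the points suffices.\<close>
  have "\<forall>p\<in>mpoints M. \<exists>z. (fst z, fst (snd z)) \<in> mcharts M \<and> p \<in> fst z \<and> inj_on \<pi> (fst z) \<and> snd (snd z) > 0 \<and>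
     closed_box (mdim M) (fst (snd z) p) (4 * snd (snd z)) \<subseteq> fst (snd z) ` fst z"
  proof
    fix p assume "p \<in> mpoints M"
    from small_chart[OF openin_topspace this] obtain U \<phi> where U: "(U, \<phi>) \<in> mcharts M" "p \<in> U" "inj_on \<pi> U" .
    from Rn_box_obtain[OF mchart_open_range[OF M U(1)] imageI[OF U(2)]] obtain e
      where e: "e > 0" "open_box (mdim M) (\<phi> p) e \<subseteq> \<phi> ` U" .
    \<comment> \<open>With radius e / 5 even the box of fourfold radius stays strictly inside the
      open box of radius e.\<close>
    have "closed_box (mdim M) (\<phi> p) (4 * (e / 5)) \<subseteq> \<phi> ` U"
      by (rule order_trans[OF closed_box_subset_open_box e(2)]) (use e(1) in simp)
    then show "\<exists>z. (fst z, fst (snd z)) \<in> mcharts M \<and> p \<in> fst z \<and> inj_on \<pi> (fst z) \<and> snd (snd z) > 0 \<and>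
     closed_box (mdim M) (fst (snd z) p) (4 * snd (snd z)) \<subseteq> fst (snd z) ` fst z"
      using U e(1) by (intro exI[of _ "(U, \<phi>, e / 5)"]) simp
  qed
  from bchoice[OF this] obtain z where z: "\<forall>p\<in>mpoints M. (fst (z p), fst (snd (z p))) \<in> mcharts M \<and> p \<in> fst (z p) \<and>
     inj_on \<pi> (fst (z p)) \<and> snd (snd (z p)) > 0 \<and>
     closed_box (mdim M) (fst (snd (z p)) p) (4 * snd (snd (z p))) \<subseteq> fst (snd (z p)) ` fst (z p)" by (rule exE)
  define U \<phi> r where "U = (\<lambda>p. fst (z p))" and "\<phi> = (\<lambda>p. fst (snd (z p)))" and "r = (\<lambda>p. snd (snd (z p)))"
  have fr: "(U p, \<phi> p) \<in> mcharts M" "p \<in> U p" "inj_on \<pi> (U p)" "r p > 0"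
    "closed_box (mdim M) (\<phi> p p) (4 * r p) \<subseteq> \<phi> p ` U p" if "p \<in> mpoints M" for p
    using bspec[OF z that] by (auto simp: U_def \<phi>_def r_def)
  define V where "V = (\<lambda>p. {q \<in> U p. \<phi> p q \<in> open_box (mdim M) (\<phi> p p) (r p)})"
  have V: "openin (mtop M) (V p)" "p \<in> V p" if "p \<in> mpoints M" for p
  proof -
    show "openin (mtop M) (V p)"
      unfolding V_def by (rule chart_open_vimage[OF mcharts_is_chart[OF M fr(1)[OF that]] openin_open_box])
    have "\<phi> p p \<in> Rn (mdim M)" by (rule chart_in_Rn[OF mcharts_is_chart[OF M fr(1)[OF that]] fr(2)[OF that]])
    then show "p \<in> V p" using fr[OF that] by (simp add: V_def open_box_def)
  qed
  \<comment> \<open>The images of the r-boxes form an open cover of the orbit space; cocompactness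
    leaves finitely many centres, which serve as index set.\<close>
  let ?\<U> = "(\<lambda>p. \<pi> ` V p) ` mpoints M"
  have "compactin TQ (topspace TQ)" using assms by (simp add: cocompact_action_def compact_space_def)
  moreover have "\<forall>W\<in>?\<U>. openin TQ W" using orbit_open V(1) by blast
  moreover have "topspace TQ \<subseteq> \<Union>?\<U>" unfolding points_Q using V(2) by blast
  ultimately obtain \<F> where \<F>: "finite \<F>" "\<F> \<subseteq> ?\<U>" "topspace TQ \<subseteq> \<Union>\<F>"
    unfolding compactin_def by meson
  from finite_subset_image[OF \<F>(1,2)] obtain I where I: "I \<subseteq> mpoints M" "finite I" "\<F> = (\<lambda>p. \<pi> ` V p) ` I"
    by blast
  have "invariant_frame G \<alpha> M I U \<phi> (\<lambda>p. \<phi> p p) r"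
  proof
    show "finite I" by (rule I(2))
    show "(U j, \<phi> j) \<in> mcharts M" "inj_on \<pi> (U j)" "r j > 0"
      "closed_box (mdim M) (\<phi> j j) (4 * r j) \<subseteq> \<phi> j ` U j" if "j \<in> I" for j
      using fr[of j] that I(1) by auto
    fix q assume "q \<in> mpoints M"
    then have "\<pi> q \<in> \<Union>\<F>" using \<F>(3) points_Q by blast
    then obtain j where j: "j \<in> I" "\<pi> q \<in> \<pi> ` V j" using I(3) by blast
    then obtain x where "x \<in> V j" "\<pi> x = \<pi> q" by (metis imageE)
    then have "x \<in> U j" "\<phi> j x \<in> closed_box (mdim M) (\<phi> j j) (r j)"
      using open_box_subset_closed_box unfolding V_def by blast+
    then show "\<exists>j\<in>I. \<exists>x\<in>U j. \<pi> x = \<pi> q \<and> \<phi> j x \<in> closed_box (mdim M) (\<phi> j j) (r j)"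
      using j(1) \<open>\<pi> x = \<pi> q\<close> by blast
  qed
  then show ?thesis by blast
qed

lemma smooth_map_tuple:
  assumes "\<And>i. i < m \<Longrightarrow> s i \<in> Inv"
  shows "smooth_map M (euclidean_manifold m) (tuple_map m s)"
proof (rule smooth_map_euclideanI[OF M tuple_map_in_Rn])
  fix i assume i: "i < m"
  then have "smooth_real M (mpoints M) (s i)" using InvD[OF assms] by (simp add: smooth_functions_iff[OF M])
  then show "smooth_real M (mpoints M) (\<lambda>p. tuple_map m s p i)" using i by (simp add: tuple_map_def)
qed

lemma tuple_map_act:
  assumes "\<And>i. i < m \<Longrightarrow> s i \<in> Inv" "g \<in> carrier G" "p \<in> mpoints M"
  shows "tuple_map m s (\<alpha> g p) = tuple_map m s p"
  using Inv_act[OF assms(1) assms(2,3)] by (auto simp: tuple_map_def fun_eq_iff)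

lemma pullback_tuple_Inv:
  assumes s: "\<And>i. i < m \<Longrightarrow> s i \<in> Inv" and F: "F \<in> smooth_functions (euclidean_manifold m)"
  shows "pullback M (tuple_map m s) F \<in> Inv"
proof -
  have "pullback M (tuple_map m s) F \<in> smooth_functions M"
    by (rule smooth_functions_pullback[OF M smooth_structure_euclidean smooth_map_tuple[OF s] F])
  then show ?thesis
    using tuple_map_act[OF s] act_closed by (simp add: invariant_functions_def pullback_eq)
qed

text \<open>Taking for X the one-point manifold R^0 turns the extension with parameter into the one
  without; the tuple lists the finitely many generators of a frame.\<close>

lemma generating_invariants_exist:
  assumes "cocompact_action G \<alpha> M"
  shows "\<exists>m s. generating_invariants G \<alpha> M m s"
proof -
  obtain I :: "'a set" and U \<phi> c r where "invariant_frame G \<alpha> M I U \<phi> c r"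
    using invariant_frame_exists[OF assms] by blast
  then interpret fr: invariant_frame G \<alpha> M I U \<phi> c r .
  obtain l where l: "set l = fr.generators" using finite_list[OF fr.finite_generators] by blast
  define m where "m = length l"
  define s where "s = (\<lambda>i. l ! i)"
  let ?t = "tuple_map m s" and ?Em = "euclidean_manifold m" and ?X = "euclidean_manifold 0"
  have s: "s i \<in> Inv" if "i < m" for i
    using that l fr.generators_invariant by (auto simp: m_def s_def)
  note E0 = smooth_structure_euclidean[of 0] and Em = smooth_structure_euclidean[of m]
  note P = smooth_structure_prod[OF E0 M] and R = smooth_structure_prod[OF E0 Em]
  define z where "z = (\<lambda>_ :: nat. 0 :: real)"
  have z: "z \<in> Rn 0" by (simp add: z_def topspace_Euclidean_space)
  \<comment> \<open>Each generator is a component of the tuple, so a coordinate function expresses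
    it.\<close>
  have gen: "\<exists>A. smooth_fun_on m (Rn m) A \<and> (\<forall>q\<in>mpoints M. A (?t q) = a q)" if a: "a \<in> fr.generators" for a
  proof -
    have "a \<in> set l" using a l by simp
    then obtain i where i: "i < m" "s i = a" unfolding m_def s_def in_set_conv_nth by blast
    have "\<forall>q\<in>mpoints M. ?t q i = a q" using i by (simp add: tuple_map_def)
    then show ?thesis using smooth_fun_on_coord[OF openin_topspace, of m i] by blast
  qed
  have "\<exists>F\<in>smooth_functions ?Em. pullback M ?t F = f" if f: "f \<in> Inv" for f
  proof -
    let ?f = "pullback (prod_manifold ?X M) snd f"
    have "?f \<in> smooth_functions (prod_manifold ?X M)"
      by (rule smooth_functions_pullback[OF P M smooth_map_snd[OF E0 M] InvD[OF f]])
    then have "?f \<in> invariant_functions G (\<lambda>g. map_prod id (\<alpha> g)) (prod_manifold ?X M)"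
      using Inv_act[OF f] act_closed by (auto simp: invariant_functions_def pullback_eq)
    from fr.invariant_extension[OF E0 this gen tuple_map_in_Rn] obtain F where
      F: "F \<in> smooth_functions (prod_manifold ?X ?Em)" "pullback (prod_manifold ?X M) (map_prod id ?t) F = ?f" by blast
    \<comment> \<open>The embedding of R^m as the slice over z brings the function found on R^0
      \<times> R^m back to R^m.\<close>
    have "smooth_map ?Em ?X (\<lambda>w. z)" by (rule smooth_map_euclideanI[OF Em]) (use z in simp_all)
    moreover have "smooth_map ?Em ?Em (\<lambda>w. w)"
      by (rule smooth_map_euclideanI[OF Em])
        (simp_all add: smooth_real_euclideanI smooth_fun_on_coord)
    ultimately have "smooth_map ?Em (prod_manifold ?X ?Em) (\<lambda>w. (z, w))"
      by (rule smooth_map_pair[OF E0 Em Em])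
    from smooth_functions_pullback[OF Em R this F(1)]
    have "pullback ?Em (\<lambda>w. (z, w)) F \<in> smooth_functions ?Em" .
    moreover have "pullback M ?t (pullback ?Em (\<lambda>w. (z, w)) F) = f"
    proof
      fix p
      show "pullback M ?t (pullback ?Em (\<lambda>w. (z, w)) F) p = f p"
      proof (cases "p \<in> mpoints M")
        case True
        then show ?thesis using fun_cong[OF F(2), of "(z, p)"] z by (simp add: pullback_eq tuple_map_in_Rn)
      next
        case False
        then show ?thesis
          using smooth_functions_extensional[OF M InvD[OF f]] by (simp add: pullback_eq extensional_def)
      qed
    qed
    ultimately show ?thesis by blast
  qed
  then have "pullback M ?t ` smooth_functions ?Em = Inv" using pullback_tuple_Inv[OF s] by auto
  then show ?thesis unfolding generating_invariants_def using s by blast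
qed

text \<open>The generators of a frame are invariants of M, so by hypothesis each is a smooth
  function of the given tuple. This is exactly the input of the extension argument, whatever X
  is.\<close>

lemma generating_invariants_product:
  fixes X :: "'x manifold"
  assumes "cocompact_action G \<alpha> M" and gen: "generating_invariants G \<alpha> M m s" and X: "smooth_structure X"
  shows "pullback (prod_manifold X M) (map_prod id (tuple_map m s)) `
     smooth_functions (prod_manifold X (euclidean_manifold m)) =
     invariant_functions G (\<lambda>g. map_prod id (\<alpha> g)) (prod_manifold X M)"
proof -
  obtain I :: "'a set" and U \<phi> c r where "invariant_frame G \<alpha> M I U \<phi> c r"
    using invariant_frame_exists[OF assms(1)] by blast
  then interpret fr: invariant_frame G \<alpha> M I U \<phi> c r .
  let ?t = "tuple_map m s" and ?Em = "euclidean_manifold m"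
  note Em = smooth_structure_euclidean[of m]
  note P = smooth_structure_prod[OF X M] and R = smooth_structure_prod[OF X Em]
  have s: "\<And>i. i < m \<Longrightarrow> s i \<in> Inv" and im: "pullback M ?t ` smooth_functions ?Em = Inv"
    using gen by (auto simp: generating_invariants_def)
  have A: "\<exists>A. smooth_fun_on m (Rn m) A \<and> (\<forall>q\<in>mpoints M. A (?t q) = a q)" if a: "a \<in> fr.generators" for a
  proof -
    have "a \<in> pullback M ?t ` smooth_functions ?Em" using a fr.generators_invariant im by blast
    then obtain A where A: "A \<in> smooth_functions ?Em" "a = pullback M ?t A" by blast
    have "smooth_real ?Em (Rn m) A" using A(1) by (simp add: smooth_functions_iff[OF Em])
    then have "smooth_fun_on m (Rn m) A" by (rule smooth_real_euclideanD[OF openin_topspace])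
    moreover have "\<forall>q\<in>mpoints M. A (?t q) = a q" unfolding A(2) by (simp add: pullback_eq)
    ultimately show ?thesis by blast
  qed
  have eq: "map_prod id ?t = (\<lambda>z. (fst z, ?t (snd z)))" by (auto simp: fun_eq_iff)
  have sm: "smooth_map (prod_manifold X M) (prod_manifold X ?Em) (map_prod id ?t)"
    unfolding eq
    by (rule smooth_map_pair[OF X Em P smooth_map_fst[OF X M]
          smooth_map_compose[OF P M Em smooth_map_snd[OF X M] smooth_map_tuple[OF s]]])
  show ?thesis
  proof (rule subset_antisym; rule subsetI)
    fix f assume "f \<in> pullback (prod_manifold X M) (map_prod id ?t) ` smooth_functions (prod_manifold X ?Em)"
    then obtain F where F: "F \<in> smooth_functions (prod_manifold X ?Em)" "f = pullback (prod_manifold X M) (map_prod id ?t) F"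
      by blast
    have "f \<in> smooth_functions (prod_manifold X M)"
      unfolding F(2) by (rule smooth_functions_pullback[OF P R sm F(1)])
    then show "f \<in> invariant_functions G (\<lambda>g. map_prod id (\<alpha> g)) (prod_manifold X M)"
      using tuple_map_act[OF s] act_closed by (auto simp: F(2) invariant_functions_def pullback_eq)
  next
    fix f assume "f \<in> invariant_functions G (\<lambda>g. map_prod id (\<alpha> g)) (prod_manifold X M)"
    from fr.invariant_extension[OF X this A tuple_map_in_Rn]
    show "f \<in> pullback (prod_manifold X M) (map_prod id ?t) ` smooth_functions (prod_manifold X ?Em)" by blast
  qed
qed

end

theorem theoremC:
  fixes G :: "('g, 'b) monoid_scheme"
    and \<alpha> :: "'g \<Rightarrow> 'a \<Rightarrow> 'a"
    and M :: "'a manifold"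
  assumes "smooth_manifold M"
    and "smooth_action G \<alpha> M"
    and "free_action G \<alpha> M"
    and "proper_action G \<alpha> M"
    and "cocompact_action G \<alpha> M"
  shows
    "frechet_isomorphism
       (mpoints (quotient_manifold G \<alpha> M)) (cinf_topology (quotient_manifold G \<alpha> M))
       (mpoints M) (subtopology (cinf_topology M) (invariant_functions G \<alpha> M))
       (pullback M (orbit G \<alpha>)) \<and>
     (\<exists>m s. generating_invariants G \<alpha> M m s) \<and>
     (\<forall>m s. generating_invariants G \<alpha> M m s \<longrightarrow>
        (\<forall>X :: 'x manifold. smooth_manifold X \<longrightarrow>
           pullback (prod_manifold X M) (map_prod id (tuple_map m s)) `
             smooth_functions (prod_manifold X (euclidean_manifold m)) =
           invariant_functions G (\<lambda>g. map_prod id (\<alpha> g)) (prod_manifold X M)))"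
proof -
  interpret free_proper_action G \<alpha> M using assms(1-4) by unfold_locales
  show ?thesis
    \<comment> \<open>From here on the definite description is replaced by the explicit structure
      Q.\<close>
    unfolding quotient_manifold_eq
  proof (intro conjI allI impI frechet_isomorphism_pullback generating_invariants_exist[OF assms(5)])
    fix m s and X :: "'x manifold"
    assume "generating_invariants G \<alpha> M m s" "smooth_manifold X"
    then show "pullback (prod_manifold X M) (map_prod id (tuple_map m s)) `
        smooth_functions (prod_manifold X (euclidean_manifold m)) =
        invariant_functions G (\<lambda>g. map_prod id (\<alpha> g)) (prod_manifold X M)"
      by (intro generating_invariants_product[OF assms(5)]) (simp_all add: smooth_manifold_iff)
  qed
qed

end
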